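(* Let $r\in[0,T)$ and assume that the law of a process $(Y,C)$ solves the local martingale problem for $(\mathcal{A}_t)_{t\in[r,T]}$ (see context). Let $m$ be a natural number. Assume that the coefficients of $(\mathcal{A}_t)_{t\in[r,T]}$ satisfy: (LB) the mapping $(t,y,c)\mapsto\int_{\{|F(t,y,c,x)|>1\}}|F(t,y,c,x)|\,\nu(dx)$ is locally bounded; (LG) there is $K_1>0$ such that for all $(t,y,c)$ $$|\mu(t,y,c)|^2+\|\sigma(t,y,c)\sigma(t,y,c)^\top\|+\int_{\|x\|\le a}|F(t,y,c,x)|^2\,\nu(dx)\le K_1(1+|y|^2);$$ and that there exist constants $K_3,K_4$ such that for all $(t,y,c)$ $$\int_{\|x\|>a}|F(t,y,c,x)|^2\,\nu(dx)+|\rho^{c,k}(t,y)|^2\le K_3(1+|y|^2)\quad\text{for }k\in\mathcal{K},\ k\neq c,$$ $$\int_{\mathbf{R}^n}|F(t,y,c,x)|^{2m}\,\nu(dx)\le K_4(1+|y|^{2m}).$$ Then $$\mathbf{E}\Big(\sup_{t\in[r,T]}|Y_t|^{2m}\Big)<\infty.$$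
   Context: Fix $T\in(0,\infty)$, $a>0$, positive integers $d,n,p,K$, and $\mathcal{K}=\{1,\dots,K\}$. $\nu$ is a L\'evy measure on $\mathbf{R}^n$: $\nu(\{0\})=0$, $\int(\|x\|^2\wedge1)\nu(dx)<\infty$. "Locally bounded" means bounded on compact sets. For a matrix $A$, $\|A\|^2=\sum_{i,j}|a_{i,j}|^2$. Standing assumptions on the (deterministic) coefficients: $\mu:[0,T]\times\mathbf{R}^d\times\mathcal{K}\to\mathbf{R}^d$, $\sigma:[0,T]\times\mathbf{R}^d\times\mathcal{K}\to\mathbf{R}^{d\times p}$, $\rho^{i,j}:[0,T]\times\mathbf{R}^d\to\mathbf{R}^d$ ($i\neq j$ in $\mathcal{K}$) are measurable and locally bounded; $F:[0,T]\times\mathbf{R}^d\times\mathcal{K}\times\mathbf{R}^n\to\mathbf{R}^d$ is measurable and $(t,y,c)\mapsto\int_{\|x\|\le a}|F(t,y,c,x)|^2\nu(dx)$ is locally bounded; $\lambda^{i,j}:[0,T]\times\mathbf{R}^d\to[0,\infty)$ ($i\ne j$) are bounded and continuous. $C^2_c$ is the set of compactly supported $v:\mathbf{R}^d\times\mathcal{K}\to\mathbf{R}$ with $v(\cdot,k)\in C^2(\mathbf{R}^d)$ for each $k$. For $v\in C^2_c$, $$\begin{aligned}\mathcal{A}_tv(y,c)=&\ \nabla v(y,c)\mu(t,y,c)+\tfrac12\mathrm{Tr}\big(\sigma(t,y,c)\sigma(t,y,c)^\top\nabla^2v(y,c)\big)\\&+\int_{\mathbf{R}^n}\big(v(y+F(t,y,c,x),c)-v(y,c)-\nabla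 v(y,c)F(t,y,c,x)\mathbf{1}_{\{\|x\|\le a\}}\big)\nu(dx)\\&+\sum_{k\in\mathcal{K}\setminus\{c\}}\big(v(y+\rho^{c,k}(t,y),k)-v(y,c)\big)\lambda^{c,k}(t,y),\end{aligned}$$ with derivatives in $y$. The law of a c\`adl\`ag $\mathbf{R}^d\times\mathcal{K}$-valued process $(Y,C)$ solves the local martingale problem for $(\mathcal{A}_t)_{t\in[r,T]}$ (started at time $r$, with initial distribution the law of $(Y_r,C_r)$) if for every $v\in C^2_c$ the process $M^v_t=v(Y_t,C_t)-\int_r^t\mathcal{A}_uv(Y_{u-},C_{u-})du$ is a local martingale on $[r,T]$ with respect to the filtration generated by $(Y,C)$ on $[r,T]$.
   Formalization: The formal theorem adds the assumption that E|Y_r|^{2m} is finite; without it the claim fails (all coefficients zero, Y constant in time with infinite 2m-th moment), and the conclusion itself implies it. *)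

theory Defs
  imports "HOL-Probability.Probability"
begin

text \<open>
  The regimes are the elements of \<open>{1..K}\<close> in the type \<^typ>\<open>nat\<close>, whose topology is discrete.
  Functions of \<open>(t, y, c)\<close> are total in Isabelle/HOL; every condition on them is restricted to
  \<open>t \<in> [0, T]\<close> (or \<open>[r, T]\<close>) and \<open>c \<in> {1..K}\<close>, and values elsewhere are irrelevant.
\<close>

definition levy_measure :: "(real^'n) measure \<Rightarrow> bool" where
  "levy_measure \<nu> \<longleftrightarrow>
     sets \<nu> = sets borel \<and> emeasure \<nu> {0} = 0 \<and>
     (\<integral>\<^sup>+x. ennreal (min ((norm x)\<^sup>2) 1) \<partial>\<nu>) < \<infinity>"

definition locally_bounded_on :: "'a::topological_space set \<Rightarrow> ('a \<Rightarrow> ennreal) \<Rightarrow> bool" where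
  "locally_bounded_on S g \<longleftrightarrow>
     (\<forall>Q. compact Q \<and> Q \<subseteq> S \<longrightarrow> (\<exists>B::real. \<forall>z\<in>Q. g z \<le> ennreal B))"

text \<open>
  The standing assumptions on the coefficients. The Euclidean norm of the type \<^typ>\<open>real^'p^'d\<close>
  is the Frobenius norm of a matrix with rows indexed by \<open>'d\<close> and columns indexed by \<open>'p\<close>.
  Nonnegative integrals, possibly infinite, are \<open>ennreal\<close>-valued.
\<close>

definition standing_assumptions ::
  "real \<Rightarrow> real \<Rightarrow> nat \<Rightarrow> (real^'n) measure \<Rightarrow>
   (real \<Rightarrow> real^'d \<Rightarrow> nat \<Rightarrow> real^'d) \<Rightarrow>
   (real \<Rightarrow> real^'d \<Rightarrow> nat \<Rightarrow> real^'p^'d) \<Rightarrow>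
   (real \<Rightarrow> real^'d \<Rightarrow> nat \<Rightarrow> real^'n \<Rightarrow> real^'d) \<Rightarrow>
   (nat \<Rightarrow> nat \<Rightarrow> real \<Rightarrow> real^'d \<Rightarrow> real^'d) \<Rightarrow>
   (nat \<Rightarrow> nat \<Rightarrow> real \<Rightarrow> real^'d \<Rightarrow> real) \<Rightarrow> bool" where
  "standing_assumptions T a K \<nu> \<mu> \<sigma> F \<rho> lam \<longleftrightarrow>
     (let S = {0..T} \<times> (UNIV :: (real^'d) set) \<times> {1..K};
          S' = {0..T} \<times> (UNIV :: (real^'d) set)
      in
       levy_measure \<nu> \<and>
       (\<lambda>(t, y, c). \<mu> t y c) \<in> borel_measurable (restrict_space borel S) \<and>
       locally_bounded_on S (\<lambda>(t, y, c). ennreal (norm (\<mu> t y c))) \<and>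
       (\<lambda>(t, y, c). \<sigma> t y c) \<in> borel_measurable (restrict_space borel S) \<and>
       locally_bounded_on S (\<lambda>(t, y, c). ennreal (norm (\<sigma> t y c))) \<and>
       (\<forall>i\<in>{1..K}. \<forall>j\<in>{1..K} - {i}.
          (\<lambda>(t, y). \<rho> i j t y) \<in> borel_measurable (restrict_space borel S') \<and>
          locally_bounded_on S' (\<lambda>(t, y). ennreal (norm (\<rho> i j t y)))) \<and>
       (\<lambda>(t, y, c, x). F t y c x)
          \<in> borel_measurable (restrict_space borel ({0..T} \<times> UNIV \<times> {1..K} \<times> UNIV)) \<and>
       locally_bounded_on S
          (\<lambda>(t, y, c). \<integral>\<^sup>+x\<in>{x. norm x \<le> a}. ennreal ((norm (F t y c x))\<^sup>2) \<partial>\<nu>) \<and>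
       (\<forall>i\<in>{1..K}. \<forall>j\<in>{1..K} - {i}.
          continuous_on S' (\<lambda>(t, y). lam i j t y) \<and>
          (\<forall>t\<in>{0..T}. \<forall>y. 0 \<le> lam i j t y) \<and>
          (\<exists>B. \<forall>t\<in>{0..T}. \<forall>y. lam i j t y \<le> B)))"

definition grad :: "(real^'d \<Rightarrow> real) \<Rightarrow> real^'d \<Rightarrow> real^'d" where
  "grad f y = (\<chi> i. frechet_derivative f (at y) (axis i 1))"

definition hessian :: "(real^'d \<Rightarrow> real) \<Rightarrow> real^'d \<Rightarrow> real^'d^'d" where
  "hessian f y = jacobian (grad f) (at y)"

definition C2 :: "(real^'d \<Rightarrow> real) \<Rightarrow> bool" where
  "C2 f \<longleftrightarrow> (\<forall>y. f differentiable (at y)) \<and> (\<forall>y. grad f differentiable (at y)) \<and>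
     continuous_on UNIV (hessian f)"

text \<open>Since \<open>{1..K}\<close> is finite, compact support on \<open>\<real>\<^sup>d \<times> {1..K}\<close> means compact support in each regime.\<close>

definition C2c :: "nat \<Rightarrow> (real^'d \<Rightarrow> nat \<Rightarrow> real) set" where
  "C2c K = {v. \<forall>k\<in>{1..K}. C2 (\<lambda>y. v y k) \<and> compact (closure {y. v y k \<noteq> 0})}"

definition generator ::
  "real \<Rightarrow> nat \<Rightarrow> (real^'n) measure \<Rightarrow>
   (real \<Rightarrow> real^'d \<Rightarrow> nat \<Rightarrow> real^'d) \<Rightarrow>
   (real \<Rightarrow> real^'d \<Rightarrow> nat \<Rightarrow> real^'p^'d) \<Rightarrow>
   (real \<Rightarrow> real^'d \<Rightarrow> nat \<Rightarrow> real^'n \<Rightarrow> real^'d) \<Rightarrow>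
   (nat \<Rightarrow> nat \<Rightarrow> real \<Rightarrow> real^'d \<Rightarrow> real^'d) \<Rightarrow>
   (nat \<Rightarrow> nat \<Rightarrow> real \<Rightarrow> real^'d \<Rightarrow> real) \<Rightarrow>
   real \<Rightarrow> (real^'d \<Rightarrow> nat \<Rightarrow> real) \<Rightarrow> real^'d \<Rightarrow> nat \<Rightarrow> real" where
  "generator a K \<nu> \<mu> \<sigma> F \<rho> lam t v y c =
     grad (\<lambda>z. v z c) y \<bullet> \<mu> t y c
     + 1/2 * trace (\<sigma> t y c ** transpose (\<sigma> t y c) ** hessian (\<lambda>z. v z c) y)
     + (\<integral>x. v (y + F t y c x) c - v y c
             - (grad (\<lambda>z. v z c) y \<bullet> F t y c x) * indicator {x. norm x \<le> a} x \<partial>\<nu>)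
     + (\<Sum>k\<in>{1..K} - {c}. (v (y + \<rho> c k t y) k - v y c) * lam c k t y)"

definition cadlag_on :: "real \<Rightarrow> real \<Rightarrow> (real \<Rightarrow> 'a::topological_space) \<Rightarrow> bool" where
  "cadlag_on r T f \<longleftrightarrow>
     (\<forall>t\<in>{r..<T}. (f \<longlongrightarrow> f t) (at_right t)) \<and>
     (\<forall>t\<in>{r<..T}. \<exists>l. (f \<longlongrightarrow> l) (at_left t))"

definition generated_filtration ::
  "'w measure \<Rightarrow> real \<Rightarrow> (real \<Rightarrow> 'w \<Rightarrow> 'a::topological_space) \<Rightarrow> real \<Rightarrow> 'w measure" where
  "generated_filtration M r X t =
     sigma (space M) (\<Union>s\<in>{r..t}. {X s -` A \<inter> space M | A. A \<in> sets borel})"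

definition martingale_on ::
  "'w measure \<Rightarrow> (real \<Rightarrow> 'w measure) \<Rightarrow> real \<Rightarrow> real \<Rightarrow> (real \<Rightarrow> 'w \<Rightarrow> real) \<Rightarrow> bool" where
  "martingale_on M G r T X \<longleftrightarrow>
     (\<forall>t\<in>{r..T}. X t \<in> borel_measurable (G t) \<and> integrable M (X t)) \<and>
     (\<forall>s\<in>{r..T}. \<forall>t\<in>{s..T}. AE \<omega> in M. real_cond_exp M (G s) (X t) \<omega> = X s \<omega>)"

text \<open>
  On the closed interval \<open>[r, T]\<close> a localizing sequence has to reach the end point \<open>T\<close> after
  finitely many steps (almost surely); convergence to \<open>T\<close> from below would only give a local
  martingale on \<open>[r, T)\<close>.
\<close>

definition local_martingale_on ::
  "'w measure \<Rightarrow> (real \<Rightarrow> 'w measure) \<Rightarrow> real \<Rightarrow> real \<Rightarrow> (real \<Rightarrow> 'w \<Rightarrow> real) \<Rightarrow> bool" where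
  "local_martingale_on M G r T X \<longleftrightarrow>
     (\<forall>t\<in>{r..T}. X t \<in> borel_measurable (G t)) \<and>
     (\<forall>\<omega>\<in>space M. cadlag_on r T (\<lambda>t. X t \<omega>)) \<and>
     (\<exists>\<tau> :: nat \<Rightarrow> 'w \<Rightarrow> real.
        (\<forall>n. stopping_time G (\<tau> n)) \<and>
        (\<forall>n. \<forall>\<omega>\<in>space M. r \<le> \<tau> n \<omega> \<and> \<tau> n \<omega> \<le> \<tau> (Suc n) \<omega> \<and> \<tau> n \<omega> \<le> T) \<and>
        (AE \<omega> in M. \<exists>n. \<tau> n \<omega> = T) \<and>
        (\<forall>n. martingale_on M G r T (\<lambda>t \<omega>. X (min t (\<tau> n \<omega>)) \<omega>)))"

definition mg_process ::
  "real \<Rightarrow> (real \<Rightarrow> (real^'d \<Rightarrow> nat \<Rightarrow> real) \<Rightarrow> real^'d \<Rightarrow> nat \<Rightarrow> real) \<Rightarrow>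
   (real \<Rightarrow> 'w \<Rightarrow> real^'d) \<Rightarrow> (real \<Rightarrow> 'w \<Rightarrow> nat) \<Rightarrow>
   (real^'d \<Rightarrow> nat \<Rightarrow> real) \<Rightarrow> real \<Rightarrow> 'w \<Rightarrow> real" where
  "mg_process r A Y C v t \<omega> =
     v (Y t \<omega>) (C t \<omega>)
     - (LINT u:{r..t}|lborel. A u v (Lim (at_left u) (\<lambda>s. Y s \<omega>)) (Lim (at_left u) (\<lambda>s. C s \<omega>)))"

text \<open>
  The property below depends on \<open>(M, Y, C)\<close> only through the law of \<open>(Y, C)\<close>, because the
  filtration is the one generated by \<open>(Y, C)\<close>. Paths are indexed by all reals, but only their
  restriction to \<open>[r, T]\<close> enters.
\<close>

definition solves_local_martingale_problem ::
  "'w measure \<Rightarrow> real \<Rightarrow> real \<Rightarrow> nat \<Rightarrow>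
   (real \<Rightarrow> (real^'d \<Rightarrow> nat \<Rightarrow> real) \<Rightarrow> real^'d \<Rightarrow> nat \<Rightarrow> real) \<Rightarrow>
   (real \<Rightarrow> 'w \<Rightarrow> real^'d) \<Rightarrow> (real \<Rightarrow> 'w \<Rightarrow> nat) \<Rightarrow> bool" where
  "solves_local_martingale_problem M r T K A Y C \<longleftrightarrow>
     prob_space M \<and>
     (\<forall>t\<in>{r..T}. Y t \<in> borel_measurable M \<and> C t \<in> borel_measurable M) \<and>
     (\<forall>\<omega>\<in>space M. (\<forall>t\<in>{r..T}. C t \<omega> \<in> {1..K}) \<and> cadlag_on r T (\<lambda>t. (Y t \<omega>, C t \<omega>))) \<and>
     (\<forall>v\<in>C2c K.
        local_martingale_on M (generated_filtration M r (\<lambda>t \<omega>. (Y t \<omega>, C t \<omega>))) r T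
          (mg_process r A Y C v))"

end

theory Submission
  imports Defs
begin

text \<open>
  Write \<open>x = 1 + |y|\<^sup>2\<close>. A radial function \<open>v(y) = f(x)\<close> with \<open>|f| \<le> W\<close>, \<open>|f'| \<le> W / x\<close>
  and \<open>|f''| \<le> W / x\<^sup>2\<close> satisfies \<open>|A\<^sub>t v(y, c)| \<le> L W(x)\<close>, where \<open>L\<close> depends neither on
  \<open>f\<close> nor on the weight \<open>W\<close>, as long as \<open>W\<close> is increasing and \<open>W(l x) \<le> l\<^sup>m W(x)\<close> for
  \<open>l \<ge> 1\<close>. Multiplying \<open>f\<close> by the cutoff \<open>max(0, 1 - x/R)\<^sup>3\<close> keeps these bounds uniformly
  in \<open>R\<close>, so only compactly supported test functions are needed. Their local martingales are
  bounded, hence martingales, and no localization by exit times is necessary.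

  The weights \<open>(x / (1 + e x))\<^sup>m\<close> with \<open>e > 0\<close> are bounded, so letting \<open>R \<rightarrow> \<infinity>\<close> and applying
  Gronwall's inequality yields a moment bound uniform in \<open>e\<close>, and \<open>e \<rightarrow> 0\<close> bounds
  \<open>E |Y\<^sub>t|\<^sup>2\<^sup>m\<close>. The supremum is then controlled by Doob's \<open>L\<^sup>2\<close> inequality for the martingale
  of the square root weight \<open>x\<^sup>m\<^sup>/\<^sup>2\<close>, whose drift is again bounded by a multiple of
  \<open>x\<^sup>m\<^sup>/\<^sup>2\<close>; thus neither moments beyond \<open>2m\<close> nor quadratic variation enter.
\<close>

section \<open>Weights and scaled test functions\<close>

text \<open>The two regularisations serve different ends, and neither replaces the other. The cutoff
  makes the test function admissible, but the drift of a cut-off function is controlled only by the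
  uncut weight, so the moment inequality does not close while \<open>R\<close> is finite. The
  parameter e bounds the uncut weight; this supplies the finite a priori bound that Gronwall's
  argument needs to absorb a term into the left side, and the constants do not see e.

  The exponents come from the jumps. With u = |z|^2 / x, a displacement z of y multiplies x by at
  most 2 + 2 u, so a weight of degree m grows by a factor of order 1 + u^m, while the Taylor
  remainder costs u when u is small. Integrated against the jump measure, u is paid for by the
  linear growth condition and u^m by the condition on the 2m-th moment of the jumps, both with
  constants independent of y. Bounds on f' and f'' that gain 1/x and 1/x^2 are what makes drift and
  diffusion of linear growth harmless as well.\<close>

definition moderate_weight :: "nat \<Rightarrow> (real \<Rightarrow> real) \<Rightarrow> bool" where
  "moderate_weight m W \<longleftrightarrow> (\<forall>x\<ge>1. \<forall>y\<ge>1. \<forall>l\<ge>1. y \<le> l * x \<longrightarrow> W y \<le> l ^ m * W x)"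

text \<open>The class is invariant under rescaling of x, in the manner of a symbol class: each
  derivative gains a factor 1/x. Differentiability is asked on the open half-line because x = 1 +
  |y|^2 attains the value 1, at y = 0, where a two-sided derivative is wanted.\<close>

definition scaled_C2 ::
  "(real \<Rightarrow> real) \<Rightarrow> (real \<Rightarrow> real) \<Rightarrow> (real \<Rightarrow> real) \<Rightarrow> (real \<Rightarrow> real) \<Rightarrow> bool" where
  "scaled_C2 W f f1 f2 \<longleftrightarrow>
     (\<forall>x>0. (f has_real_derivative f1 x) (at x)) \<and>
     (\<forall>x>0. (f1 has_real_derivative f2 x) (at x)) \<and>
     continuous_on {0<..} f2 \<and>
     (\<forall>x\<ge>1. \<bar>f x\<bar> \<le> W x \<and> \<bar>f1 x\<bar> \<le> W x / x \<and> \<bar>f2 x\<bar> \<le> W x / x\<^sup>2)"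

lemma scaled_C2_nonneg: "scaled_C2 W f f1 f2 \<Longrightarrow> 1 \<le> x \<Longrightarrow> 0 \<le> W x"
  unfolding scaled_C2_def by (meson abs_ge_zero order_trans)

lemma scaled_C2_mono:
  assumes "scaled_C2 V f f1 f2" "\<And>x. 1 \<le> x \<Longrightarrow> V x \<le> W x"
  shows "scaled_C2 W f f1 f2"
proof -
  have "V x / x \<le> W x / x" "V x / x\<^sup>2 \<le> W x / x\<^sup>2" if "1 \<le> x" for x
    using assms(2)[OF that] that by (auto intro!: divide_right_mono)
  with assms show ?thesis unfolding scaled_C2_def by (meson order_trans)
qed

text \<open>By the Leibniz rule every product of derivatives of total order k is at most
  \<open>B * V x\<close> divided by x^k. The second derivative consists of 1 + 2 + 1 such products,
  whence the factor 4.\<close>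

lemma scaled_C2_mult:
  assumes f: "scaled_C2 V f f1 f2" and g: "scaled_C2 (\<lambda>x. B) g g1 g2"
  shows "scaled_C2 (\<lambda>x. 4 * B * V x) (\<lambda>x. f x * g x) (\<lambda>x. f1 x * g x + f x * g1 x)
           (\<lambda>x. f2 x * g x + 2 * (f1 x * g1 x) + f x * g2 x)"
proof -
  have df: "(f has_real_derivative f1 x) (at x)" "(f1 has_real_derivative f2 x) (at x)"
    and dg: "(g has_real_derivative g1 x) (at x)" "(g1 has_real_derivative g2 x) (at x)" if "x > 0"
      for x
    using f g that unfolding scaled_C2_def by blast+
  have cont: "continuous_on {0<..} f" "continuous_on {0<..} f1" "continuous_on {0<..} g"
    "continuous_on {0<..} g1"
    by (auto intro!: continuous_at_imp_continuous_on dest: df dg DERIV_isCont)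
  have cont2: "continuous_on {0<..} f2" "continuous_on {0<..} g2"
    using f g unfolding scaled_C2_def by blast+
  have bounds: "\<bar>f x * g x\<bar> \<le> 4 * B * V x \<and> \<bar>f1 x * g x + f x * g1 x\<bar> \<le> 4 * B * V x / x \<and>
      \<bar>f2 x * g x + 2 * (f1 x * g1 x) + f x * g2 x\<bar> \<le> 4 * B * V x / x\<^sup>2" if x: "1 \<le> x" for x
  proof -
    have bf: "\<bar>f x\<bar> \<le> V x" "\<bar>f1 x\<bar> \<le> V x / x" "\<bar>f2 x\<bar> \<le> V x / x\<^sup>2"
      and bg: "\<bar>g x\<bar> \<le> B" "\<bar>g1 x\<bar> \<le> B / x" "\<bar>g2 x\<bar> \<le> B / x\<^sup>2"
      using f g x unfolding scaled_C2_def by blast+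
    have pos: "0 \<le> V x" "0 \<le> B" using bf(1) bg(1) by linarith+
    have m: "\<bar>a * b\<bar> \<le> c * d" if "\<bar>a\<bar> \<le> c" "\<bar>b\<bar> \<le> d" for a b c d :: real
      unfolding abs_mult using that by (intro mult_mono) auto
    have VB: "0 \<le> V x * B" using pos by simp
    have 0: "\<bar>f x * g x\<bar> \<le> V x * B" by (rule m[OF bf(1) bg(1)])
    have 1: "\<bar>f1 x * g x\<bar> \<le> V x * B / x" "\<bar>f x * g1 x\<bar> \<le> V x * B / x"
      using m[OF bf(2) bg(1)] m[OF bf(1) bg(2)] by (simp_all add: mult_ac)
    have 2: "\<bar>f2 x * g x\<bar> \<le> V x * B / x\<^sup>2" "\<bar>f x * g2 x\<bar> \<le> V x * B / x\<^sup>2" "\<bar>f1 x * g1 x\<bar>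
      \<le> V x * B / x\<^sup>2"
      using m[OF bf(3) bg(1)] m[OF bf(1) bg(3)] m[OF bf(2) bg(2)]
      by (simp_all add: mult_ac power2_eq_square)
    have 3: "4 * B * V x / x = 4 * (V x * B / x)" "4 * B * V x / x\<^sup>2
      = 4 * (V x * B / x\<^sup>2)" "4 * B * V x = 4 * (V x * B)" by simp_all
    have "0 \<le> V x * B / x" using VB x by simp
    then have 4: "\<bar>f x * g x\<bar> \<le> 4 * (V x * B)"
      using 0 VB by linarith
    have abs2: "\<bar>u + v\<bar> \<le> 4 * c" if "\<bar>u\<bar> \<le> c" "\<bar>v\<bar> \<le> c" "0 \<le> c" for u v c :: real
      using that by linarith
    have abs3: "\<bar>u + 2 * t + v\<bar> \<le> 4 * c" if "\<bar>u\<bar> \<le> c" "\<bar>v\<bar> \<le> c" "\<bar>t\<bar> \<le> c" for u v t c :: real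
      using that by linarith
    have 5: "\<bar>f1 x * g x + f x * g1 x\<bar> \<le> 4 * (V x * B / x)"
      using abs2[OF 1 \<open>0 \<le> V x * B / x\<close>] .
    have "\<bar>f2 x * g x + 2 * (f1 x * g1 x) + f x * g2 x\<bar> \<le> 4 * (V x * B / x\<^sup>2)"
      using abs3[OF 2] .
    with 4 5 show ?thesis unfolding 3 by (simp only: times_divide_eq_right)
  qed
  show ?thesis
    unfolding scaled_C2_def
  proof (intro conjI allI impI)
    fix x :: real assume "x > 0"
    then show "((\<lambda>x. f x * g x) has_real_derivative f1 x * g x + f x * g1 x) (at x)"
      and "((\<lambda>x. f1 x * g x + f x * g1 x) has_real_derivative f2 x * g x + 2 * (f1 x * g1 x)
        + f x * g2 x) (at x)"
      by (auto intro!: derivative_eq_intros df dg)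
  next
    show "continuous_on {0<..} (\<lambda>x. f2 x * g x + 2 * (f1 x * g1 x) + f x * g2 x)"
      by (intro continuous_intros cont cont2)
  qed (use bounds in auto)
qed

definition weight :: "real \<Rightarrow> real \<Rightarrow> real \<Rightarrow> real" where
  "weight e p x = (x / (1 + e * x)) powr p"

lemma weight_nonneg [simp]: "0 \<le> weight e p x"
  by (simp add: weight_def)

text \<open>The map x / (1 + e x) is increasing, and replacing x by l x gains at most the factor l.
  Raising to the power p <= m turns this factor into at most l^m.\<close>

lemma moderate_weight_weight:
  assumes "0 \<le> e" "0 \<le> p" "p \<le> real m" "0 \<le> B"
  shows "moderate_weight m (\<lambda>x. B * weight e p x)"
  unfolding moderate_weight_def
proof (intro allI impI)
  fix x y l :: real assume x: "1 \<le> x" and y: "1 \<le> y" and l: "1 \<le> l" and yl: "y \<le> l * x"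
  have "y / (1 + e * y) \<le> l * x / (1 + e * (l * x))"
  proof -
    have "y + y * (e * (l * x)) \<le> l * x + l * x * (e * y)" using yl by (simp add: mult_ac)
    moreover have "0 < 1 + e * y" "0 < 1 + e * (l * x)" using assms x y l
      by (auto intro!: add_pos_nonneg)
    ultimately show ?thesis by (simp add: divide_simps algebra_simps)
  qed
  also have "\<dots> \<le> l * x / (1 + e * x)"
  proof (rule divide_left_mono)
    have "1 * x \<le> l * x" using x l by (intro mult_right_mono) auto
    then show "1 + e * x \<le> 1 + e * (l * x)" using assms(1) by (simp add: mult_left_mono)
    show "0 \<le> l * x" using x l by simp
    show "0 < (1 + e * (l * x)) * (1 + e * x)" using assms x l
      by (auto intro!: add_pos_nonneg mult_pos_pos)
  qed
  finally have "weight e p y \<le> (l * (x / (1 + e * x))) powr p"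
    unfolding weight_def using assms y by (intro powr_mono2) auto
  also have "\<dots> = l powr p * weight e p x"
    unfolding weight_def using powr_mult[of l "x / (1 + e * x)" p] by simp
  also have "l powr p \<le> l ^ m"
    using powr_mono[OF assms(3) l] l by (simp add: powr_realpow)
  finally have "weight e p y \<le> l ^ m * weight e p x" by (simp add: mult_right_mono)
  then show "B * weight e p y \<le> l ^ m * (B * weight e p x)"
    using mult_left_mono[OF _ assms(4)] by (metis mult.left_commute)
qed

text \<open>The quotient x / (1 + e x) has derivative 1 / (1 + e x)^2, so the logarithmic derivative
  of the weight is p / (x (1 + e x)). Hence the derivatives decay as they do for pure powers,
  uniformly in e.\<close>

lemma scaled_C2_weight:
  assumes e: "0 \<le> e" and p: "0 \<le> p"
  shows "\<exists>f1 f2. scaled_C2 (\<lambda>x. (p * (p + 3) + 1) * weight e p x) (weight e p) f1 f2"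
proof -
  define w where "w x = 1 + e * x" for x
  define f1 where "f1 x = p * (weight e p x / (x * w x))" for x
  define f2 where "f2 x = p * ((p * (weight e p x / (x * w x))) * (1 / (x * w x)) - weight e p x *
    (w x + x * e) / (x * w x)\<^sup>2)" for x
  have w: "1 \<le> w x" if "x > 0" for x using that e by (simp add: w_def)
  have dW: "(weight e p has_real_derivative f1 x) (at x)" if x: "x > 0" for x
  proof -
    have wp: "w x > 0" using w[OF x] by simp
    have "((\<lambda>x. (x / w x) powr p) has_real_derivative f1 x) (at x)"
    proof (rule DERIV_cong[OF DERIV_powr])
      show "((\<lambda>x. x / w x) has_real_derivative (w x - x * e) / (w x * w x)) (at x)"
        unfolding w_def by (rule derivative_eq_intros | use x wp in \<open>simp add: w_def\<close>)+
      show "((\<lambda>x. p) has_real_derivative 0) (at x)" by simp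
      show "0 < x / w x" using x wp by simp
      show "(x / w x) powr p * (0 * ln (x / w x) + (w x - x * e) / (w x * w x) * p / (x / w x))
        = f1 x"
        using x wp unfolding f1_def weight_def w_def[symmetric] by (simp add: w_def mult_ac)
    qed
    then show ?thesis by (simp add: weight_def[abs_def] w_def)
  qed
  have d1: "(f1 has_real_derivative f2 x) (at x)" if x: "x > 0" for x
  proof -
    have "x * w x \<noteq> 0" using w[OF x] x by auto
    have "((\<lambda>x. x * w x) has_real_derivative (w x + x * e)) (at x)"
      unfolding w_def by (auto intro!: derivative_eq_intros)
    then have "((\<lambda>x. weight e p x / (x * w x)) has_real_derivative
        ((f1 x * (x * w x) - weight e p x * (w x + x * e)) / ((x * w x) * (x * w x)))) (at x)"
      using \<open>x * w x \<noteq> 0\<close> by (rule DERIV_divide[OF dW[OF x]])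
    then have "(f1 has_real_derivative p * ((f1 x * (x * w x) - weight e p x * (w x
      + x * e)) / ((x * w x) * (x * w x)))) (at x)"
      unfolding f1_def by (rule DERIV_cmult)
    also have "p * ((f1 x * (x * w x) - weight e p x * (w x + x * e)) / ((x * w x) * (x * w x)))
      = f2 x"
      using \<open>x * w x \<noteq> 0\<close> unfolding f2_def f1_def
        by (simp add: diff_divide_distrib power2_eq_square)
    finally show ?thesis .
  qed
  have cW: "continuous_on {0<..} (weight e p)"
    by (auto intro!: continuous_at_imp_continuous_on dest: dW DERIV_isCont)
  have c2: "continuous_on {0<..} f2"
  proof -
    have nz: "x \<noteq> 0" "w x \<noteq> 0" if "x \<in> {0<..}" for x using w[of x] that by auto
    have cw: "continuous_on {0<..} w" unfolding w_def by (intro continuous_intros)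
    show ?thesis unfolding f2_def by (intro continuous_intros cW cw) (use nz in auto)
  qed
  have bounds: "\<bar>weight e p x\<bar> \<le> (p * (p + 3) + 1) * weight e p x \<and> \<bar>f1 x\<bar> \<le> (p * (p + 3)
    + 1) * weight e p x / x
     \<and> \<bar>f2 x\<bar> \<le> (p * (p + 3) + 1) * weight e p x / x\<^sup>2" if x: "1 \<le> x" for x
  proof -
    define A where "A = weight e p x"
    have A: "0 \<le> A" by (simp add: A_def)
    have wx: "1 \<le> w x" using w x by simp
    \<comment> \<open>In terms of \<open>i\<close> and \<open>x * e * i\<close>, both in [0, 1], the
      derivatives become p i A / x and p (p i^2 - i - x e i^2) A / x^2. The bracket is at most p + 2
      in absolute value, and p (p + 3) + 1 dominates 1, p and p (p + 2) at once.\<close>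
    define i where "i = 1 / w x"
    have i: "0 \<le> i" "i \<le> 1" using wx by (auto simp: i_def)
    have ew: "x * e * i \<le> 1" "0 \<le> x * e * i"
      using wx x e mult_nonneg_nonneg[of e x] unfolding i_def
      by (simp_all add: w_def divide_le_eq mult.commute del: mult_nonneg_nonneg) 
    have "f1 x = p * i * A / x" by (simp add: f1_def A_def i_def)
    then have 1: "\<bar>f1 x\<bar> = p * i * A / x" using p i A x by simp
    have f2: "f2 x = p * (p * i * i - (i + x * e * i * i)) * A / x\<^sup>2"
      using wx x unfolding f2_def A_def i_def by (simp add: field_simps power2_eq_square)
    have ii: "0 \<le> i * i" "i * i \<le> 1" using i by (auto intro: mult_le_one)
    have t: "0 \<le> x * e * i * i" "x * e * i * i \<le> 1" using ew i by (auto intro: mult_le_one)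
    have "p * (i * i) \<le> p * 1" "0 \<le> p * (i * i)"
      using mult_left_mono[OF ii(2) p] p ii(1) by simp_all
    then have "\<bar>p * i * i - (i + x * e * i * i)\<bar> \<le> p + 2"
      using i t p unfolding mult.assoc by linarith
    then have "\<bar>p * (p * i * i - (i + x * e * i * i))\<bar> \<le> p * (p + 2)"
      using p by (simp add: abs_mult mult_left_mono)
    also have "\<dots> \<le> p * (p + 3) + 1" using p by (simp add: algebra_simps)
    finally have "\<bar>f2 x\<bar> \<le> (p * (p + 3) + 1) * A / x\<^sup>2"
      unfolding f2 using A x by (simp add: abs_mult divide_right_mono mult_right_mono)
    moreover have "p * i \<le> p * (p + 3) + 1"
    proof -
      have "p * i \<le> p * 1" using p i by (intro mult_left_mono) auto
      also have "\<dots> \<le> p * (p + 3) + 1" using p by (simp add: algebra_simps)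
      finally show ?thesis .
    qed
    then have "\<bar>f1 x\<bar> \<le> (p * (p + 3) + 1) * A / x" unfolding 1 using A x
      by (simp add: divide_right_mono mult_right_mono)
    moreover have "1 * A \<le> (p * (p + 3) + 1) * A" using p A by (intro mult_right_mono) auto
    ultimately show ?thesis using A unfolding A_def by simp
  qed
  have "scaled_C2 (\<lambda>x. (p * (p + 3) + 1) * weight e p x) (weight e p) f1 f2"
    unfolding scaled_C2_def using dW d1 c2 bounds by blast
  then show ?thesis by blast
qed

text \<open>The cube is the lowest integer power of the positive part whose second derivative is
  continuous.\<close>

definition cutoff :: "real \<Rightarrow> real \<Rightarrow> real" where
  "cutoff R x = (max 0 (1 - x / R)) ^ 3"

lemma cutoff_bounds: "R > 0 \<Longrightarrow> 0 \<le> x \<Longrightarrow> 0 \<le> cutoff R x \<and> cutoff R x \<le> 1"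
  unfolding cutoff_def by (auto intro!: power_le_one simp: max_def)

lemma DERIV_max_0_power:
  assumes "2 \<le> n"
  shows "((\<lambda>t::real. (max 0 t) ^ n) has_real_derivative real n * (max 0 t) ^ (n - 1)) (at t)"
proof -
  consider "t > 0" | "t < 0" | "t = 0" by linarith
  then show ?thesis
  proof cases
    case 1
    have "((\<lambda>t::real. t ^ n) has_real_derivative real n * t ^ (n - 1)) (at t)"
      by (auto intro!: derivative_eq_intros)
    then show ?thesis
      by (rule has_field_derivative_transform_within_open[where S="{0<..}", THEN DERIV_cong])
        (use 1 in \<open>auto simp: max_def\<close>)
  next
    case 2
    have "((\<lambda>t::real. 0) has_real_derivative 0) (at t)" by simp
    then show ?thesis
      by (rule has_field_derivative_transform_within_open[where S="{..<0}", THEN DERIV_cong])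
        (use 2 assms in \<open>auto simp: max_def\<close>)
  next
    case 3
    obtain k where n: "n = Suc (Suc k)"
      using assms by (metis Suc_le_D numeral_2_eq_2 Suc_le_mono)
    \<comment> \<open>At the kink the difference quotient is itself a positive power of the positive
      part, since n >= 2, and so tends to 0. For h = 0 the equation holds because division by zero
      gives 0.\<close>
    have "(max 0 h) ^ n / h = (max 0 h) ^ Suc k" for h :: real
      by (cases "0 < h") (auto simp: n max_def)
    moreover have "((\<lambda>h::real. (max 0 h) ^ Suc k) \<longlongrightarrow> (max 0 0) ^ Suc k) (at 0)"
      by (intro tendsto_intros)
    ultimately show ?thesis using 3 by (simp add: DERIV_def n)
  qed
qed

text \<open>Differentiation produces powers of 1/R, which are traded for powers of 1/x on x < R; for
  x >= R both derivatives vanish. So the bounds are uniform in \<open>R\<close>. The constant 6 = 3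
  * 2 is the factor of the second derivative of a cube.\<close>

lemma scaled_C2_cutoff:
  assumes R: "R > 0"
  shows "\<exists>g1 g2. scaled_C2 (\<lambda>x. 6) (cutoff R) g1 g2"
proof -
  define q where "q x = max 0 (1 - x / R)" for x
  define g1 where "g1 x = - 3 / R * (q x)\<^sup>2" for x
  define g2 where "g2 x = 6 / R\<^sup>2 * q x" for x
  have inner: "((\<lambda>x. 1 - x / R) has_real_derivative - 1 / R) (at x)" for x
    using R by (auto intro!: derivative_eq_intros)
  have d0: "(cutoff R has_real_derivative g1 x) (at x)" for x
    using DERIV_chain2[OF DERIV_max_0_power[of 3] inner, of x]
    unfolding cutoff_def g1_def q_def by (simp add: cutoff_def[abs_def])
  have d1: "(g1 has_real_derivative g2 x) (at x)" for x
    using DERIV_cmult[OF DERIV_chain2[OF DERIV_max_0_power[of 2] inner, of x], of "- 3 / R"]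
    unfolding g1_def g2_def q_def by (simp add: power2_eq_square)
  have c: "continuous_on {0<..} g2" unfolding g2_def q_def using R by (intro continuous_intros) auto
  have b: "\<bar>cutoff R x\<bar> \<le> 6 \<and> \<bar>g1 x\<bar> \<le> 6 / x \<and> \<bar>g2 x\<bar> \<le> 6 / x\<^sup>2" if x: "1 \<le> x" for x
  proof (cases "x < R")
    case True
    have q: "0 \<le> q x" "q x \<le> 1" using x R unfolding q_def by auto
    have "3 / R * (q x)\<^sup>2 \<le> 3 / x * 1"
      using q True x R by (intro mult_mono power_le_one) (auto intro: divide_left_mono)
    also have "\<dots> \<le> 6 / x" using x by (simp add: field_simps)
    finally have "\<bar>g1 x\<bar> \<le> 6 / x" using R by (simp add: g1_def abs_mult)
    moreover have "6 / R\<^sup>2 * q x \<le> 6 / x\<^sup>2 * 1"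
      using q True x R by (intro mult_mono) (auto intro!: divide_left_mono power_mono)
    then have "\<bar>g2 x\<bar> \<le> 6 / x\<^sup>2" using R q by (simp add: g2_def abs_mult)
    ultimately show ?thesis using cutoff_bounds[OF R, of x] x by simp
  next
    case False
    then have "q x = 0" using R by (simp add: q_def)
    then show ?thesis using cutoff_bounds[OF R, of x] x by (simp add: g1_def g2_def)
  qed
  have "scaled_C2 (\<lambda>x. 6) (cutoff R) g1 g2"
    unfolding scaled_C2_def using d0 d1 c b by blast
  then show ?thesis by blast
qed

text \<open>The factor 24 is 4, from the Leibniz rule, times 6, from the cutoff. The bounding weight
  carries no cutoff, so estimates derived from it survive the limit in \<open>R\<close>.\<close>

lemma scaled_C2_weight_cutoff:
  assumes "0 \<le> e" "0 \<le> p" "R > 0"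
  shows "\<exists>f1 f2. scaled_C2 (\<lambda>x. 24 * (p * (p + 3) + 1) * weight e p x)
           (\<lambda>x. weight e p x * cutoff R x) f1 f2"
proof -
  obtain f1 f2 where f: "scaled_C2 (\<lambda>x. (p * (p + 3) + 1) * weight e p x) (weight e p) f1 f2"
    using scaled_C2_weight[OF assms(1,2)] by blast
  obtain g1 g2 where g: "scaled_C2 (\<lambda>x. 6) (cutoff R) g1 g2"
    using scaled_C2_cutoff[OF assms(3)] by blast
  have "4 * 6 * ((p * (p + 3) + 1) * weight e p x) = 24 * (p * (p + 3) + 1) * weight e p x" for x
    by simp
  then show ?thesis using scaled_C2_mono[OF scaled_C2_mult[OF f g], of "\<lambda>x. 24 * (p * (p + 3)
    + 1) * weight e p x"] by (metis order_refl)
qed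

section \<open>Radial functions\<close>

lemma moderate_weightD:
  "moderate_weight m W \<Longrightarrow> 1 \<le> x \<Longrightarrow> 1 \<le> y \<Longrightarrow> 1 \<le> l \<Longrightarrow> y \<le> l * x \<Longrightarrow> W y \<le> l ^ m * W x"
  unfolding moderate_weight_def by blast

abbreviation (input) radial :: "(real \<Rightarrow> real) \<Rightarrow> 'a::real_inner \<Rightarrow> real" where
  "radial f y \<equiv> f (1 + (norm y)\<^sup>2)"

lemma radial_has_derivative:
  assumes "(f has_real_derivative d) (at (1 + (norm y)\<^sup>2))"
  shows "((radial f) has_derivative (\<lambda>h. d * (2 * (y \<bullet> h)))) (at y)"
proof -
  have 1: "((\<lambda>y. 1 + (norm y)\<^sup>2) has_derivative (\<lambda>h. 2 * (y \<bullet> h))) (at y)"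
    unfolding power2_norm_eq_inner
    by (auto intro!: derivative_eq_intros simp: inner_commute)
  show ?thesis
    using has_derivative_compose[OF 1 assms[unfolded has_field_derivative_def]] by simp
qed

lemma one_plus_norm_sq_ge_1: "1 \<le> 1 + (norm (y::'a::real_normed_vector))\<^sup>2"
  by simp

lemma scaled_C2_DERIV:
  fixes y :: "'a::real_normed_vector"
  assumes "scaled_C2 W f f1 f2"
  shows "(f has_real_derivative f1 (1 + (norm y)\<^sup>2)) (at (1 + (norm y)\<^sup>2))"
    and "(f1 has_real_derivative f2 (1 + (norm y)\<^sup>2)) (at (1 + (norm y)\<^sup>2))"
proof -
  have "0 < 1 + (norm y)\<^sup>2" using one_plus_norm_sq_ge_1[of y] by linarith
  then show "(f has_real_derivative f1 (1 + (norm y)\<^sup>2)) (at (1 + (norm y)\<^sup>2))"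
    and "(f1 has_real_derivative f2 (1 + (norm y)\<^sup>2)) (at (1 + (norm y)\<^sup>2))"
    using assms unfolding scaled_C2_def by blast+
qed

lemma grad_radial:
  fixes y :: "real^'d"
  assumes "scaled_C2 W f f1 f2"
  shows "grad (radial f) y = (2 * f1 (1 + (norm y)\<^sup>2)) *\<^sub>R y"
proof -
  have "frechet_derivative (radial f) (at y) = (\<lambda>h. f1 (1 + (norm y)\<^sup>2) * (2 * (y \<bullet> h)))"
    by (intro frechet_derivative_at[symmetric] radial_has_derivative scaled_C2_DERIV(1)[OF assms])
  then show ?thesis
    by (simp add: grad_def vec_eq_iff inner_axis)
qed

lemma radial_grad_has_derivative:
  fixes y :: "real^'d"
  assumes "scaled_C2 W f f1 f2"
  shows "((grad (radial f)) has_derivative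
    (\<lambda>h. (2 * (f2 (1 + (norm y)\<^sup>2) * (2 * (y \<bullet> h)))) *\<^sub>R y + (2 * f1 (1
      + (norm y)\<^sup>2)) *\<^sub>R h)) (at y)"
proof -
  from radial_has_derivative[OF scaled_C2_DERIV(2)[OF assms]]
  have "((\<lambda>y. (2 * radial f1 y) *\<^sub>R y) has_derivative
    (\<lambda>h. (2 * (f2 (1 + (norm y)\<^sup>2) * (2 * (y \<bullet> h)))) *\<^sub>R y + (2 * f1 (1
      + (norm y)\<^sup>2)) *\<^sub>R h)) (at y)"
    by (auto intro!: derivative_eq_intros)
  moreover have "grad (radial f) = (\<lambda>y. (2 * radial f1 y) *\<^sub>R (y::real^'d))"
    by (intro ext grad_radial[OF assms])
  ultimately show ?thesis by simp
qed

lemma hessian_radial: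
  fixes y :: "real^'d"
  assumes "scaled_C2 W f f1 f2"
  shows "hessian (radial f) y $ i $ j =
    4 * f2 (1 + (norm y)\<^sup>2) * (y $ i * y $ j) + 2 * f1 (1 + (norm y)\<^sup>2) * (if i = j then 1 else 0)"
  unfolding hessian_def jacobian_def frechet_derivative_at[OF radial_grad_has_derivative[OF assms],
    symmetric]
  by (simp add: matrix_def inner_axis) (simp add: axis_def)

lemma C2_radial:
  assumes "scaled_C2 W f f1 f2"
  shows "C2 (radial f :: real^'d \<Rightarrow> real)"
  unfolding C2_def
proof (intro conjI allI)
  fix y :: "real^'d"
  from radial_has_derivative[OF scaled_C2_DERIV(1)[OF assms]] show "radial f differentiable at y"
    by (rule differentiableI)
  show "grad (radial f) differentiable at y"
    using radial_grad_has_derivative[OF assms] by (rule differentiableI)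
next
  have c2: "continuous_on {0<..} f2" and c1: "continuous_on {0<..} f1"
    using assms unfolding scaled_C2_def
    by (auto intro!: continuous_at_imp_continuous_on intro: DERIV_isCont)
  have q: "continuous_on UNIV (\<lambda>y::real^'d. 1 + (norm y)\<^sup>2)" by (intro continuous_intros)
  have sub: "(\<lambda>y::real^'d. 1 + (norm y)\<^sup>2) ` UNIV \<subseteq> {0<..}"
    using one_plus_norm_sq_ge_1 by (auto intro: less_le_trans[of 0 1])
  have r2: "continuous_on UNIV (radial f2 :: real^'d \<Rightarrow> real)" and r1:
    "continuous_on UNIV (radial f1 :: real^'d \<Rightarrow> real)"
    using continuous_on_compose2[OF c2 q sub] continuous_on_compose2[OF c1 q sub] by auto
  have "hessian (radial f) = (\<lambda>y::real^'d. \<chi> i j. 4 * radial f2 y * (y $ i * y $ j)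
    + 2 * radial f1 y * (if i = j then 1 else 0))"
    by (simp add: fun_eq_iff vec_eq_iff hessian_radial[OF assms])
  then show "continuous_on UNIV (hessian (radial f :: real^'d \<Rightarrow> real))"
    by (auto intro!: continuous_intros r1 r2)
qed

lemma radial_C2c:
  assumes "scaled_C2 W f f1 f2" and supp: "\<And>x. R \<le> x \<Longrightarrow> f x = 0"
  shows "(\<lambda>y c. radial f y) \<in> (C2c K :: (real^'d \<Rightarrow> nat \<Rightarrow> real) set)"
proof -
  have "{y::real^'d. radial f y \<noteq> 0} \<subseteq> cball 0 (sqrt \<bar>R\<bar>)"
  proof
    fix y :: "real^'d" assume "y \<in> {y. radial f y \<noteq> 0}"
    then have "1 + (norm y)\<^sup>2 < R" using supp by (metis mem_Collect_eq not_le)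
    then have "norm y \<le> sqrt \<bar>R\<bar>" by (intro real_le_rsqrt) linarith
    then show "y \<in> cball 0 (sqrt \<bar>R\<bar>)" by simp
  qed
  then have "bounded {y::real^'d. radial f y \<noteq> 0}"
    using bounded_cball bounded_subset by blast
  then show ?thesis
    using C2_radial[OF assms(1), where 'd='d] by (simp add: C2c_def compact_closure)
qed

section \<open>Growth and Taylor estimates for radial functions\<close>

lemma Taylor2_bound:
  fixes h :: "real \<Rightarrow> real"
  assumes "\<And>t. 0 \<le> t \<Longrightarrow> t \<le> 1 \<Longrightarrow> (h has_real_derivative h1 t) (at t)"
    and "\<And>t. 0 \<le> t \<Longrightarrow> t \<le> 1 \<Longrightarrow> (h1 has_real_derivative h2 t) (at t)"
    and "\<And>t. 0 \<le> t \<Longrightarrow> t \<le> 1 \<Longrightarrow> \<bar>h2 t\<bar> \<le> 2 * B"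
  shows "\<bar>h 1 - h 0 - h1 0\<bar> \<le> B"
proof -
  define diff where "diff n = (if n = 0 then h else if n = 1 then h1 else h2)" for n :: nat
  have "\<exists>t>0. t < 1 \<and> h 1 = (\<Sum>m<2. diff m 0 / fact m * 1 ^ m) + diff 2 t / fact 2 * 1 ^ 2"
    by (rule Maclaurin) (use assms in \<open>auto simp: diff_def less_2_cases_iff\<close>)
  then obtain t where t: "0 < t" "t < 1" "h 1 = h 0 + h1 0 + h2 t / 2"
    by (auto simp: diff_def numeral_2_eq_2)
  then show ?thesis using assms(3)[of t] by (simp add: abs_divide)
qed

lemma norm_add_sq_le: "(norm (y + z))\<^sup>2 \<le> 2 * (norm y)\<^sup>2 + 2 * (norm (z::'a::real_normed_vector))\<^sup>2"
proof -
  have "(norm (y + z))\<^sup>2 \<le> (norm y + norm z)\<^sup>2" by (intro power_mono norm_triangle_ineq) auto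
  also have "\<dots> \<le> 2 * (norm y)\<^sup>2 + 2 * (norm z)\<^sup>2"
    using sum_squares_ge_zero[of "norm y - norm z" 0] by (simp add: power2_eq_square algebra_simps)
  finally show ?thesis .
qed

text \<open>In units of x = 1 + |y|^2 the shifted radius is at most (2 + 2 u) x, which moderate
  growth converts into the factor (2 + 2 u)^m; distinguishing u <= 1 from u > 1 separates this into
  4^m (1 + u^m). There is no cancellation against f(y), so the bound suits jumps of finite
  intensity.\<close>

lemma radial_shift_bound:
  assumes s: "scaled_C2 W f f1 f2" and mw: "moderate_weight m W"
  shows "\<bar>radial f (y + z)\<bar> \<le> 4 ^ m * (1 + ((norm z)\<^sup>2 / (1 + (norm y)\<^sup>2)) ^ m) * radial W y"
proof -
  define x u where "x = 1 + (norm y)\<^sup>2" and "u = (norm z)\<^sup>2 / (1 + (norm y)\<^sup>2)"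
  have x: "1 \<le> x" by (simp add: x_def)
  have u: "0 \<le> u" "(norm z)\<^sup>2 = u * x" using x by (auto simp: u_def x_def[symmetric])
  have W: "0 \<le> W x" by (rule scaled_C2_nonneg[OF s x])
  have "1 + (norm (y + z))\<^sup>2 \<le> (2 + 2 * u) * x"
    using norm_add_sq_le[of y z] u by (simp add: x_def algebra_simps)
  then have "radial W (y + z) \<le> (2 + 2 * u) ^ m * W x"
    by (intro moderate_weightD[OF mw x]) (use u in auto)
  also have "(2 + 2 * u) ^ m \<le> (4 * max 1 u) ^ m" using u by (intro power_mono) auto
  also have "\<dots> \<le> 4 ^ m * (1 + u ^ m)"
    using u by (auto simp: power_mult_distrib max_def)
  finally have "radial W (y + z) \<le> 4 ^ m * (1 + u ^ m) * W x"
    using W by (auto intro: mult_right_mono)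
  moreover have "\<bar>radial f (y + z)\<bar> \<le> radial W (y + z)"
    using s one_plus_norm_sq_ge_1[of "y + z"] unfolding scaled_C2_def by blast
  ultimately show ?thesis unfolding u_def x_def by linarith
qed

text \<open>Displacements with u <= 1/4 keep x within a constant factor of its initial value, so a
  second-order Taylor expansion yields a multiple of u. For longer ones the three terms are
  estimated separately: the shifted value by u^m, the other two by u, which is possible since then 1
  < 4 u.\<close>

lemma radial_Taylor_bound:
  assumes s: "scaled_C2 W f f1 f2" and mw: "moderate_weight m W"
  defines "u y z \<equiv> (norm z)\<^sup>2 / (1 + (norm y)\<^sup>2)"
  shows "\<bar>radial f (y + z) - radial f y - radial f1 y * (2 * (y \<bullet> z))\<bar>
           \<le> 20 * 10 ^ m * (u y z + u y z ^ m) * radial W y"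
proof -
  define x where "x = 1 + (norm y)\<^sup>2"
  have x: "1 \<le> x" by (simp add: x_def)
  define U where "U = u y z"
  have U: "0 \<le> U" "(norm z)\<^sup>2 = U * x" using x by (auto simp: U_def u_def x_def[symmetric])
  have W: "0 \<le> W x" by (rule scaled_C2_nonneg[OF s x])
  have sf: "\<bar>f v\<bar> \<le> W v" "\<bar>f1 v\<bar> \<le> W v / v" "\<bar>f2 v\<bar> \<le> W v / v\<^sup>2" if "1 \<le> v" for v
    using s that unfolding scaled_C2_def by blast+
  have df: "(f has_real_derivative f1 v) (at v)" "(f1 has_real_derivative f2 v) (at v)" if "0 < v"
    for v
    using s that unfolding scaled_C2_def by blast+
  have "\<bar>radial f (y + z) - f x - f1 x * (2 * (y \<bullet> z))\<bar> \<le> 20 * 10 ^ m * (U + U ^ m) * W x"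
  proof (cases "U \<le> 1 / 4")
    case True
    \<comment> \<open>\<open>q t\<close> is 1 + |y + t z|^2 written as a polynomial in t; the Taylor
      formula is applied to f along \<open>q\<close> on [0, 1].\<close>
    define q where "q t = x + 2 * t * (y \<bullet> z) + t\<^sup>2 * (norm z)\<^sup>2" for t
    have q: "q t = 1 + (norm (y + t *\<^sub>R z))\<^sup>2" for t
      unfolding q_def x_def power2_norm_eq_inner
      by (simp add: inner_add_left inner_add_right inner_commute power2_eq_square)
    have q1: "1 \<le> q t" for t unfolding q by simp
    have dq: "(q has_real_derivative 2 * ((y + t *\<^sub>R z) \<bullet> z)) (at t)" for t
      unfolding q_def
      by (auto intro!: derivative_eq_intros simp: inner_add_left power2_norm_eq_inner)
    define h1 where "h1 t = f1 (q t) * (2 * ((y + t *\<^sub>R z) \<bullet> z))" for t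
    define h2 where "h2 t = f2 (q t) * (2 * ((y + t *\<^sub>R z) \<bullet> z))\<^sup>2 + f1 (q t) * (2 * (norm z)\<^sup>2)"
      for t
    have qpos: "0 < q t" for t using q1[of t] by linarith
    have d1: "((\<lambda>t. f (q t)) has_real_derivative h1 t) (at t)" for t
      unfolding h1_def by (rule DERIV_chain2[OF df(1)[OF qpos] dq])
    have d2: "(h1 has_real_derivative h2 t) (at t)" for t
    proof -
      have "((\<lambda>t. 2 * ((y + t *\<^sub>R z) \<bullet> z)) has_real_derivative 2 * (norm z)\<^sup>2) (at t)"
        unfolding inner_add_left inner_scaleR_left power2_norm_eq_inner
          by (auto intro!: derivative_eq_intros)
      from DERIV_mult[OF DERIV_chain2[OF df(2)[OF qpos] dq] this] show ?thesis
        unfolding h1_def h2_def by (simp add: power2_eq_square mult_ac)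
    qed
    have b: "\<bar>h2 t\<bar> \<le> 2 * (12 * (5 / 2) ^ m * U * W x)" if t: "0 \<le> t" "t \<le> 1" for t
    proof -
      let ?w = "y + t *\<^sub>R z"
      have tz: "(norm (t *\<^sub>R z))\<^sup>2 \<le> (norm z)\<^sup>2"
        using t by (intro power_mono) (auto simp: mult_left_le_one_le)
      have zx: "(norm z)\<^sup>2 \<le> x / 4" using True U x by (simp add: mult_right_mono)
      \<comment> \<open>Both bounds on \<open>q t\<close> matter: the upper one, 5/2 x, controls
        \<open>W\<close>, and the lower one, x/4, controls the denominators.\<close>
      have "q t \<le> 5 / 2 * x"
        using norm_add_sq_le[of y "t *\<^sub>R z"] tz zx zero_le_power2[of "norm y"] unfolding q x_def
          by argo
      then have Wq: "W (q t) \<le> (5 / 2) ^ m * W x"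
        by (intro moderate_weightD[OF mw x q1]) auto
      have "(norm y)\<^sup>2 \<le> 2 * (norm ?w)\<^sup>2 + 2 * (norm (t *\<^sub>R z))\<^sup>2"
        using norm_add_sq_le[of ?w "- (t *\<^sub>R z)"] by simp
      then have qx: "x / 4 \<le> q t" using tz zx zero_le_power2[of "norm y"] unfolding q x_def by argo
      have "(2 * (?w \<bullet> z))\<^sup>2 \<le> 4 * ((norm ?w)\<^sup>2 * (norm z)\<^sup>2)"
        using power_mono[OF Cauchy_Schwarz_ineq2[of ?w z] abs_ge_zero, of 2]
          by (simp add: power_mult_distrib)
      also have "\<dots> \<le> 4 * (q t * (norm z)\<^sup>2)"
        unfolding q by (intro mult_left_mono mult_right_mono) auto
      finally have sq: "(2 * (?w \<bullet> z))\<^sup>2 \<le> 4 * (q t * (norm z)\<^sup>2)" .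
      have "\<bar>h2 t\<bar> \<le> \<bar>f2 (q t)\<bar> * (2 * (?w \<bullet> z))\<^sup>2 + \<bar>f1 (q t)\<bar> * (2 * (norm z)\<^sup>2)"
        unfolding h2_def by (rule order_trans[OF abs_triangle_ineq]) (simp add: abs_mult)
      also have "\<dots> \<le> W (q t) / (q t)\<^sup>2 * (4 * (q t * (norm z)\<^sup>2))
        + W (q t) / q t * (2 * (norm z)\<^sup>2)"
        using sf[OF q1] sq qpos[of t] scaled_C2_nonneg[OF s q1] by (intro add_mono mult_mono) auto
      also have "\<dots> = 6 * (norm z)\<^sup>2 * (W (q t) / q t)"
        using qpos[of t] by (simp add: power2_eq_square field_simps)
      also have "\<dots> \<le> 6 * (norm z)\<^sup>2 * (((5 / 2) ^ m * W x) / (x / 4))"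
        using Wq qx x W scaled_C2_nonneg[OF s q1] by (intro mult_left_mono frac_le) auto
      also have "\<dots> = 2 * (12 * (5 / 2) ^ m * U * W x)"
        using x by (simp add: U)
      finally show ?thesis .
    qed
    have "\<bar>f (q 1) - f (q 0) - h1 0\<bar> \<le> 12 * (5 / 2) ^ m * U * W x"
      by (rule Taylor2_bound[OF d1 d2 b])
    also have "12 * (5 / 2) ^ m * U * W x \<le> 20 * 10 ^ m * (U + U ^ m) * W x"
      using U W by (intro mult_mono power_mono) auto
    finally have "\<bar>f (q 1) - f (q 0) - h1 0\<bar> \<le> 20 * 10 ^ m * (U + U ^ m) * W x" .
    moreover have "q 0 = x" by (simp add: q_def)
    ultimately show ?thesis using q[of 1] by (simp add: h1_def)
  next
    case False
    have Ux: "U > 1 / 4" using False by simp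
    have xz: "x \<le> 4 * (norm z)\<^sup>2" using Ux x by (simp add: U)
    have "1 + (norm (y + z))\<^sup>2 \<le> 2 * x + 2 * (norm z)\<^sup>2"
      using norm_add_sq_le[of y z] by (simp add: x_def)
    \<comment> \<open>Since x <= 4 |z|^2, everything is absorbed by |z|^2 = U x, with 2 * 4 + 2 =
      10. The dilation 10 U is an admissible factor because U > 1/4 makes it exceed 1.\<close>
    also have "\<dots> \<le> (10 * U) * x" using xz U by simp
    finally have "1 + (norm (y + z))\<^sup>2 \<le> (10 * U) * x" .
    then have "radial W (y + z) \<le> (10 * U) ^ m * W x"
      by (intro moderate_weightD[OF mw x]) (use Ux in auto)
    then have 1: "\<bar>radial f (y + z)\<bar> \<le> 10 ^ m * U ^ m * W x"
      using sf(1)[OF one_plus_norm_sq_ge_1[of "y + z"]] by (simp add: power_mult_distrib)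
    have 2: "\<bar>f x\<bar> \<le> 4 * U * W x"
      using sf(1)[OF x] mult_right_mono[of 1 "4 * U" "W x"] Ux W by simp
    have "norm y \<le> 2 * norm z"
    proof (rule power2_le_imp_le)
      show "(norm y)\<^sup>2 \<le> (2 * norm z)\<^sup>2" using xz by (simp add: x_def power_mult_distrib)
    qed simp
    then have "norm y * norm z \<le> 2 * norm z * norm z" by (intro mult_right_mono) auto
    then have "\<bar>2 * (y \<bullet> z)\<bar> \<le> 4 * (norm z)\<^sup>2"
      using Cauchy_Schwarz_ineq2[of y z] by (simp add: power2_eq_square)
    then have "\<bar>f1 x\<bar> * \<bar>2 * (y \<bullet> z)\<bar> \<le> W x / x * (4 * (norm z)\<^sup>2)"
      using sf(2)[OF x] W x by (intro mult_mono) auto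
    then have 3: "\<bar>f1 x * (2 * (y \<bullet> z))\<bar> \<le> 4 * U * W x"
      unfolding U abs_mult[of "f1 x"] using x by (simp add: mult_ac)
    have "10 ^ m * U ^ m * W x + 8 * U * W x \<le> 20 * 10 ^ m * U ^ m * W x + 20 * 10 ^ m * U * W x"
    proof (intro add_mono mult_right_mono)
      show "8 \<le> 20 * (10::real) ^ m" using one_le_power[of "10::real" m] by linarith
    qed (use U W in auto)
    then have "10 ^ m * U ^ m * W x + 8 * U * W x \<le> 20 * 10 ^ m * (U + U ^ m) * W x"
      by (simp add: algebra_simps)
    then show ?thesis using 1 2 3 by linarith
  qed
  then show ?thesis by (simp add: U_def x_def)
qed

section \<open>The generator on radial functions\<close>

text \<open>The Bochner integral of a non-integrable function is 0 by convention, so the bound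
  persists in that case and integrability never has to be established.\<close>

lemma norm_integral_le_nn_integral:
  fixes f :: "'a \<Rightarrow> 'b::{banach, second_countable_topology}"
  assumes "(\<integral>\<^sup>+x. ennreal (norm (f x)) \<partial>M) \<le> ennreal B" "0 \<le> B"
  shows "norm (\<integral>x. f x \<partial>M) \<le> B"
proof (cases "integrable M f")
  case True
  then have "ennreal (norm (\<integral>x. f x \<partial>M)) \<le> ennreal B"
    using integral_norm_bound_ennreal[of M f] assms(1) by (blast intro: order_trans)
  then show ?thesis using assms(2) by simp
qed (simp add: not_integrable_integral_eq assms(2))

text \<open>The compensator is present exactly where \<open>P\<close> holds; there the Taylor bound
  applies and costs u + u^m. Elsewhere the cruder 1 + u^m must do. The three summands are paid for
  by \<open>k1\<close>, \<open>k2\<close> and the finite mass \<open>k3\<close> of the complement;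
  dividing by x and x^m turns the growth of the jump moments into constants.\<close>

lemma jump_integral_bound:
  fixes G :: "'b \<Rightarrow> 'a::euclidean_space"
  assumes s: "scaled_C2 W f f1 f2" and mw: "moderate_weight m W"
    and G: "G \<in> borel_measurable \<nu>" and A: "{x. P x} \<inter> space \<nu> \<in> sets \<nu>"
    and c1: "(\<integral>\<^sup>+x\<in>{x. P x}. ennreal ((norm (G x))\<^sup>2) \<partial>\<nu>) \<le> ennreal (k1 * (1 + (norm y)\<^sup>2))"
    and c2: "(\<integral>\<^sup>+x. ennreal (norm (G x) ^ (2 * m)) \<partial>\<nu>) \<le> ennreal (k2 * (1 + (norm y)\<^sup>2) ^ m)"
    and c3: "(\<integral>\<^sup>+x. indicator {x. \<not> P x} x \<partial>\<nu>) \<le> ennreal k3"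
    and k: "0 \<le> k1" "0 \<le> k2" "0 \<le> k3"
  shows "\<bar>\<integral>x. radial f (y + G x) - radial f y
            - (((2 * radial f1 y) *\<^sub>R y) \<bullet> G x) * indicator {x. P x} x \<partial>\<nu>\<bar>
          \<le> 20 * 10 ^ m * (k1 + k2 + k3) * radial W y"
proof -
  define x where "x = 1 + (norm y)\<^sup>2"
  have x: "1 \<le> x" by (simp add: x_def)
  have W: "0 \<le> W x" by (rule scaled_C2_nonneg[OF s x])
  define c where "c = 20 * 10 ^ m * W x"
  have c: "0 \<le> c" using W by (simp add: c_def)
  define J where "J z = radial f (y + G z) - radial f y
            - (((2 * radial f1 y) *\<^sub>R y) \<bullet> G z) * indicator {x. P x} z" for z
  have J: "\<bar>J z\<bar> \<le> c / x * ((norm (G z))\<^sup>2 * indicator {x. P x} z)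
    + c / x ^ m * norm (G z) ^ (2 * m) + c * indicator {x. \<not> P x} z" for z
  proof (cases "P z")
    case True
    then have "\<bar>J z\<bar> \<le> c * ((norm (G z))\<^sup>2 / x + ((norm (G z))\<^sup>2 / x) ^ m)"
      using radial_Taylor_bound[OF s mw, of y "G z"] by (simp add: J_def c_def x_def mult_ac)
    then show ?thesis using True by (simp add: power_divide power_mult distrib_left)
  next
    case False
    define v where "v = ((norm (G z))\<^sup>2 / x) ^ m"
    have v: "0 \<le> v" using x by (simp add: v_def)
    have "\<bar>radial f (y + G z)\<bar> \<le> 4 ^ m * (1 + v) * W x"
      using radial_shift_bound[OF s mw, of y "G z"] by (simp add: x_def v_def)
    moreover have "\<bar>radial f y\<bar> \<le> W x"
      using s x unfolding scaled_C2_def x_def by blast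
    moreover have "4 ^ m * (1 + v) * W x + W x \<le> 20 * 10 ^ m * (1 + v) * W x"
    proof -
      have "(4::real) ^ m \<le> 10 ^ m" "(1::real) \<le> 10 ^ m" by (auto intro: power_mono)
      then have "4 ^ m * (1 + v) + 1 * (1 + 0) \<le> 10 ^ m * (1 + v) + 10 ^ m * (1 + v)"
        using v by (intro add_mono mult_mono) auto
      also have "\<dots> \<le> 20 * 10 ^ m * (1 + v)" using v by simp
      finally show ?thesis using W mult_right_mono[of "4 ^ m * (1 + v) + 1" "20 * 10 ^ m * (1 + v)"
        "W x"]
        by (simp add: distrib_right)
    qed
    ultimately have "\<bar>J z\<bar> \<le> 20 * 10 ^ m * (1 + v) * W x" using False unfolding J_def by simp
    also have "\<dots> = c / x ^ m * norm (G z) ^ (2 * m) + c"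
      by (simp add: c_def v_def power_divide algebra_simps flip: power_mult)
    finally show ?thesis using False by simp
  qed
  have 1: "(\<lambda>z. ennreal (c / x) * (ennreal ((norm (G z))\<^sup>2) * indicator {x. P x} z))
    \<in> borel_measurable \<nu>"
    "(\<lambda>z. ennreal (c / x ^ m) * ennreal (norm (G z) ^ (2 * m))) \<in> borel_measurable \<nu>"
    "(\<lambda>z. ennreal c * indicator {x. \<not> P x} z) \<in> borel_measurable \<nu>"
    "(\<lambda>z. ennreal ((norm (G z))\<^sup>2) * indicator {x. P x} z) \<in> borel_measurable \<nu>"
    "(\<lambda>z. indicator {x. \<not> P x} z :: ennreal) \<in> borel_measurable \<nu>"
    "(\<lambda>z. ennreal (norm (G z) ^ (2 * m))) \<in> borel_measurable \<nu>"
  proof -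
    have [measurable]: "(\<lambda>z. indicator {x. P x} z :: ennreal) \<in> borel_measurable \<nu>"
      using A by (simp add: borel_measurable_indicator_iff)
    have "{x. \<not> P x} \<inter> space \<nu> = space \<nu> - ({x. P x} \<inter> space \<nu>)" by auto
    then have [measurable]: "(\<lambda>z. indicator {x. \<not> P x} z :: ennreal) \<in> borel_measurable \<nu>"
      using A by (simp add: borel_measurable_indicator_iff)
    note G[measurable]
    show "(\<lambda>z. ennreal (c / x) * (ennreal ((norm (G z))\<^sup>2) * indicator {x. P x} z))
      \<in> borel_measurable \<nu>"
    "(\<lambda>z. ennreal (c / x ^ m) * ennreal (norm (G z) ^ (2 * m))) \<in> borel_measurable \<nu>"
    "(\<lambda>z. ennreal c * indicator {x. \<not> P x} z) \<in> borel_measurable \<nu>"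
    "(\<lambda>z. ennreal ((norm (G z))\<^sup>2) * indicator {x. P x} z) \<in> borel_measurable \<nu>"
    "(\<lambda>z. indicator {x. \<not> P x} z :: ennreal) \<in> borel_measurable \<nu>"
    "(\<lambda>z. ennreal (norm (G z) ^ (2 * m))) \<in> borel_measurable \<nu>"
      by measurable
  qed
  have "(\<integral>\<^sup>+z. ennreal (norm (J z)) \<partial>\<nu>) \<le> (\<integral>\<^sup>+z. ennreal (c / x) * (ennreal ((norm (G z))\<^sup>2) *
    indicator {x. P x} z)
      + ennreal (c / x ^ m) * ennreal (norm (G z) ^ (2 * m))
        + ennreal c * indicator {x. \<not> P x} z \<partial>\<nu>)"
  proof (rule nn_integral_mono)
    fix z
    have "ennreal (norm (J z)) \<le> ennreal (c / x * ((norm (G z))\<^sup>2 * indicator {x. P x} z)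
      + c / x ^ m * norm (G z) ^ (2 * m) + c * indicator {x. \<not> P x} z)"
      using J[of z] by (intro ennreal_leI) simp
    also have "\<dots> = ennreal (c / x) * (ennreal ((norm (G z))\<^sup>2) * indicator {x. P x} z)
      + ennreal (c / x ^ m) * ennreal (norm (G z) ^ (2 * m)) + ennreal c * indicator {x. \<not> P x} z"
    proof -
      have "ennreal (c / x * (norm (G z))\<^sup>2) = ennreal (c / x) * ennreal ((norm (G z))\<^sup>2)"
        "ennreal (c / x ^ m * norm (G z) ^ (2 * m))
          = ennreal (c / x ^ m) * ennreal (norm (G z) ^ (2 * m))"
        using c x by (intro ennreal_mult; simp)+
      then show ?thesis
        using c x by (subst ennreal_plus, simp, simp, subst ennreal_plus, simp, simp)
          (auto simp: indicator_def)
    qed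
    finally show "ennreal (norm (J z)) \<le> \<dots>" .
  qed
  also have "\<dots> = ennreal (c / x) * (\<integral>\<^sup>+z\<in>{x. P x}. ennreal ((norm (G z))\<^sup>2) \<partial>\<nu>)
      + ennreal (c / x ^ m) * (\<integral>\<^sup>+z. ennreal (norm (G z) ^ (2 * m)) \<partial>\<nu>)
        + ennreal c * (\<integral>\<^sup>+z. indicator {x. \<not> P x} z \<partial>\<nu>)"
    using 1 by (simp add: nn_integral_add nn_integral_cmult)
  also have "\<dots> \<le> ennreal (c / x) * ennreal (k1 * x) + ennreal (c / x ^ m) * ennreal (k2 * x ^ m)
    + ennreal c * ennreal k3"
    using c1 c2 c3 unfolding x_def by (intro add_mono mult_left_mono) auto
  also have "\<dots> = ennreal (c * (k1 + k2 + k3))"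
    using c x k by (simp flip: ennreal_mult ennreal_plus) (simp add: algebra_simps)
  finally have "(\<integral>\<^sup>+z. ennreal (norm (J z)) \<partial>\<nu>) \<le> ennreal (c * (k1 + k2 + k3))" .
  from norm_integral_le_nn_integral[OF this] have "\<bar>\<integral>z. J z \<partial>\<nu>\<bar> \<le> c * (k1 + k2 + k3)"
    using c k by simp
  then show ?thesis by (simp add: J_def c_def x_def mult_ac)
qed

lemma abs_trace_mult_le:
  fixes A :: "real^'m^'n" and B :: "real^'n^'m"
  assumes "norm A \<le> a" "\<And>i j. \<bar>B $ i $ j\<bar> \<le> b"
  shows "\<bar>trace (A ** B)\<bar> \<le> real CARD('n) * real CARD('m) * (a * b)"
proof -
  have "\<bar>A $ i $ k * B $ k $ i\<bar> \<le> a * b" for i k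
  proof -
    have "\<bar>A $ i $ k\<bar> \<le> norm (A $ i)" by (rule component_le_norm_cart)
    also have "\<dots> \<le> norm A" by (rule Finite_Cartesian_Product.norm_nth_le)
    finally have "\<bar>A $ i $ k\<bar> \<le> a" using assms(1) by simp
    then show ?thesis
      unfolding abs_mult using assms(2)[of k i] by (intro mult_mono) auto
  qed
  then have "\<bar>\<Sum>i\<in>UNIV. \<Sum>k\<in>UNIV. A $ i $ k * B $ k $ i\<bar>
    \<le> (\<Sum>i\<in>(UNIV::'n set). \<Sum>k\<in>(UNIV::'m set). a * b)"
    by (intro order_trans[OF sum_abs] sum_mono order_trans[OF sum_abs]) auto
  then show ?thesis by (simp add: trace_def matrix_matrix_mult_def)
qed

text \<open>Markov's inequality: outside the ball of radius a the integrand min(|x|^2, 1) is at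
  least min(a^2, 1) > 0.\<close>

lemma levy_measure_large_jumps:
  assumes "levy_measure \<nu>" "0 < a"
  shows "\<exists>k\<ge>0. (\<integral>\<^sup>+x. indicator {x. \<not> norm x \<le> a} x \<partial>\<nu>) \<le> ennreal k"
proof -
  define b where "b = min (a\<^sup>2) 1"
  have b: "0 < b" using assms(2) by (simp add: b_def)
  have sets: "sets \<nu> = sets borel" and fin: "(\<integral>\<^sup>+x. ennreal (min ((norm x)\<^sup>2) 1) \<partial>\<nu>) < \<infinity>"
    using assms(1) by (auto simp: levy_measure_def)
  have "(\<integral>\<^sup>+x. indicator {x. \<not> norm x \<le> a} x \<partial>\<nu>)
    \<le> (\<integral>\<^sup>+x. ennreal (1 / b) * ennreal (min ((norm x)\<^sup>2) 1) \<partial>\<nu>)"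
  proof (rule nn_integral_mono)
    fix x
    show "indicator {x. \<not> norm x \<le> a} x \<le> ennreal (1 / b) * ennreal (min ((norm x)\<^sup>2) 1)"
    proof (cases "norm x \<le> a")
      case False
      then have "a\<^sup>2 \<le> (norm x)\<^sup>2" using assms(2) by (intro power_mono) auto
      then have "1 \<le> 1 / b * min ((norm x)\<^sup>2) 1" using b unfolding b_def by (simp add: field_simps) 
      then have "ennreal 1 \<le> ennreal (1 / b * min ((norm x)\<^sup>2) 1)" by (rule ennreal_leI)
      also have "\<dots> = ennreal (1 / b) * ennreal (min ((norm x)\<^sup>2) 1)" using b
        by (intro ennreal_mult) auto
      finally show ?thesis using False by simp
    qed simp
  qed
  also have "\<dots> = ennreal (1 / b) * (\<integral>\<^sup>+x. ennreal (min ((norm x)\<^sup>2) 1) \<partial>\<nu>)"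
  proof (rule nn_integral_cmult)
    have "(\<lambda>x::real^'a. ennreal (min ((norm x)\<^sup>2) 1)) \<in> borel_measurable borel" by measurable
    then show "(\<lambda>x::real^'a. ennreal (min ((norm x)\<^sup>2) 1)) \<in> borel_measurable \<nu>"
      using measurable_cong_sets[OF sets refl] by blast
  qed
  also have "\<dots> < \<infinity>" using fin by (simp add: ennreal_mult_less_top)
  finally show ?thesis
    by (metis enn2real_nonneg ennreal_enn2real infinity_ennreal_def order_refl)
qed


text \<open>Linear growth is matched by the decay of the derivatives: 2 |y . b| <= |y|^2 + |b|^2 is
  of order x against f' of order W/x, and the Hessian has entries at most (4 + 2) W/x against a
  diffusion matrix of order x.\<close>

lemma radial_local_terms_bound:
  fixes y b :: "real^'d" and A :: "real^'d^'d"
  assumes s: "scaled_C2 W f f1 f2" and k: "0 \<le> k"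
    and b: "(norm b)\<^sup>2 \<le> k * (1 + (norm y)\<^sup>2)" and A: "norm A \<le> k * (1 + (norm y)\<^sup>2)"
  shows "\<bar>grad (radial f) y \<bullet> b\<bar> \<le> (1 + k) * radial W y"
    and "\<bar>1/2 * trace (A ** hessian (radial f) y)\<bar> \<le> 3 * (real CARD('d))\<^sup>2 * k * radial W y"
proof -
  define x where "x = 1 + (norm y)\<^sup>2"
  have x: "1 \<le> x" by (simp add: x_def)
  have W: "0 \<le> W x" by (rule scaled_C2_nonneg[OF s x])
  have f1: "\<bar>f1 x\<bar> \<le> W x / x" and f2: "\<bar>f2 x\<bar> \<le> W x / x\<^sup>2"
    using s x unfolding scaled_C2_def by blast+
  have "2 * \<bar>y \<bullet> b\<bar> \<le> (norm y)\<^sup>2 + (norm b)\<^sup>2"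
    using Cauchy_Schwarz_ineq2[of y b] sum_squares_bound[of "norm y" "norm b"] by linarith
  also have "\<dots> \<le> (1 + k) * x" using b by (simp add: x_def algebra_simps)
  finally have yb: "2 * \<bar>y \<bullet> b\<bar> \<le> (1 + k) * x" .
  have "\<bar>f1 x\<bar> * (2 * \<bar>y \<bullet> b\<bar>) \<le> W x / x * ((1 + k) * x)"
    by (rule mult_mono[OF f1 yb]) (use W x in auto)
  then show "\<bar>grad (radial f) y \<bullet> b\<bar> \<le> (1 + k) * radial W y"
    using x unfolding grad_radial[OF s] x_def[symmetric] by (simp add: abs_mult mult_ac)
  have "\<bar>hessian (radial f) y $ i $ j\<bar> \<le> 6 * (W x / x)" for i j
  proof -
    have "\<bar>y $ i\<bar> * \<bar>y $ j\<bar> \<le> norm y * norm y"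
      by (intro mult_mono component_le_norm_cart) auto
    then have "\<bar>y $ i * y $ j\<bar> \<le> x" by (simp add: x_def abs_mult power2_eq_square)
    then have "\<bar>f2 x\<bar> * \<bar>y $ i * y $ j\<bar> \<le> W x / x\<^sup>2 * x"
      using f2 W x by (intro mult_mono) auto
    then have "\<bar>f2 x * (y $ i * y $ j)\<bar> \<le> W x / x"
      using x unfolding abs_mult[of "f2 x"] by (simp add: power2_eq_square)
    moreover have "hessian (radial f) y $ i $ j = 4 * (f2 x * (y $ i * y $ j)) + 2 * f1 x * (if i
      = j then 1 else 0)"
      by (simp add: hessian_radial[OF s] x_def)
    ultimately show ?thesis using f1 by (cases "i = j") auto
  qed
  from abs_trace_mult_le[OF A this]
  have "\<bar>trace (A ** hessian (radial f) y)\<bar> \<le> (real CARD('d))\<^sup>2 * (k * x * (6 * (W x / x)))"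
    by (simp add: x_def power2_eq_square)
  also have "\<dots> = 6 * (real CARD('d))\<^sup>2 * k * W x" using x by simp
  finally show "\<bar>1/2 * trace (A ** hessian (radial f) y)\<bar> \<le> 3 * (real CARD('d))\<^sup>2 * k * radial W y"
    by (simp add: x_def)
qed

text \<open>Radial functions ignore the regime, so a switch is felt only through its displacement.
  This has u <= k, and the shift bound becomes a constant multiple of \<open>W\<close>.\<close>

lemma switching_bound:
  fixes w :: "nat \<Rightarrow> real^'d" and l :: "nat \<Rightarrow> real"
  assumes s: "scaled_C2 W f f1 f2" and mw: "moderate_weight m W" and k: "0 \<le> k"
    and w: "\<And>j. j \<in> {1..K} - {c} \<Longrightarrow> (norm (w j))\<^sup>2 \<le> k * (1 + (norm y)\<^sup>2)"
    and l: "\<And>j. j \<in> {1..K} - {c} \<Longrightarrow> \<bar>l j\<bar> \<le> b" and b: "0 \<le> b"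
  shows "\<bar>\<Sum>j\<in>{1..K} - {c}. (radial f (y + w j) - radial f y) * l j\<bar>
    \<le> real K * ((4 ^ m * (1 + k ^ m) + 1) * b) * radial W y"
proof -
  define x where "x = 1 + (norm y)\<^sup>2"
  have x: "1 \<le> x" by (simp add: x_def)
  have W: "0 \<le> W x" by (rule scaled_C2_nonneg[OF s x])
  define B where "B = (4 ^ m * (1 + k ^ m) + 1) * W x * b"
  have B: "0 \<le> B" using W b k by (simp add: B_def)
  have "\<bar>(radial f (y + w j) - radial f y) * l j\<bar> \<le> B" if j: "j \<in> {1..K} - {c}" for j
  proof -
    have "(norm (w j))\<^sup>2 / x \<le> k" using w[OF j] x by (simp add: x_def[symmetric] divide_le_eq)
    then have "((norm (w j))\<^sup>2 / x) ^ m \<le> k ^ m" using x by (intro power_mono) auto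
    then have "4 ^ m * (1 + ((norm (w j))\<^sup>2 / x) ^ m) * W x \<le> 4 ^ m * (1 + k ^ m) * W x"
      using W by (intro mult_right_mono mult_left_mono) auto
    then have "\<bar>radial f (y + w j)\<bar> \<le> 4 ^ m * (1 + k ^ m) * W x"
      using radial_shift_bound[OF s mw, of y "w j"] unfolding x_def by (rule order_trans[rotated])
    moreover have "\<bar>radial f y\<bar> \<le> W x" using s x unfolding scaled_C2_def x_def by blast
    ultimately have "\<bar>radial f (y + w j) - radial f y\<bar> \<le> (4 ^ m * (1 + k ^ m) + 1) * W x"
      unfolding distrib_right by (intro order_trans[OF abs_triangle_ineq4]) simp
    then show ?thesis unfolding abs_mult B_def
      using l[OF j] W k by (intro mult_mono) auto
  qed
  then have "\<bar>\<Sum>j\<in>{1..K} - {c}. (radial f (y + w j) - radial f y) * l j\<bar> \<le> (\<Sum>j\<in>{1..K} - {c}. B)"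
    by (intro order_trans[OF sum_abs] sum_mono)
  also have "\<dots> \<le> (\<Sum>j\<in>{1..K}. B)" using B by (intro sum_mono2) auto
  finally show ?thesis by (simp add: B_def x_def mult_ac)
qed

lemma ennreal_add_le_ennrealD:
  assumes "ennreal p + q \<le> ennreal s" "0 \<le> s"
  shows "p \<le> s" "q \<le> ennreal s"
proof -
  have "ennreal p \<le> ennreal s" using assms(1) by (rule order_trans[rotated]) simp
  then show "p \<le> s" using assms(2) by simp
  show "q \<le> ennreal s" using assms(1) by (rule order_trans[rotated]) simp
qed

text \<open>The order of the quantifiers is the point: one constant \<open>L\<close> serves all
  weights and functions, hence all cutoffs and all values of e at once.\<close>

lemma generator_radial_bound:
  fixes \<nu> :: "(real^'n) measure"
    and \<mu> :: "real \<Rightarrow> real^'d \<Rightarrow> nat \<Rightarrow> real^'d"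
    and \<sigma> :: "real \<Rightarrow> real^'d \<Rightarrow> nat \<Rightarrow> real^'p^'d"
  assumes "0 < a" "0 \<le> r" "1 \<le> m"
    and coeffs: "standing_assumptions T a K \<nu> \<mu> \<sigma> F \<rho> lam"
    and LG: "\<exists>K1>0. \<forall>t\<in>{r..T}. \<forall>y. \<forall>c\<in>{1..K}.
               ennreal ((norm (\<mu> t y c))\<^sup>2 + norm (\<sigma> t y c ** transpose (\<sigma> t y c)))
               + (\<integral>\<^sup>+x\<in>{x. norm x \<le> a}. ennreal ((norm (F t y c x))\<^sup>2) \<partial>\<nu>)
               \<le> ennreal (K1 * (1 + (norm y)\<^sup>2))"
    and growth_2: "\<exists>K3\<ge>0. \<forall>t\<in>{r..T}. \<forall>y. \<forall>c\<in>{1..K}. \<forall>k\<in>{1..K} - {c}.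
               (\<integral>\<^sup>+x\<in>{x. norm x > a}. ennreal ((norm (F t y c x))\<^sup>2) \<partial>\<nu>)
               + ennreal ((norm (\<rho> c k t y))\<^sup>2)
               \<le> ennreal (K3 * (1 + (norm y)\<^sup>2))"
    and growth_2m: "\<exists>K4\<ge>0. \<forall>t\<in>{r..T}. \<forall>y. \<forall>c\<in>{1..K}.
               (\<integral>\<^sup>+x. ennreal (norm (F t y c x) ^ (2 * m)) \<partial>\<nu>)
               \<le> ennreal (K4 * (1 + norm y ^ (2 * m)))"
  shows "\<exists>L\<ge>0. \<forall>W f f1 f2. moderate_weight m W \<longrightarrow> scaled_C2 W f f1 f2 \<longrightarrow>
    (\<forall>t\<in>{r..T}. \<forall>y. \<forall>c\<in>{1..K}.
       \<bar>generator a K \<nu> \<mu> \<sigma> F \<rho> lam t (\<lambda>y c. radial f y) y c\<bar> \<le> L * radial W y)"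
proof -
  have levy: "levy_measure \<nu>" using coeffs by (simp add: standing_assumptions_def Let_def)
  then have sets: "sets \<nu> = sets borel" by (simp add: levy_measure_def)
  then have space: "space \<nu> = UNIV" by (metis sets_eq_imp_space_eq space_borel)
  obtain k0 where k0: "0 \<le> k0" "(\<integral>\<^sup>+x. indicator {x. \<not> norm x \<le> a} x \<partial>\<nu>) \<le> ennreal k0"
    using levy_measure_large_jumps[OF levy \<open>0 < a\<close>] by blast
  obtain k1 where k1: "0 < k1" and LG': "\<forall>t\<in>{r..T}. \<forall>y. \<forall>c\<in>{1..K}.
               ennreal ((norm (\<mu> t y c))\<^sup>2 + norm (\<sigma> t y c ** transpose (\<sigma> t y c)))
               + (\<integral>\<^sup>+x\<in>{x. norm x \<le> a}. ennreal ((norm (F t y c x))\<^sup>2) \<partial>\<nu>)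
               \<le> ennreal (k1 * (1 + (norm y)\<^sup>2))"
    using LG by (elim exE conjE) (rule that)
  obtain k3 where k3: "0 \<le> k3" and g2: "\<forall>t\<in>{r..T}. \<forall>y. \<forall>c\<in>{1..K}. \<forall>k\<in>{1..K} - {c}.
      (\<integral>\<^sup>+x\<in>{x. norm x > a}. ennreal ((norm (F t y c x))\<^sup>2) \<partial>\<nu>) + ennreal ((norm (\<rho> c k t y))\<^sup>2)
               \<le> ennreal (k3 * (1 + (norm y)\<^sup>2))"
    using growth_2 by (elim exE conjE) (rule that)
  obtain k4 where k4: "0 \<le> k4" and g2m: "\<forall>t\<in>{r..T}. \<forall>y. \<forall>c\<in>{1..K}.
               (\<integral>\<^sup>+x. ennreal (norm (F t y c x) ^ (2 * m)) \<partial>\<nu>) \<le> ennreal (k4 * (1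
                 + norm y ^ (2 * m)))"
    using growth_2m by (elim exE conjE) (rule that)
  have "\<forall>i\<in>{1..K}. \<forall>j\<in>{1..K} - {i}. \<exists>B. \<forall>t\<in>{0..T}. \<forall>y. 0 \<le> lam i j t y \<and> lam i j t y \<le> B"
    using coeffs unfolding standing_assumptions_def Let_def by (elim conjE) blast
  then obtain B where B: "\<forall>i\<in>{1..K}. \<forall>j\<in>{1..K} - {i}. \<forall>t\<in>{0..T}. \<forall>y. 0 \<le> lam i j t y \<and> lam i j t y
    \<le> B i j"
    unfolding bchoice_iff by (elim exE) (rule that)
  \<comment> \<open>Each pair of regimes has its own bound on the rate; the sum of their absolute
    values is a common one.\<close>
  define b where "b = (\<Sum>i\<in>{1..K}. \<Sum>j\<in>{1..K}. \<bar>B i j\<bar>)"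
  have b: "0 \<le> b" by (auto simp: b_def intro!: sum_nonneg)
  have lam_b: "\<bar>lam i j t y\<bar> \<le> b" if "i \<in> {1..K}" "j \<in> {1..K} - {i}" "t \<in> {0..T}" for i j t y
  proof -
    have "\<bar>B i j\<bar> \<le> (\<Sum>j\<in>{1..K}. \<bar>B i j\<bar>)" using that by (intro member_le_sum) auto
    also have "\<dots> \<le> b" unfolding b_def
      using that by (intro member_le_sum[of i "{1..K}"
        "\<lambda>i. \<Sum>j\<in>{1..K}. \<bar>B i j\<bar>"]) (auto intro: sum_nonneg)
    finally show ?thesis using B[rule_format, OF that, of y] by linarith
  qed
  have F_meas: "F t y c \<in> borel_measurable \<nu>" if "t \<in> {r..T}" "c \<in> {1..K}" for t y c
  proof -
    let ?S = "{0..T} \<times> (UNIV :: (real^'d) set) \<times> {1..K} \<times> (UNIV :: (real^'n) set)"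
    have "(\<lambda>(t, y, c, x). F t y c x) \<in> borel_measurable (restrict_space borel ?S)"
      using coeffs by (simp add: standing_assumptions_def Let_def)
    moreover have "(\<lambda>x. (t, y, c, x)) \<in> \<nu> \<rightarrow>\<^sub>M restrict_space borel ?S"
    proof (rule measurable_restrict_space2)
      have "(\<lambda>x::real^'n. (t, y, c, x)) \<in> borel \<rightarrow>\<^sub>M borel"
        by (intro borel_measurable_continuous_onI continuous_intros)
      then show "(\<lambda>x. (t, y, c, x)) \<in> \<nu> \<rightarrow>\<^sub>M borel"
        using measurable_cong_sets[OF sets refl] by blast
    qed (use that \<open>0 \<le> r\<close> in auto)
    ultimately show ?thesis by (auto dest: measurable_compose_rev)
  qed
  define L where "L = (1 + k1) + 3 * (real CARD('d))\<^sup>2 * k1 + 20 * 10 ^ m * (k1 + 2 * k4 + k0)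
     + real K * ((4 ^ m * (1 + k3 ^ m) + 1) * b)"
  have L: "0 \<le> L" unfolding L_def using k0 k1 k3 k4 b
    by (intro add_nonneg_nonneg mult_nonneg_nonneg) auto
  have "\<bar>generator a K \<nu> \<mu> \<sigma> F \<rho> lam t (\<lambda>y c. radial f y) y c\<bar> \<le> L * radial W y"
    if mw: "moderate_weight m W" and s: "scaled_C2 W f f1 f2" and t: "t \<in> {r..T}" and c: "c
      \<in> {1..K}"
    for W f f1 f2 t y c
  proof -
    have kx: "0 \<le> k * (1 + (norm y)\<^sup>2)" if "0 \<le> k" for k
      using that by simp
    have lg: "(norm (\<mu> t y c))\<^sup>2 + norm (\<sigma> t y c ** transpose (\<sigma> t y c)) \<le> k1 * (1 + (norm y)\<^sup>2)"
      "(\<integral>\<^sup>+x\<in>{x. norm x \<le> a}. ennreal ((norm (F t y c x))\<^sup>2) \<partial>\<nu>) \<le> ennreal (k1 * (1 + (norm y)\<^sup>2))"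
      using ennreal_add_le_ennrealD[OF LG'[rule_format, OF t c] kx] k1 by auto
    have mu: "(norm (\<mu> t y c))\<^sup>2 \<le> k1 * (1 + (norm y)\<^sup>2)"
      and sig: "norm (\<sigma> t y c ** transpose (\<sigma> t y c)) \<le> k1 * (1 + (norm y)\<^sup>2)"
      using lg(1) zero_le_power2[of "norm (\<mu> t y c)"] norm_ge_zero[of
        "\<sigma> t y c ** transpose (\<sigma> t y c)"]
      by linarith+
    have rho: "(norm (\<rho> c j t y))\<^sup>2 \<le> k3 * (1 + (norm y)\<^sup>2)" if "j \<in> {1..K} - {c}" for j
      using ennreal_add_le_ennrealD(1)[OF g2[rule_format, OF t c that, unfolded add.commute[of _
        "ennreal ((norm _)\<^sup>2)"]] kx[OF k3]] .
    \<comment> \<open>Passing from 1 + |y|^(2m) to a power of x costs the factor 2 that appears as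
      \<open>2 * k4\<close> in \<open>L\<close>.\<close>
    have "1 + norm y ^ (2 * m) \<le> 2 * (1 + (norm y)\<^sup>2) ^ m"
    proof -
      have "norm y ^ (2 * m) \<le> (1 + (norm y)\<^sup>2) ^ m" unfolding power_mult by (intro power_mono) auto
      moreover have "1 \<le> (1 + (norm y)\<^sup>2) ^ m" by (intro one_le_power) simp
      ultimately show ?thesis by linarith
    qed
    then have "k4 * (1 + norm y ^ (2 * m)) \<le> 2 * k4 * (1 + (norm y)\<^sup>2) ^ m"
      using mult_left_mono[OF _ k4] by fastforce
    then have F2m: "(\<integral>\<^sup>+x. ennreal (norm (F t y c x) ^ (2 * m)) \<partial>\<nu>) \<le> ennreal (2 * k4 * (1
      + (norm y)\<^sup>2) ^ m)"
      using g2m[rule_format, OF t c] ennreal_leI by (blast intro: order_trans)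
    have "{x. norm x \<le> a} \<inter> space \<nu> \<in> sets \<nu>" unfolding sets space by measurable
    note j = jump_integral_bound[OF s mw F_meas[OF t c] this lg(2) F2m k0(2)]
    have "\<bar>\<integral>x. radial f (y + F t y c x) - radial f y
             - (grad (radial f) y \<bullet> F t y c x) * indicator {x. norm x \<le> a} x \<partial>\<nu>\<bar>
          \<le> 20 * 10 ^ m * (k1 + 2 * k4 + k0) * radial W y"
      unfolding grad_radial[OF s] by (rule j) (use k0 k1 k4 in auto)
    moreover note radial_local_terms_bound[OF s _ mu sig]
    moreover have "\<bar>\<Sum>k\<in>{1..K} - {c}. (radial f (y + \<rho> c k t y) - radial f y) * lam c k t y\<bar>
      \<le> real K * ((4 ^ m * (1 + k3 ^ m) + 1) * b) * radial W y"
      by (rule switching_bound[OF s mw k3 rho lam_b[OF c] b]) (use t \<open>0 \<le> r\<close> in auto)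
    ultimately show ?thesis
      unfolding generator_def L_def distrib_right using k1
      by (intro order_trans[OF abs_triangle_ineq] add_mono) auto
  qed
  with L show ?thesis by blast
qed

section \<open>Gronwall's inequality, Doob's inequality and bounded local martingales\<close>

text \<open>The argument uses a weighted supremum: \<open>\<beta>\<close> is the supremum of exp(-2
  c (u - r)) P(u), and the integral of \<open>P\<close> is compared with that of its measurable
  majorant. The rate 2 c makes the integral operator contract by 1/2 in this norm, so that
  \<open>\<beta>\<close> is at most b plus half of itself, which is the origin of
  \<open>2 * b\<close>.\<close>

lemma gronwall_nn_integral:
  fixes P :: "real \<Rightarrow> ennreal"
  assumes bound: "\<And>u. u \<in> {r<..T} \<Longrightarrow> P u \<le> ennreal B"
    and ineq: "\<And>u. u \<in> {r<..T} \<Longrightarrow> P u \<le> b + ennreal c * (\<integral>\<^sup>+v\<in>{r<..u}. P v \<partial>lborel)"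
    and c: "0 < c" and u: "u \<in> {r<..T}"
  shows "P u \<le> ennreal (exp (2 * c * (T - r))) * (2 * b)"
proof -
  define e where "e u = exp (2 * c * (u - r))" for u
  have e: "1 \<le> e u" if "r \<le> u" for u using that c by (simp add: e_def)
  have epos: "0 < e u" for u by (simp add: e_def)
  define \<beta> where "\<beta> = (SUP u\<in>{r<..T}. ennreal (1 / e u) * P u)"
  have "\<beta> \<le> ennreal B"
    unfolding \<beta>_def
  proof (rule SUP_least)
    fix u assume u: "u \<in> {r<..T}"
    have "ennreal (1 / e u) * P u \<le> ennreal 1 * ennreal B"
      using e[of u] u by (intro mult_mono ennreal_leI bound) auto
    then show "ennreal (1 / e u) * P u \<le> ennreal B" by simp
  qed
  then obtain q where q: "\<beta> = ennreal q" "0 \<le> q"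
    by (metis ennreal_cases ennreal_less_top top.not_eq_extremum top_unique)
  have Pe: "P v \<le> \<beta> * ennreal (e v)" if "v \<in> {r<..T}" for v
  proof -
    have "P v = ennreal (e v) * (ennreal (1 / e v) * P v)"
      using epos[of v] by (simp flip: ennreal_mult mult.assoc)
    also have "\<dots> \<le> ennreal (e v) * \<beta>"
      unfolding \<beta>_def using that by (intro mult_left_mono SUP_upper) auto
    finally show ?thesis by (simp add: mult.commute)
  qed
  have "ennreal (1 / e u) * P u \<le> b + ennreal (q / 2)" if u: "u \<in> {r<..T}" for u
  proof -
    have "(\<integral>\<^sup>+v\<in>{r<..u}. P v \<partial>lborel) \<le> (\<integral>\<^sup>+v. \<beta> * (ennreal (e v) * indicator {r..u} v) \<partial>lborel)"
      using u Pe by (intro nn_integral_mono) (auto simp: indicator_def)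
    also have "\<dots> = \<beta> * (\<integral>\<^sup>+v. ennreal (e v) * indicator {r..u} v \<partial>lborel)"
      by (rule nn_integral_cmult) (auto simp: e_def)
    also have "(\<integral>\<^sup>+v. ennreal (e v) * indicator {r..u} v \<partial>lborel)
      = ennreal (e u / (2 * c) - e r / (2 * c))"
    proof (rule nn_integral_FTC_Icc)
      show "e \<in> borel_measurable borel" unfolding e_def by measurable
      show "((\<lambda>u. e u / (2 * c)) has_real_derivative e x) (at x)" if "x \<in> {r..u}" for x
        unfolding e_def using c by (auto intro!: derivative_eq_intros)
      show "0 \<le> e x" if "x \<in> {r..u}" for x using epos[of x] by simp
      show "r \<le> u" using u by simp
    qed
    also have "\<dots> \<le> ennreal (e u / (2 * c))" using c epos[of r] by (intro ennreal_leI) simp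
    finally have "(\<integral>\<^sup>+v\<in>{r<..u}. P v \<partial>lborel) \<le> \<beta> * ennreal (e u / (2 * c))"
      by (simp add: mult_left_mono)
    then have "P u \<le> b + ennreal c * (\<beta> * ennreal (e u / (2 * c)))"
      using ineq[OF u] by (meson add_left_mono mult_left_mono order_trans zero_le)
    also have "ennreal c * (\<beta> * ennreal (e u / (2 * c))) = ennreal (e u * (q / 2))"
      unfolding q using c epos[of u] q(2) by (simp flip: ennreal_mult)
    finally have "ennreal (1 / e u) * P u \<le> ennreal (1 / e u) * (b + ennreal (e u * (q / 2)))"
      by (rule mult_left_mono) simp
    also have "\<dots> = ennreal (1 / e u) * b + ennreal (q / 2)"
      using epos[of u] q(2) by (simp add: distrib_left flip: ennreal_mult)
    also have "\<dots> \<le> 1 * b + ennreal (q / 2)"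
      using e[of u] epos[of u] u by (intro add_mono mult_right_mono) (auto simp: ennreal_le_1)
    finally show ?thesis by simp
  qed
  then have "\<beta> \<le> b + ennreal (q / 2)" unfolding \<beta>_def by (intro SUP_least)
  \<comment> \<open>Subtracting q/2 is legitimate because the a priori bound has made
    \<open>\<beta>\<close> finite; for infinite b the claim is trivial.\<close>
  then have "\<beta> \<le> 2 * b"
  proof (cases b)
    case (real b')
    then have "q \<le> b' + q / 2"
      using \<open>\<beta> \<le> b + ennreal (q / 2)\<close> q by (simp flip: ennreal_plus)
    then have "ennreal q \<le> ennreal (2 * b')" by (intro ennreal_leI) simp
    then show ?thesis using real q by (simp add: ennreal_mult)
  qed (simp add: ennreal_mult_top)
  have "P u \<le> ennreal (e u) * \<beta>" using Pe[OF u] by (simp add: mult.commute)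
  also have "\<dots> \<le> ennreal (exp (2 * c * (T - r))) * (2 * b)"
    using u c \<open>\<beta> \<le> 2 * b\<close> unfolding e_def by (intro mult_mono ennreal_leI) auto
  finally show ?thesis .
qed

section \<open>Doob's inequality in discrete time\<close>

fun running_max :: "(nat \<Rightarrow> 'w \<Rightarrow> real) \<Rightarrow> nat \<Rightarrow> 'w \<Rightarrow> real" where
  "running_max X 0 \<omega> = \<bar>X 0 \<omega>\<bar>"
| "running_max X (Suc n) \<omega> = max (running_max X n \<omega>) \<bar>X (Suc n) \<omega>\<bar>"

lemma abs_le_running_max: "i \<le> n \<Longrightarrow> \<bar>X i \<omega>\<bar> \<le> running_max X n \<omega>"
  by (induction n) (auto simp: le_Suc_eq max.coboundedI1)

lemma running_max_nonneg: "0 \<le> running_max X n \<omega>"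
  using abs_le_running_max[of 0 n X \<omega>] by simp

lemma running_max_le: "(\<And>i. i \<le> n \<Longrightarrow> \<bar>X i \<omega>\<bar> \<le> B) \<Longrightarrow> running_max X n \<omega> \<le> B"
  by (induction n) auto

lemma borel_measurable_running_max:
  "(\<And>i. i \<le> n \<Longrightarrow> X i \<in> borel_measurable N) \<Longrightarrow> running_max X n \<in> borel_measurable N"
proof (induction n)
  case 0
  then have [measurable]: "X 0 \<in> borel_measurable N" by simp
  have "(\<lambda>\<omega>. \<bar>X 0 \<omega>\<bar>) \<in> borel_measurable N" by measurable
  then show ?case by simp
next
  case (Suc n)
  then have [measurable]: "X (Suc n) \<in> borel_measurable N" "running_max X n \<in> borel_measurable N"
    by simp_all
  have "(\<lambda>\<omega>. max (running_max X n \<omega>) \<bar>X (Suc n) \<omega>\<bar>) \<in> borel_measurable N" by measurable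
  then show ?case by simp
qed

text \<open>A discrete analogue of integrating the running maximum against |X|. If the new value s
  stays below the old maximum b, both sides change by b times the increment; if s is larger, the
  claim b s - b^2/2 <= s^2/2 is (s - b)^2 >= 0.\<close>

lemma running_max_sum_le:
  "(\<Sum>i<n. running_max X i \<omega> * (\<bar>X (Suc i) \<omega>\<bar> - \<bar>X i \<omega>\<bar>))
     \<le> running_max X n \<omega> * \<bar>X n \<omega>\<bar> - (running_max X n \<omega>)\<^sup>2 / 2"
proof (induction n)
  case 0
  then show ?case by (simp add: power2_eq_square)
next
  case (Suc n)
  define b s where "b = running_max X n \<omega>" and "s = \<bar>X (Suc n) \<omega>\<bar>"
  have "(\<Sum>i<Suc n. running_max X i \<omega> * (\<bar>X (Suc i) \<omega>\<bar> - \<bar>X i \<omega>\<bar>)) \<le> b * s - b\<^sup>2 / 2"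
    using Suc.IH by (simp add: b_def s_def algebra_simps)
  also have "\<dots> \<le> max b s * s - (max b s)\<^sup>2 / 2"
    using zero_le_power2[of "s - b"] by (auto simp: max_def power2_eq_square field_simps)
  finally show ?case by (simp add: b_def s_def)
qed

text \<open>The transform of the submartingale \<open>|X|\<close> by its running maximum has nonnegative
  expectation, and \<open>running_max_sum_le\<close> bounds it pathwise.\<close>

lemma (in finite_measure) doob_L2:
  fixes X :: "nat \<Rightarrow> 'a \<Rightarrow> real"
  assumes adapted: "\<And>i j. j \<le> i \<Longrightarrow> i \<le> n \<Longrightarrow> X j \<in> borel_measurable (F i)"
    and subalg: "\<And>i. i \<le> n \<Longrightarrow> subalgebra M (F i)"
    and bounded: "\<And>i \<omega>. i \<le> n \<Longrightarrow> \<omega> \<in> space M \<Longrightarrow> \<bar>X i \<omega>\<bar> \<le> B"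
    and mart: "\<And>i Z. i < n \<Longrightarrow> Z \<in> borel_measurable (F i) \<Longrightarrow> (\<And>\<omega>. \<omega> \<in> space M \<Longrightarrow> \<bar>Z \<omega>\<bar> \<le> B) \<Longrightarrow>
      (\<integral>\<omega>. Z \<omega> * X (Suc i) \<omega> \<partial>M) = (\<integral>\<omega>. Z \<omega> * X i \<omega> \<partial>M)"
  shows "(\<integral>\<omega>. (running_max X n \<omega>)\<^sup>2 \<partial>M) \<le> 4 * (\<integral>\<omega>. (X n \<omega>)\<^sup>2 \<partial>M)"
proof -
  have XM[measurable]: "X i \<in> borel_measurable M" if "i \<le> n" for i
    using measurable_from_subalg[OF subalg adapted] that by blast
  have RM[measurable]: "running_max X i \<in> borel_measurable M" if "i \<le> n" for i
    using that by (intro borel_measurable_running_max XM) auto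
  have Rb: "\<bar>running_max X i \<omega>\<bar> \<le> B" if "i \<le> n" "\<omega> \<in> space M" for i \<omega>
    using running_max_le[of i X \<omega> B] running_max_nonneg[of X i \<omega>] bounded[OF _ that(2)] that(1)
    by (simp add: abs_of_nonneg)
  have prod_int: "integrable M (\<lambda>\<omega>. g \<omega> * h \<omega>)"
    if "g \<in> borel_measurable M" "h \<in> borel_measurable M"
      "\<And>\<omega>. \<omega> \<in> space M \<Longrightarrow> \<bar>g \<omega>\<bar> \<le> B" "\<And>\<omega>. \<omega> \<in> space M \<Longrightarrow> \<bar>h \<omega>\<bar> \<le> B" for g h :: "'a \<Rightarrow> real"
  proof (rule integrable_const_bound[of _ "B * B"])
    show "AE \<omega> in M. norm (g \<omega> * h \<omega>) \<le> B * B"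
    proof (rule AE_I2)
      fix \<omega> assume "\<omega> \<in> space M"
      from that(3)[OF this] that(4)[OF this] show "norm (g \<omega> * h \<omega>) \<le> B * B"
        unfolding real_norm_def abs_mult by (intro mult_mono) auto
    qed
  qed (use that in measurable)
  have Xi: "\<bar>\<bar>X i \<omega>\<bar>\<bar> \<le> B" if "i \<le> n" "\<omega> \<in> space M" for i \<omega> using bounded[OF that] by simp
  have term_int: "integrable M (\<lambda>\<omega>. running_max X i \<omega> * (\<bar>X (Suc i) \<omega>\<bar> - \<bar>X i \<omega>\<bar>))" if "i < n" for i
    unfolding right_diff_distrib
    using that by (intro Bochner_Integration.integrable_diff prod_int RM Rb Xi borel_measurable_abs
      XM) auto
  have nonneg: "0 \<le> (\<integral>\<omega>. running_max X i \<omega> * (\<bar>X (Suc i) \<omega>\<bar> - \<bar>X i \<omega>\<bar>) \<partial>M)" if i: "i < n" for i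
  proof -
    \<comment> \<open>The sign of \<open>X i\<close>, known at time i, linearises the absolute
      value: its product with \<open>X (Suc i)\<close> is at most the absolute value, with equality
      at time i. This is the submartingale property in integrated form. As the running maximum is at
      most B, \<open>Z\<close> is among the test variables that \<open>mart\<close> admits.\<close>
    define Z where "Z \<omega> = running_max X i \<omega> * sgn (X i \<omega>)" for \<omega>
    have Zb: "\<bar>Z \<omega>\<bar> \<le> B" if "\<omega> \<in> space M" for \<omega>
      using Rb[of i \<omega>] running_max_nonneg[of X i \<omega>] i that
        by (auto simp: Z_def abs_mult sgn_real_def)
    have ZF: "Z \<in> borel_measurable (F i)"
    proof -
      have [measurable]: "X i \<in> borel_measurable (F i)" "running_max X i \<in> borel_measurable (F i)"
        using i by (auto intro!: adapted borel_measurable_running_max)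
      show ?thesis unfolding Z_def[abs_def] by measurable
    qed
    have ZM: "Z \<in> borel_measurable M" using measurable_from_subalg[OF subalg ZF] i by simp
    have int: "integrable M (\<lambda>\<omega>. Z \<omega> * X (Suc i) \<omega>)" "integrable M (\<lambda>\<omega>. Z \<omega> * X i \<omega>)"
      using i by (auto intro!: prod_int ZM Zb bounded XM)
    have "0 = (\<integral>\<omega>. Z \<omega> * X (Suc i) \<omega> - Z \<omega> * X i \<omega> \<partial>M)"
      using mart[OF i ZF Zb] int by simp
    also have "\<dots> \<le> (\<integral>\<omega>. running_max X i \<omega> * (\<bar>X (Suc i) \<omega>\<bar> - \<bar>X i \<omega>\<bar>) \<partial>M)"
    proof (rule integral_mono)
      fix \<omega>
      have "sgn (X i \<omega>) * X (Suc i) \<omega> - sgn (X i \<omega>) * X i \<omega> \<le> \<bar>X (Suc i) \<omega>\<bar> - \<bar>X i \<omega>\<bar>"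
        by (auto simp: sgn_real_def)
      from mult_left_mono[OF this running_max_nonneg[of X i \<omega>]]
      show "Z \<omega> * X (Suc i) \<omega> - Z \<omega> * X i \<omega> \<le> running_max X i \<omega> * (\<bar>X (Suc i) \<omega>\<bar> - \<bar>X i \<omega>\<bar>)"
        by (simp add: Z_def algebra_simps)
    qed (use int term_int[OF i] in auto)
    finally show ?thesis .
  qed
  have sq: "integrable M (\<lambda>\<omega>. (X n \<omega>)\<^sup>2)" "integrable M (\<lambda>\<omega>. (running_max X n \<omega>)\<^sup>2)"
    unfolding power2_eq_square by (auto intro!: prod_int XM RM Rb bounded)
  have "0 \<le> (\<integral>\<omega>. (\<Sum>i<n. running_max X i \<omega> * (\<bar>X (Suc i) \<omega>\<bar> - \<bar>X i \<omega>\<bar>)) \<partial>M)"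
    using nonneg by (subst Bochner_Integration.integral_sum) (auto intro!: term_int sum_nonneg)
  also have "\<dots> \<le> (\<integral>\<omega>. (X n \<omega>)\<^sup>2 - (running_max X n \<omega>)\<^sup>2 / 4 \<partial>M)"
  proof (rule integral_mono)
    fix \<omega>
    \<comment> \<open>Young's inequality spends half of the negative term in the pathwise bound; the
      quarter of the squared maximum that remains is the origin of the constant 4.\<close>
    have "running_max X n \<omega> * \<bar>X n \<omega>\<bar> \<le> (running_max X n \<omega>)\<^sup>2 / 4 + (X n \<omega>)\<^sup>2"
      using zero_le_power2[of "running_max X n \<omega> / 2 - \<bar>X n \<omega>\<bar>"]
      by (simp add: power2_diff power_divide)
    then show "(\<Sum>i<n. running_max X i \<omega> * (\<bar>X (Suc i) \<omega>\<bar> - \<bar>X i \<omega>\<bar>))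
      \<le> (X n \<omega>)\<^sup>2 - (running_max X n \<omega>)\<^sup>2 / 4"
      using running_max_sum_le[of X \<omega> n] by linarith
  qed (use sq in \<open>auto intro!: term_int\<close>)
  also have "\<dots> = (\<integral>\<omega>. (X n \<omega>)\<^sup>2 \<partial>M) - (\<integral>\<omega>. (running_max X n \<omega>)\<^sup>2 \<partial>M) / 4"
    using sq by simp
  finally show ?thesis by simp
qed

text \<open>Dominated convergence along the localizing sequence. The martingale property is
  expressed by integrals against bounded variables measurable at the earlier time, the form that
  \<open>doob_L2\<close> takes as input; conditional expectations disappear from here on.\<close>

lemma (in prob_space) bounded_local_martingale:
  assumes lm: "local_martingale_on M G r T X"
    and subalg: "\<And>s. s \<in> {r..T} \<Longrightarrow> subalgebra M (G s)"
    and bounded: "\<And>t \<omega>. t \<in> {r..T} \<Longrightarrow> \<omega> \<in> space M \<Longrightarrow> \<bar>X t \<omega>\<bar> \<le> B"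
    and s: "s \<in> {r..T}" and t: "t \<in> {s..T}"
    and Z: "Z \<in> borel_measurable (G s)" and Zb: "\<And>\<omega>. \<omega> \<in> space M \<Longrightarrow> \<bar>Z \<omega>\<bar> \<le> B'"
  shows "(\<integral>\<omega>. Z \<omega> * X t \<omega> \<partial>M) = (\<integral>\<omega>. Z \<omega> * X s \<omega> \<partial>M)"
proof -
  obtain \<tau> where \<tau>: "\<And>n \<omega>. \<omega> \<in> space M \<Longrightarrow> r \<le> \<tau> n \<omega> \<and> \<tau> n \<omega> \<le> \<tau> (Suc n) \<omega> \<and> \<tau> n \<omega> \<le> T"
    and reach: "AE \<omega> in M. \<exists>n. \<tau> n \<omega> = T"
    and mart: "\<And>n. martingale_on M G r T (\<lambda>t \<omega>. X (min t (\<tau> n \<omega>)) \<omega>)"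
    using lm unfolding local_martingale_on_def by blast
  have t': "t \<in> {r..T}" using s t by auto
  have ZM: "Z \<in> borel_measurable M" by (rule measurable_from_subalg[OF subalg[OF s] Z])
  have stopped: "\<bar>X (min u (\<tau> n \<omega>)) \<omega>\<bar> \<le> B" if "u \<in> {r..T}" "\<omega> \<in> space M" for u n \<omega>
    using that \<tau>[OF that(2), of n] by (intro bounded) auto
  have XM: "X u \<in> borel_measurable M" if "u \<in> {r..T}" for u
    using lm that measurable_from_subalg[OF subalg[OF that]] unfolding local_martingale_on_def
      by blast
  have stM: "(\<lambda>\<omega>. X (min u (\<tau> n \<omega>)) \<omega>) \<in> borel_measurable M" if "u \<in> {r..T}" for u n
    using mart[of n] that unfolding martingale_on_def by (blast intro: borel_measurable_integrable)
  have prod: "\<bar>Z \<omega> * X (min u (\<tau> n \<omega>)) \<omega>\<bar> \<le> B' * B" if "u \<in> {r..T}" "\<omega> \<in> space M" for u n \<omega>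
    unfolding abs_mult using Zb[OF that(2)] stopped[OF that]
    by (intro mult_mono) (auto intro: order_trans[OF abs_ge_zero])
  have lim: "(\<lambda>n. \<integral>\<omega>. Z \<omega> * X (min u (\<tau> n \<omega>)) \<omega> \<partial>M) \<longlonglongrightarrow> (\<integral>\<omega>. Z \<omega> * X u \<omega> \<partial>M)" if u: "u \<in> {r..T}" for u
  proof (rule integral_dominated_convergence[where w="\<lambda>_. B' * B"])
    show "AE \<omega> in M. (\<lambda>n. Z \<omega> * X (min u (\<tau> n \<omega>)) \<omega>) \<longlonglongrightarrow> Z \<omega> * X u \<omega>"
      using reach AE_space
    proof eventually_elim
      case (elim \<omega>)
      then obtain N where N: "\<tau> N \<omega> = T" by blast
      \<comment> \<open>The times increase and never exceed T, so once T is reached they stay there,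
        and the stopped values eventually equal the unstopped ones.\<close>
      have "\<tau> k \<omega> = T" if "N \<le> k" for k
        using that
      proof (induction rule: dec_induct)
        case (step k)
        then show ?case using \<tau>[OF elim(2), of k] \<tau>[OF elim(2), of "Suc k"] by linarith
      qed (rule N)
      then have "\<forall>\<^sub>F n in sequentially. Z \<omega> * X (min u (\<tau> n \<omega>)) \<omega> = Z \<omega> * X u \<omega>"
        using u by (intro eventually_sequentiallyI[of N]) simp
      then show ?case by (rule tendsto_eventually)
    qed
    show "AE \<omega> in M. norm (Z \<omega> * X (min u (\<tau> n \<omega>)) \<omega>) \<le> B' * B" for n
      using prod[OF u] by (intro AE_I2) simp
  qed (use ZM XM[OF u] stM[OF u] in auto)
  have eq: "(\<integral>\<omega>. Z \<omega> * X (min t (\<tau> n \<omega>)) \<omega> \<partial>M) = (\<integral>\<omega>. Z \<omega> * X (min s (\<tau> n \<omega>)) \<omega> \<partial>M)" for n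
  proof -
    interpret finite_measure_subalgebra M "G s"
      using subalg[OF s] by unfold_locales
    have "integrable M (\<lambda>\<omega>. Z \<omega> * X (min t (\<tau> n \<omega>)) \<omega>)"
      using prod[OF t'] ZM stM[OF t'] by (intro integrable_const_bound[of _ "B' * B"]) auto
    from real_cond_exp_intg(2)[OF this Z stM[OF t']]
    have "(\<integral>\<omega>. Z \<omega> * X (min t (\<tau> n \<omega>)) \<omega> \<partial>M) = (\<integral>\<omega>. Z \<omega> * real_cond_exp M (G s) (\<lambda>\<omega>. X (min t (\<tau> n
      \<omega>)) \<omega>) \<omega> \<partial>M)"
      by simp
    also have "\<dots> = (\<integral>\<omega>. Z \<omega> * X (min s (\<tau> n \<omega>)) \<omega> \<partial>M)"
    proof (rule integral_cong_AE)
      have "AE \<omega> in M. real_cond_exp M (G s) (\<lambda>\<omega>. X (min t (\<tau> n \<omega>)) \<omega>) \<omega> = X (min s (\<tau> n \<omega>)) \<omega>"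
        using mart[of n] s t unfolding martingale_on_def by blast
      then show "AE \<omega> in M. Z \<omega> * real_cond_exp M (G s) (\<lambda>\<omega>. X (min t (\<tau> n \<omega>)) \<omega>) \<omega>
        = Z \<omega> * X (min s (\<tau> n \<omega>)) \<omega>"
        by auto
    qed (use ZM stM[OF s] in auto)
    finally show ?thesis .
  qed
  show ?thesis using LIMSEQ_unique lim[OF t'] lim[OF s] unfolding eq by blast
qed

section \<open>The moment estimate\<close>

text \<open>The coefficients are left behind here: of the generator only the estimate on radial
  functions is retained. \<open>L\<close> is fixed in the locale since it must not depend on the
  regularisation parameters.\<close>

locale bounded_generator = prob_space M for M :: "'w measure" +
  fixes r T :: real and K m :: nat
    and A :: "real \<Rightarrow> (real^'d \<Rightarrow> nat \<Rightarrow> real) \<Rightarrow> real^'d \<Rightarrow> nat \<Rightarrow> real"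
    and Y :: "real \<Rightarrow> 'w \<Rightarrow> real^'d" and C :: "real \<Rightarrow> 'w \<Rightarrow> nat" and L :: real
  assumes rT: "r < T" and L: "0 \<le> L"
    and LMP: "solves_local_martingale_problem M r T K A Y C"
    and A_bound: "\<And>W f f1 f2 t y c. moderate_weight m W \<Longrightarrow> scaled_C2 W f f1 f2 \<Longrightarrow>
       t \<in> {r..T} \<Longrightarrow> c \<in> {1..K} \<Longrightarrow> \<bar>A t (\<lambda>y c. radial f y) y c\<bar> \<le> L * radial W y"
begin

abbreviation G :: "real \<Rightarrow> 'w measure" where
  "G \<equiv> generated_filtration M r (\<lambda>t \<omega>. (Y t \<omega>, C t \<omega>))"

definition Yl :: "real \<Rightarrow> 'w \<Rightarrow> real^'d" where
  "Yl u \<omega> = Lim (at_left u) (\<lambda>s. Y s \<omega>)"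

definition Cl :: "real \<Rightarrow> 'w \<Rightarrow> nat" where
  "Cl u \<omega> = Lim (at_left u) (\<lambda>s. C s \<omega>)"

lemma YM [measurable]: "t \<in> {r..T} \<Longrightarrow> Y t \<in> borel_measurable M"
  and CM: "t \<in> {r..T} \<Longrightarrow> C t \<in> borel_measurable M"
  and C_range: "\<omega> \<in> space M \<Longrightarrow> t \<in> {r..T} \<Longrightarrow> C t \<omega> \<in> {1..K}"
  and cadlag: "\<omega> \<in> space M \<Longrightarrow> cadlag_on r T (\<lambda>t. (Y t \<omega>, C t \<omega>))"
  and lmg: "v \<in> C2c K \<Longrightarrow> local_martingale_on M G r T (mg_process r A Y C v)"
  using LMP unfolding solves_local_martingale_problem_def by blast+

lemma Y_right: "\<omega> \<in> space M \<Longrightarrow> t \<in> {r..<T} \<Longrightarrow> ((\<lambda>s. Y s \<omega>) \<longlongrightarrow> Y t \<omega>) (at_right t)"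
  using tendsto_fst[of "\<lambda>s. (Y s \<omega>, C s \<omega>)"] cadlag[of \<omega>] unfolding cadlag_on_def by fastforce

text \<open>Regimes are discrete, so the path of \<open>C\<close> is eventually constant to the left
  of u and its limit is a value taken. At u = r the left limit lies outside the time interval, hence
  the half-open intervals here and below.\<close>

lemma left_limits:
  assumes \<omega>: "\<omega> \<in> space M" and u: "u \<in> {r<..T}"
  shows "((\<lambda>s. Y s \<omega>) \<longlongrightarrow> Yl u \<omega>) (at_left u)" "Cl u \<omega> \<in> {1..K}"
proof -
  obtain l where l: "((\<lambda>t. (Y t \<omega>, C t \<omega>)) \<longlongrightarrow> l) (at_left u)"
    using cadlag[OF \<omega>] u unfolding cadlag_on_def by blast
  have Y: "((\<lambda>s. Y s \<omega>) \<longlongrightarrow> fst l) (at_left u)" and C: "((\<lambda>s. C s \<omega>) \<longlongrightarrow> snd l) (at_left u)"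
    using tendsto_fst[OF l] tendsto_snd[OF l] by simp_all
  show "((\<lambda>s. Y s \<omega>) \<longlongrightarrow> Yl u \<omega>) (at_left u)"
    unfolding Yl_def using tendsto_Lim[OF _ Y] Y by simp
  have "\<forall>\<^sub>F s in at_left u. C s \<omega> = snd l"
    using topological_tendstoD[OF C Topological_Spaces.open_discrete[of "{snd l}"]] by simp
  moreover have "\<forall>\<^sub>F s in at_left u. C s \<omega> \<in> {1..K}"
    using u C_range[OF \<omega>] by (intro eventually_at_leftI[of r]) auto
  ultimately have "\<forall>\<^sub>F s in at_left u. snd l \<in> {1..K}" by eventually_elim simp
  then have "snd l \<in> {1..K}" by (simp add: eventually_const)
  moreover have "Cl u \<omega> = snd l" unfolding Cl_def by (rule tendsto_Lim[OF _ C]) simp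
  ultimately show "Cl u \<omega> \<in> {1..K}" by simp
qed

lemma sets_G:
  "sets (G s) = sigma_sets (space M) (\<Union>u\<in>{r..s}. {(\<lambda>\<omega>. (Y u \<omega>, C u \<omega>)) -` B \<inter> space M |B. B
    \<in> sets borel})"
  unfolding generated_filtration_def by (rule sets_measure_of) auto

lemma space_G: "space (G s) = space M"
  unfolding generated_filtration_def by (rule space_measure_of) auto

lemma G_subalgebra:
  assumes s: "s \<in> {r..T}"
  shows "subalgebra M (G s)"
proof -
  have "(\<lambda>\<omega>. (Y u \<omega>, C u \<omega>)) \<in> borel_measurable M" if "u \<in> {r..s}" for u
    using that s YM[of u] CM[of u] by (intro borel_measurable_Pair) auto
  then have "(\<Union>u\<in>{r..s}. {(\<lambda>\<omega>. (Y u \<omega>, C u \<omega>)) -` B \<inter> space M |B. B \<in> sets borel}) \<subseteq> sets M"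
    by (auto dest: measurable_sets)
  then show ?thesis
    unfolding subalgebra_def space_G sets_G by (auto dest!: sets.sigma_sets_subset)
qed

lemma G_mono:
  assumes "s \<le> t"
  shows "subalgebra (G t) (G s)"
proof -
  have "{r..s} \<subseteq> {r..t}" using assms by auto
  then show ?thesis
    unfolding subalgebra_def space_G sets_G by (intro conjI refl sigma_sets_mono' UN_mono) auto
qed

lemma radial_continuous:
  assumes "scaled_C2 W f f1 f2"
  shows "continuous_on UNIV (radial f :: real^'d \<Rightarrow> real)"
proof (intro continuous_at_imp_continuous_on ballI)
  fix y :: "real^'d"
  show "isCont (radial f) y"
    by (rule has_derivative_continuous[OF radial_has_derivative[OF scaled_C2_DERIV(1)[OF assms]]])
qed

text \<open>The left-limit process is a pointwise limit of processes that sample \<open>Y\<close> at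
  countably many times; joint measurability prepares for Fubini's theorem.\<close>

lemma left_limit_measurable:
  fixes h :: "real^'d \<Rightarrow> real"
  assumes h: "continuous_on UNIV h"
  shows "(\<lambda>(u, \<omega>). h (Yl u \<omega>) * indicator {r<..T} u) \<in> borel_measurable (lborel \<Otimes>\<^sub>M M)"
proof -
  \<comment> \<open>Ceiling minus one, rather than floor, keeps the sampling time strictly below u
    even when u lies on the grid. The clamping to [r, T] makes it legitimate for every real
    u.\<close>
  define g where "g n u = max r (min T (r + (of_int \<lceil>real (Suc n) * (u - r)\<rceil> - 1) / real (Suc n)))"
    for n and u :: real
  have g: "g n u \<in> {r..T}" for n u using rT by (auto simp: g_def)
  have hm: "h \<in> borel_measurable borel" using h by (rule borel_measurable_continuous_onI)
  have "(\<lambda>x::real \<times> 'w. h (Yl (fst x) (snd x)) * indicator {r<..T} (fst x))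
    \<in> borel_measurable (lborel \<Otimes>\<^sub>M M)"
  proof (rule borel_measurable_LIMSEQ_real)
    fix n
    have "(\<lambda>x::real \<times> 'w. Y (max r (min T (r + (of_int i - 1) / real (Suc n)))) (snd x))
      \<in> borel_measurable (lborel \<Otimes>\<^sub>M M)" for i :: int
      using g[of n] rT by (intro measurable_compose[OF measurable_snd] YM) auto
    then have "(\<lambda>x::real \<times> 'w. Y (max r (min T (r
      + (of_int \<lceil>real (Suc n) * (fst x - r)\<rceil> - 1) / real (Suc n)))) (snd x))
        \<in> borel_measurable (lborel \<Otimes>\<^sub>M M)"
      by (rule measurable_compose_countable) measurable
    then have "(\<lambda>x::real \<times> 'w. Y (g n (fst x)) (snd x)) \<in> borel_measurable (lborel \<Otimes>\<^sub>M M)"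
      by (simp add: g_def)
    then have [measurable]: "(\<lambda>x::real \<times> 'w. h (Y (g n (fst x)) (snd x)))
      \<in> borel_measurable (lborel \<Otimes>\<^sub>M M)"
      by (rule measurable_compose[OF _ hm])
    show "(\<lambda>x::real \<times> 'w. h (Y (g n (fst x)) (snd x)) * indicator {r<..T} (fst x))
      \<in> borel_measurable (lborel \<Otimes>\<^sub>M M)"
      by measurable
  next
    fix x :: "real \<times> 'w" assume x: "x \<in> space (lborel \<Otimes>\<^sub>M M)"
    obtain u \<omega> where x_eq: "x = (u, \<omega>)" by (cases x)
    have \<omega>: "\<omega> \<in> space M" using x by (simp add: x_eq space_pair_measure)
    show "(\<lambda>n. h (Y (g n (fst x)) (snd x)) * indicator {r<..T} (fst x))
      \<longlonglongrightarrow> h (Yl (fst x) (snd x)) * indicator {r<..T} (fst x)"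
    proof (cases "u \<in> {r<..T}")
      case True
      have lt: "g n u < u" and ge: "u - 1 / real (Suc n) \<le> g n u" for n
      proof -
        define k where "k = real (Suc n)"
        define c where "c = real_of_int \<lceil>k * (u - r)\<rceil>"
        have k: "0 < k" by (simp add: k_def)
        have c: "k * (u - r) \<le> c" "c < k * (u - r) + 1"
          unfolding c_def by linarith+
        have "(c - 1) / k < u - r" using c k by (simp add: divide_less_eq mult.commute)
        moreover have "(k * (u - r) - 1) / k \<le> (c - 1) / k" using c k
          by (intro divide_right_mono) auto
        then have "u - r - 1 / k \<le> (c - 1) / k" using k by (simp add: diff_divide_distrib)
        moreover have "0 < 1 / k" using k by simp
        ultimately show "g n u < u" "u - 1 / real (Suc n) \<le> g n u"
          using True unfolding g_def k_def[symmetric] c_def[symmetric]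
            by (auto simp: max_def min_def)
      qed
      have "(\<lambda>n. g n u) \<longlonglongrightarrow> u"
      proof (rule tendsto_sandwich[of "\<lambda>n. u - 1 / real (Suc n)" _ _ "\<lambda>_. u"])
        show "(\<lambda>n. u - 1 / real (Suc n)) \<longlonglongrightarrow> u"
          using tendsto_diff[OF tendsto_const LIMSEQ_inverse_real_of_nat, of u]
            by (simp add: inverse_eq_divide)
      qed (use lt ge in \<open>auto intro!: always_eventually less_imp_le\<close>)
      then have "filterlim (\<lambda>n. g n u) (at_left u) sequentially"
        using lt by (intro filterlim_at_withinI) auto
      then have "(\<lambda>n. Y (g n u) \<omega>) \<longlonglongrightarrow> Yl u \<omega>"
        by (rule filterlim_compose[OF left_limits(1)[OF \<omega> True]])
      moreover have "isCont h (Yl u \<omega>)" using h by (simp add: continuous_on_eq_continuous_at)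
      ultimately have "(\<lambda>n. h (Y (g n u) \<omega>)) \<longlonglongrightarrow> h (Yl u \<omega>)" by (rule isCont_tendsto_compose[rotated])
      then show ?thesis using True by (simp add: x_eq)
    qed (simp add: x_eq)
  qed
  then show ?thesis by (simp add: case_prod_beta)
qed

end

text \<open>Up to x = R moderate growth bounds \<open>W\<close> by R^m times its value at 1, and
  beyond that point f and its derivatives vanish. With a constant weight the drift is bounded too,
  which makes the local martingale of a cut-off function bounded.\<close>

lemma scaled_C2_bounded_if_support:
  assumes s: "scaled_C2 W f f1 f2" and mw: "moderate_weight m W"
    and supp: "\<And>x. R \<le> x \<Longrightarrow> f x = 0" and R: "1 \<le> R"
  shows "scaled_C2 (\<lambda>_. R ^ m * W 1) f f1 f2"
proof -
  have df: "(f has_real_derivative f1 v) (at v)" "(f1 has_real_derivative f2 v) (at v)" if "0 < v"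
    for v
    using s that unfolding scaled_C2_def by blast+
  \<comment> \<open>Only x > R is treated, where the function vanishes in a neighbourhood; the end
    point x = R falls under the case \<open>x \<le> R\<close> below.\<close>
  have zero: "g' x = 0" if "(g has_real_derivative g' x) (at x)" "\<And>x. R < x \<Longrightarrow> g x = 0" "R < x"
    for g g' :: "real \<Rightarrow> real" and x
  proof (rule DERIV_unique)
    show "((\<lambda>_. 0) has_real_derivative g' x) (at x)"
      by (rule has_field_derivative_transform_within_open[OF that(1), of "{R<..}"])
        (use that in auto)
  qed simp
  have f1: "f1 x = 0" if "R < x" for x
    by (rule zero[of f f1 x]) (use df(1)[of x] supp that R in auto)
  have f2: "f2 x = 0" if "R < x" for x
    by (rule zero[of f1 f2 x]) (use df(2)[of x] f1 that R in auto)
  have W1: "0 \<le> R ^ m * W 1" using scaled_C2_nonneg[OF s, of 1] R by simp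
  have W: "W x \<le> R ^ m * W 1" if "1 \<le> x" "x \<le> R" for x
    using moderate_weightD[OF mw, of 1 x R] that R by simp
  have "\<bar>f x\<bar> \<le> R ^ m * W 1 \<and> \<bar>f1 x\<bar> \<le> R ^ m * W 1 / x \<and> \<bar>f2 x\<bar> \<le> R ^ m * W 1 / x\<^sup>2" if x: "1 \<le> x"
    for x
  proof (cases "x \<le> R")
    case True
    have "W x / x \<le> R ^ m * W 1 / x" "W x / x\<^sup>2 \<le> R ^ m * W 1 / x\<^sup>2"
      using W[OF x True] x by (auto intro!: divide_right_mono)
    then show ?thesis using s x W[OF x True] unfolding scaled_C2_def by (meson order_trans)
  next
    case False
    then show ?thesis using f1[of x] f2[of x] supp[of x] W1 x by simp
  qed
  with s show ?thesis unfolding scaled_C2_def by blast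
qed

lemma moderate_weight_const: "0 \<le> b \<Longrightarrow> moderate_weight m (\<lambda>_. b)"
  unfolding moderate_weight_def using mult_right_mono[OF one_le_power] by fastforce

context bounded_generator
begin

section \<open>The compensated process of a radial function\<close>

definition drift :: "(real \<Rightarrow> real) \<Rightarrow> real \<Rightarrow> 'w \<Rightarrow> real" where
  "drift f t \<omega> = (LINT u:{r..t}|lborel. A u (\<lambda>y c. radial f y) (Yl u \<omega>) (Cl u \<omega>))"

definition mg :: "(real \<Rightarrow> real) \<Rightarrow> real \<Rightarrow> 'w \<Rightarrow> real" where
  "mg f t \<omega> = radial f (Y t \<omega>) - drift f t \<omega>"

lemma mg_process_radial: "mg_process r A Y C (\<lambda>y c. radial f y) = mg f"
  by (intro ext) (simp add: mg_process_def mg_def drift_def Yl_def Cl_def)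

text \<open>No measurability of the generator is needed: the integral of a function that is not
  integrable is \<open>0\<close>.\<close>

lemma abs_drift_le:
  assumes s: "scaled_C2 W f f1 f2" and mw: "moderate_weight m W"
    and \<omega>: "\<omega> \<in> space M" and t: "t \<in> {r..T}"
  shows "ennreal \<bar>drift f t \<omega>\<bar> \<le> (\<integral>\<^sup>+u\<in>{r<..t}. ennreal (L * radial W (Yl u \<omega>)) \<partial>lborel)"
proof -
  define k where "k u = indicator {r..t} u *\<^sub>R A u (\<lambda>y c. radial f y) (Yl u \<omega>) (Cl u \<omega>)" for u
  have drift: "drift f t \<omega> = (\<integral>u. k u \<partial>lborel)"
    by (simp add: drift_def k_def set_lebesgue_integral_def)
  show ?thesis
  proof (cases "integrable lborel k")
    case True
    then have "ennreal \<bar>drift f t \<omega>\<bar> \<le> (\<integral>\<^sup>+u. ennreal \<bar>k u\<bar> \<partial>lborel)"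
      unfolding drift using integral_norm_bound_ennreal[of lborel k] by simp
    also have "\<dots> \<le> (\<integral>\<^sup>+u\<in>{r<..t}. ennreal (L * radial W (Yl u \<omega>)) \<partial>lborel)"
    proof (rule nn_integral_mono_AE)
      show "AE u in lborel. ennreal \<bar>k u\<bar> \<le> ennreal (L * radial W (Yl u \<omega>)) * indicator {r<..t} u"
        \<comment> \<open>The left limit at r is not under control, so the estimate of the generator
          is available only for u > r; a single point is a null set.\<close>
        using AE_lborel_singleton[of r]
      proof eventually_elim
        case (elim u)
        show ?case
        proof (cases "u \<in> {r<..t}")
          case True
          then have "\<bar>A u (\<lambda>y c. radial f y) (Yl u \<omega>) (Cl u \<omega>)\<bar> \<le> L * radial W (Yl u \<omega>)"
            using t left_limits(2)[OF \<omega>] by (intro A_bound[OF mw s]) auto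
          then show ?thesis using True by (simp add: k_def ennreal_leI)
        qed (use elim in \<open>auto simp: k_def indicator_def\<close>)
      qed
    qed
    finally show ?thesis .
  qed (simp add: drift not_integrable_integral_eq)
qed

context
  fixes W f f1 f2 :: "real \<Rightarrow> real" and R :: real
  assumes s: "scaled_C2 W f f1 f2" and mw: "moderate_weight m W"
    and supp: "\<And>x. R \<le> x \<Longrightarrow> f x = 0" and R: "1 \<le> R"
begin

lemma radial_measurable [measurable]: "radial f \<in> borel_measurable (borel :: (real^'d) measure)"
  by (rule borel_measurable_continuous_onI[OF radial_continuous[OF s]])

lemma bounded_mg: "\<exists>B. \<forall>t\<in>{r..T}. \<forall>\<omega>\<in>space M. \<bar>radial f (Y t \<omega>)\<bar> \<le> B \<and> \<bar>drift f t \<omega>\<bar> \<le> B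
  \<and> \<bar>mg f t \<omega>\<bar> \<le> 2 * B"
proof -
  define b where "b = R ^ m * W 1"
  have b: "0 \<le> b" using scaled_C2_nonneg[OF s, of 1] R by (simp add: b_def)
  have sb: "scaled_C2 (\<lambda>_. b) f f1 f2"
    unfolding b_def by (rule scaled_C2_bounded_if_support[OF s mw supp R])
  define B where "B = max b (L * b * (T - r))"
  have "\<bar>radial f (Y t \<omega>)\<bar> \<le> B \<and> \<bar>drift f t \<omega>\<bar> \<le> B \<and> \<bar>mg f t \<omega>\<bar> \<le> 2 * B"
    if t: "t \<in> {r..T}" and \<omega>: "\<omega> \<in> space M" for t \<omega>
  proof -
    have "ennreal \<bar>drift f t \<omega>\<bar> \<le> (\<integral>\<^sup>+u\<in>{r<..t}. ennreal (L * b) \<partial>lborel)"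
      by (rule abs_drift_le[OF sb moderate_weight_const[OF b] \<omega> t])
    also have "\<dots> = ennreal (L * b) * ennreal (t - r)"
      using t by (simp add: nn_integral_cmult_indicator)
    also have "\<dots> = ennreal (L * b * (t - r))"
      using L b t by (simp add: ennreal_mult)
    also have "\<dots> \<le> ennreal (L * b * (T - r))" using L b t by (intro ennreal_leI mult_left_mono) auto
    finally have 1: "\<bar>drift f t \<omega>\<bar> \<le> B" using L b rT by (simp add: B_def le_max_iff_disj)
    have "\<bar>radial f (Y t \<omega>)\<bar> \<le> b"
      using sb one_plus_norm_sq_ge_1 unfolding scaled_C2_def by blast
    then have 2: "\<bar>radial f (Y t \<omega>)\<bar> \<le> B" by (simp add: B_def)
    show ?thesis using 1 2 unfolding mg_def by linarith
  qed
  then show ?thesis by blast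
qed

lemma mg_adapted: "t \<in> {r..T} \<Longrightarrow> mg f t \<in> borel_measurable (G t)"
  using lmg[OF radial_C2c[OF s supp]] unfolding mg_process_radial local_martingale_on_def by blast

lemma mg_measurable: "t \<in> {r..T} \<Longrightarrow> mg f t \<in> borel_measurable M"
  by (rule measurable_from_subalg[OF G_subalgebra mg_adapted])

lemma mg_martingale:
  assumes "t \<in> {r..T}" "t' \<in> {t..T}" "Z \<in> borel_measurable (G t)" "\<And>\<omega>. \<omega> \<in> space M \<Longrightarrow> \<bar>Z \<omega>\<bar> \<le> B"
  shows "(\<integral>\<omega>. Z \<omega> * mg f t' \<omega> \<partial>M) = (\<integral>\<omega>. Z \<omega> * mg f t \<omega> \<partial>M)"
proof -
  obtain B' where "\<forall>t\<in>{r..T}. \<forall>\<omega>\<in>space M. \<bar>radial f (Y t \<omega>)\<bar> \<le> B' \<and> \<bar>drift f t \<omega>\<bar> \<le> B' \<and> \<bar>mg f t \<omega>\<bar>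
    \<le> 2 * B'"
    using bounded_mg by blast
  then have B': "\<And>t \<omega>. t \<in> {r..T} \<Longrightarrow> \<omega> \<in> space M \<Longrightarrow> \<bar>mg f t \<omega>\<bar> \<le> 2 * B'" by blast
  show ?thesis
    by (rule bounded_local_martingale[OF lmg[OF radial_C2c[OF s supp], unfolded mg_process_radial]
          G_subalgebra B' assms])
qed

text \<open>Dynkin's formula with the drift replaced by its bound: the compensated process has
  constant expectation, and at time r its drift vanishes.\<close>

lemma expectation_radial_le:
  assumes t: "t \<in> {r..T}" and f: "\<And>x. 1 \<le> x \<Longrightarrow> 0 \<le> f x"
  shows "(\<integral>\<^sup>+\<omega>. ennreal (radial f (Y t \<omega>)) \<partial>M) \<le> (\<integral>\<^sup>+\<omega>. ennreal (radial f (Y r \<omega>)) \<partial>M)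
     + (\<integral>\<^sup>+\<omega>. (\<integral>\<^sup>+u\<in>{r<..t}. ennreal (L * radial W (Yl u \<omega>)) \<partial>lborel) \<partial>M)"
proof -
  obtain B where B: "\<And>t \<omega>. t \<in> {r..T} \<Longrightarrow> \<omega> \<in> space M \<Longrightarrow>
      \<bar>radial f (Y t \<omega>)\<bar> \<le> B \<and> \<bar>drift f t \<omega>\<bar> \<le> B \<and> \<bar>mg f t \<omega>\<bar> \<le> 2 * B"
    using bounded_mg by blast
  have r: "r \<in> {r..T}" using rT by simp
  have fnn: "0 \<le> radial f (Y t \<omega>)" for t \<omega> using f by simp
  have fY: "(\<lambda>\<omega>. radial f (Y t \<omega>)) \<in> borel_measurable M" if "t \<in> {r..T}" for t
    using measurable_compose[OF YM[OF that] radial_measurable] by simp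
  have int_f: "integrable M (\<lambda>\<omega>. radial f (Y t \<omega>))" if "t \<in> {r..T}" for t
    by (rule integrable_const_bound[of _ B]) (use B[OF that] fY[OF that] in auto)
  have int_mg: "integrable M (mg f t)" if "t \<in> {r..T}" for t
    by (rule integrable_const_bound[of _ "2 * B"]) (use B[OF that] mg_measurable[OF that] in auto)
  \<comment> \<open>Measurability of the drift in \<open>\<omega>\<close> is read off from this
    difference of two measurable processes.\<close>
  have drift: "drift f t = (\<lambda>\<omega>. radial f (Y t \<omega>) - mg f t \<omega>)" for t
    by (simp add: mg_def)
  have int_d: "integrable M (drift f t)" unfolding drift using int_f[OF t] int_mg[OF t] by simp
  have "drift f r \<omega> = 0" if "\<omega> \<in> space M" for \<omega>
    using abs_drift_le[OF s mw that r] by simp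
  then have mg_r: "(\<integral>\<omega>. mg f r \<omega> \<partial>M) = (\<integral>\<omega>. radial f (Y r \<omega>) \<partial>M)"
    by (intro Bochner_Integration.integral_cong) (auto simp: mg_def)
  have "(\<integral>\<omega>. mg f t \<omega> \<partial>M) = (\<integral>\<omega>. mg f r \<omega> \<partial>M)"
    using mg_martingale[OF r t, of "\<lambda>_. 1" 1] by simp
  moreover have "(\<integral>\<omega>. radial f (Y t \<omega>) \<partial>M) = (\<integral>\<omega>. mg f t \<omega> \<partial>M) + (\<integral>\<omega>. drift f t \<omega> \<partial>M)"
    using int_mg[OF t] int_d by (simp flip: Bochner_Integration.integral_add) (simp add: mg_def)
  moreover have "(\<integral>\<omega>. drift f t \<omega> \<partial>M) \<le> (\<integral>\<omega>. \<bar>drift f t \<omega>\<bar> \<partial>M)"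
    using int_d by (intro integral_mono) auto
  ultimately have le: "(\<integral>\<omega>. radial f (Y t \<omega>) \<partial>M) \<le> (\<integral>\<omega>. radial f (Y r \<omega>) \<partial>M)
    + (\<integral>\<omega>. \<bar>drift f t \<omega>\<bar> \<partial>M)"
    using mg_r by simp
  have "(\<integral>\<^sup>+\<omega>. ennreal (radial f (Y t \<omega>)) \<partial>M) = ennreal (\<integral>\<omega>. radial f (Y t \<omega>) \<partial>M)"
    using int_f[OF t] fnn by (intro nn_integral_eq_integral) auto
  also have "\<dots> \<le> ennreal (\<integral>\<omega>. radial f (Y r \<omega>) \<partial>M) + ennreal (\<integral>\<omega>. \<bar>drift f t \<omega>\<bar> \<partial>M)"
    using ennreal_leI[OF le] fnn by (simp add: ennreal_plus integral_nonneg)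
  also have "ennreal (\<integral>\<omega>. radial f (Y r \<omega>) \<partial>M) = (\<integral>\<^sup>+\<omega>. ennreal (radial f (Y r \<omega>)) \<partial>M)"
    using int_f[OF r] fnn by (intro nn_integral_eq_integral[symmetric]) auto
  also have "ennreal (\<integral>\<omega>. \<bar>drift f t \<omega>\<bar> \<partial>M) = (\<integral>\<^sup>+\<omega>. ennreal \<bar>drift f t \<omega>\<bar> \<partial>M)"
    using int_d by (intro nn_integral_eq_integral[symmetric]) auto
  also have "\<dots> \<le> (\<integral>\<^sup>+\<omega>. (\<integral>\<^sup>+u\<in>{r<..t}. ennreal (L * radial W (Yl u \<omega>)) \<partial>lborel) \<partial>M)"
    by (intro nn_integral_mono abs_drift_le[OF s mw _ t])
  finally show ?thesis by (simp add: add_left_mono)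
qed

end

end

section \<open>Removing the cutoff and the regularisation\<close>

lemma weight_le_inverse:
  assumes "0 < e" "0 \<le> p" "0 < x"
  shows "weight e p x \<le> (1 / e) powr p"
proof -
  have "x / (1 + e * x) \<le> 1 / e"
    using assms by (simp add: pos_divide_le_eq pos_le_divide_eq add_pos_pos mult.commute)
  then show ?thesis unfolding weight_def using assms by (intro powr_mono2) auto
qed

lemma weight_0_nat: "0 < x \<Longrightarrow> weight 0 (real m) x = x ^ m"
  by (simp add: weight_def powr_realpow)

text \<open>The link between the two levels of the proof: squaring in Doob's inequality turns the
  weight of degree m/2 into the one whose expectation is already bounded.\<close>

lemma weight_0_half_sq: "0 < x \<Longrightarrow> (weight 0 (real m / 2) x)\<^sup>2 = weight 0 (real m) x"
  by (simp add: weight_def power2_eq_square flip: powr_add)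

lemma weight_le_weight_0: "0 \<le> e \<Longrightarrow> 0 \<le> p \<Longrightarrow> 0 < x \<Longrightarrow> weight e p x \<le> weight 0 p x"
  unfolding weight_def by (intro powr_mono2) (auto simp: divide_le_eq)

lemma tendsto_weight_0:
  assumes "0 < x"
  shows "(\<lambda>n. weight (1 / real (Suc n)) p x) \<longlonglongrightarrow> weight 0 p x"
  unfolding weight_def
proof (rule tendsto_powr)
  have "(\<lambda>n. x / (1 + 1 / real (Suc n) * x)) \<longlonglongrightarrow> x / (1 + 0 * x)"
    using LIMSEQ_inverse_real_of_nat by (intro tendsto_intros) (auto simp: inverse_eq_divide)
  then show "(\<lambda>n. x / (1 + 1 / real (Suc n) * x)) \<longlonglongrightarrow> x / (1 + 0 * x)" .
qed (use assms in auto)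

text \<open>The argument may move with n, because in the final passage to the limit the cutoff level
  and the grid point change together.\<close>

lemma tendsto_cutoff_1:
  assumes "x \<longlonglongrightarrow> a"
  shows "(\<lambda>n. cutoff (real (Suc n)) (x n)) \<longlonglongrightarrow> 1"
proof -
  have "(\<lambda>n. x n * inverse (real (Suc n))) \<longlonglongrightarrow> a * 0"
    by (intro tendsto_mult assms LIMSEQ_inverse_real_of_nat)
  then have "(\<lambda>n. (max 0 (1 - x n / real (Suc n))) ^ 3) \<longlonglongrightarrow> (max 0 (1 - a * 0)) ^ 3"
    unfolding divide_inverse by (intro tendsto_power tendsto_max tendsto_diff tendsto_const)
  then show ?thesis by (simp add: cutoff_def)
qed

lemma cutoff_eq_0: "0 < R \<Longrightarrow> R \<le> x \<Longrightarrow> cutoff R x = 0"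
  by (simp add: cutoff_def max_def divide_le_eq)

definition weight_const :: "real \<Rightarrow> real" where
  "weight_const p = 24 * (p * (p + 3) + 1)"

lemma weight_const_nonneg: "0 \<le> p \<Longrightarrow> 0 \<le> weight_const p"
  by (simp add: weight_const_def)

lemma continuous_on_radial_weight:
  assumes "0 \<le> e" "0 \<le> p"
  shows "continuous_on UNIV (radial (weight e p) :: 'a::real_inner \<Rightarrow> real)"
proof -
  obtain f1 f2 where "scaled_C2 (\<lambda>x. (p * (p + 3) + 1) * weight e p x) (weight e p) f1 f2"
    using scaled_C2_weight[OF assms] by blast
  then show ?thesis
    by (intro continuous_at_imp_continuous_on ballI has_derivative_continuous[OF
      radial_has_derivative[OF scaled_C2_DERIV(1)]])
qed

context bounded_generator
begin

lemma radial_weight_measurable: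
  assumes "0 \<le> e" "0 \<le> p"
  shows "(radial (weight e p) :: real^'d \<Rightarrow> real) \<in> borel_measurable borel"
  by (rule borel_measurable_continuous_onI[OF continuous_on_radial_weight[OF assms]])

lemma radial_weight_Y_measurable:
  assumes "0 \<le> e" "0 \<le> p" "t \<in> {r..T}"
  shows "(\<lambda>\<omega>. radial (weight e p) (Y t \<omega>)) \<in> borel_measurable M"
  using measurable_compose[OF YM[OF assms(3)] radial_weight_measurable[OF assms(1,2)]] by simp

lemma left_limit_measurable_ennreal:
  fixes h :: "real^'d \<Rightarrow> real"
  assumes h: "continuous_on UNIV h" and t: "t \<in> {r..T}"
  shows "(\<lambda>(u, \<omega>). ennreal (h (Yl u \<omega>)) * indicator {r<..t} u) \<in> borel_measurable (lborel \<Otimes>\<^sub>M M)"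
proof -
  have [measurable]: "(\<lambda>x. h (Yl (fst x) (snd x)) * indicator {r<..T} (fst x))
    \<in> borel_measurable (lborel \<Otimes>\<^sub>M M)"
    using left_limit_measurable[OF h] by (simp add: case_prod_beta)
  have "(\<lambda>x. ennreal (h (Yl (fst x) (snd x)) * indicator {r<..T} (fst x)) * indicator {r<..t} (fst
    x)) \<in> borel_measurable (lborel \<Otimes>\<^sub>M M)"
    by measurable
  also have "(\<lambda>x. ennreal (h (Yl (fst x) (snd x)) * indicator {r<..T} (fst x)) * indicator {r<..t}
    (fst x))
     = (\<lambda>(u, \<omega>). ennreal (h (Yl u \<omega>)) * indicator {r<..t} u)"
    using t by (auto simp: fun_eq_iff indicator_def)
  finally show ?thesis .
qed

lemma left_limit_Fubini:
  fixes h :: "real^'d \<Rightarrow> real"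
  assumes h: "continuous_on UNIV h" and t: "t \<in> {r..T}"
  shows "(\<integral>\<^sup>+\<omega>. (\<integral>\<^sup>+u\<in>{r<..t}. ennreal (h (Yl u \<omega>)) \<partial>lborel) \<partial>M) =
    (\<integral>\<^sup>+u\<in>{r<..t}. (\<integral>\<^sup>+\<omega>. ennreal (h (Yl u \<omega>)) \<partial>M) \<partial>lborel)"
    and "(\<lambda>\<omega>. \<integral>\<^sup>+u\<in>{r<..t}. ennreal (h (Yl u \<omega>)) \<partial>lborel) \<in> borel_measurable M"
    and "u \<in> {r<..T} \<Longrightarrow> (\<lambda>\<omega>. ennreal (h (Yl u \<omega>))) \<in> borel_measurable M"
proof -
  interpret pair_sigma_finite lborel M by unfold_locales
  note m = left_limit_measurable_ennreal[OF h t]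
  have m3: "(\<lambda>\<omega>. ennreal (h (Yl u \<omega>))) \<in> borel_measurable M" if "u \<in> {r<..T}" for u
    using measurable_compose[OF measurable_Pair1'[of u lborel M] left_limit_measurable_ennreal[OF h,
      of T]] that rT
    by simp
  then show "u \<in> {r<..T} \<Longrightarrow> (\<lambda>\<omega>. ennreal (h (Yl u \<omega>))) \<in> borel_measurable M" .
  have "(\<integral>\<^sup>+\<omega>. (\<integral>\<^sup>+u\<in>{r<..t}. ennreal (h (Yl u \<omega>)) \<partial>lborel) \<partial>M) =
     (\<integral>\<^sup>+u. (\<integral>\<^sup>+\<omega>. ennreal (h (Yl u \<omega>)) * indicator {r<..t} u \<partial>M) \<partial>lborel)"
    using Fubini[OF m] by simp
  also have "\<dots> = (\<integral>\<^sup>+u\<in>{r<..t}. (\<integral>\<^sup>+\<omega>. ennreal (h (Yl u \<omega>)) \<partial>M) \<partial>lborel)"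
    by (intro nn_integral_cong) (simp add: indicator_def)
  finally show "(\<integral>\<^sup>+\<omega>. (\<integral>\<^sup>+u\<in>{r<..t}. ennreal (h (Yl u \<omega>)) \<partial>lborel) \<partial>M) =
    (\<integral>\<^sup>+u\<in>{r<..t}. (\<integral>\<^sup>+\<omega>. ennreal (h (Yl u \<omega>)) \<partial>M) \<partial>lborel)" .
  have "(\<lambda>(\<omega>, u). ennreal (h (Yl u \<omega>)) * indicator {r<..t} u) \<in> borel_measurable (M \<Otimes>\<^sub>M lborel)"
    using measurable_pair_swap[OF m] by simp
  then show "(\<lambda>\<omega>. \<integral>\<^sup>+u\<in>{r<..t}. ennreal (h (Yl u \<omega>)) \<partial>lborel) \<in> borel_measurable M"
    by (rule lborel.borel_measurable_nn_integral)
qed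

text \<open>The generator is evaluated at left limits, so the integral inequality closes for the
  moments of \<open>Yl\<close> and not directly for those of \<open>Y\<close>.\<close>

definition left_moment :: "real \<Rightarrow> real \<Rightarrow> real \<Rightarrow> ennreal" where
  "left_moment e p u = (\<integral>\<^sup>+\<omega>. ennreal (radial (weight e p) (Yl u \<omega>)) \<partial>M)"

text \<open>Fatou's lemma as the cutoff tends to 1; the bound is the same for all n because
  \<open>W\<close> is not cut off. Positive e serves Gronwall's inequality, while e = 0 yields the
  moment at time T once the left moments are known to be finite.\<close>

lemma moment_le:
  assumes e: "0 \<le> e" and p: "0 \<le> p" "p \<le> real m" and t: "t \<in> {r..T}"
  shows "(\<integral>\<^sup>+\<omega>. ennreal (radial (weight e p) (Y t \<omega>)) \<partial>M) \<le>
    (\<integral>\<^sup>+\<omega>. ennreal (radial (weight e p) (Y r \<omega>)) \<partial>M) +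
    ennreal (L * weight_const p) * (\<integral>\<^sup>+u\<in>{r<..t}. left_moment e p u \<partial>lborel)" (is "_ \<le> ?R")
proof -
  define f where "f n x = weight e p x * cutoff (real (Suc n)) x" for n x
  define W where "W x = weight_const p * weight e p x" for x
  have r: "r \<in> {r..T}" using rT by simp
  have f_le: "0 \<le> f n x \<and> f n x \<le> weight e p x" if "1 \<le> x" for n x
    using cutoff_bounds[of "real (Suc n)" x] that
    by (auto simp: f_def intro!: mult_nonneg_nonneg mult_left_le)
  have "(\<integral>\<^sup>+\<omega>. ennreal (radial (f n) (Y t \<omega>)) \<partial>M) \<le> ?R" for n
  proof -
    obtain f1 f2 where s: "scaled_C2 W (f n) f1 f2"
      using scaled_C2_weight_cutoff[OF e p(1), of "real (Suc n)"]
        unfolding W_def weight_const_def f_def[abs_def] by auto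
    have mw: "moderate_weight m W"
      unfolding W_def[abs_def] by (rule moderate_weight_weight[OF e p weight_const_nonneg[OF p(1)]])
    have supp: "f n x = 0" if "real (Suc n) \<le> x" for x
      using that by (simp add: f_def cutoff_eq_0)
    have "(\<integral>\<^sup>+\<omega>. ennreal (radial (f n) (Y t \<omega>)) \<partial>M) \<le> (\<integral>\<^sup>+\<omega>. ennreal (radial (f n) (Y r \<omega>)) \<partial>M) +
      (\<integral>\<^sup>+\<omega>. (\<integral>\<^sup>+u\<in>{r<..t}. ennreal (L * radial W (Yl u \<omega>)) \<partial>lborel) \<partial>M)"
      using f_le by (intro expectation_radial_le[OF s mw supp _ t]) auto
    also have "(\<integral>\<^sup>+\<omega>. (\<integral>\<^sup>+u\<in>{r<..t}. ennreal (L * radial W (Yl u \<omega>)) \<partial>lborel) \<partial>M)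
      = (\<integral>\<^sup>+u\<in>{r<..t}. (\<integral>\<^sup>+\<omega>. ennreal (L * radial W (Yl u \<omega>)) \<partial>M) \<partial>lborel)"
      unfolding W_def by (intro left_limit_Fubini(1) t continuous_intros continuous_on_radial_weight
        e p)
    also have "\<dots> = (\<integral>\<^sup>+u. ennreal (L * weight_const p) * (left_moment e p u * indicator {r<..t} u)
      \<partial>lborel)"
    proof (rule nn_integral_cong)
      fix u :: real
      show "(\<integral>\<^sup>+\<omega>. ennreal (L * radial W (Yl u \<omega>)) \<partial>M) * indicator {r<..t} u =
        ennreal (L * weight_const p) * (left_moment e p u * indicator {r<..t} u)"
      proof (cases "u \<in> {r<..t}")
        case True
        have "(\<integral>\<^sup>+\<omega>. ennreal (L * radial W (Yl u \<omega>)) \<partial>M)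
          = (\<integral>\<^sup>+\<omega>. ennreal (L * weight_const p) * ennreal (radial (weight e p) (Yl u \<omega>)) \<partial>M)"
          using L weight_const_nonneg[OF p(1)] by (simp add: W_def ennreal_mult mult.assoc)
        also have "\<dots> = ennreal (L * weight_const p) * left_moment e p u"
          unfolding left_moment_def using True t
          by (intro nn_integral_cmult left_limit_Fubini(3)[OF continuous_on_radial_weight[OF e p(1)]
            t]) auto
        finally show ?thesis using True by simp
      qed simp
    qed
    also have "\<dots> = ennreal (L * weight_const p) * (\<integral>\<^sup>+u\<in>{r<..t}. left_moment e p u \<partial>lborel)"
    proof (rule nn_integral_cmult)
      have "(\<lambda>u. \<integral>\<^sup>+\<omega>. ennreal (radial (weight e p) (Yl u \<omega>)) * indicator {r<..t} u \<partial>M)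
        \<in> borel_measurable lborel"
        by (rule borel_measurable_nn_integral[OF left_limit_measurable_ennreal[OF
          continuous_on_radial_weight[OF e p(1)] t]])
      also have "(\<lambda>u. \<integral>\<^sup>+\<omega>. ennreal (radial (weight e p) (Yl u \<omega>)) * indicator {r<..t} u \<partial>M)
        = (\<lambda>u. left_moment e p u * indicator {r<..t} u)"
        by (auto simp: fun_eq_iff left_moment_def indicator_def)
      finally show "(\<lambda>u. left_moment e p u * indicator {r<..t} u) \<in> borel_measurable lborel" .
    qed
    also have "(\<integral>\<^sup>+\<omega>. ennreal (radial (f n) (Y r \<omega>)) \<partial>M)
      \<le> (\<integral>\<^sup>+\<omega>. ennreal (radial (weight e p) (Y r \<omega>)) \<partial>M)"
      using f_le by (intro nn_integral_mono ennreal_leI) auto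
    finally show ?thesis by (simp add: add_right_mono)
  qed
  note f_bound = this
  have lim: "(\<lambda>n. ennreal (radial (f n) y)) \<longlonglongrightarrow> ennreal (radial (weight e p) y)" for y :: "real^'d"
  proof -
    have "(\<lambda>n. radial (f n) y) \<longlonglongrightarrow> radial (weight e p) y * 1"
      unfolding f_def by (intro tendsto_mult tendsto_const tendsto_cutoff_1[OF tendsto_const])
    then show ?thesis by (intro tendsto_ennrealI) simp
  qed
  have meas: "(\<lambda>\<omega>. ennreal (radial (f n) (Y t \<omega>))) \<in> borel_measurable M" for n
  proof -
    have [measurable]: "(\<lambda>\<omega>. radial (weight e p) (Y t \<omega>)) \<in> borel_measurable M" "Y t
      \<in> borel_measurable M"
      using radial_weight_Y_measurable[OF e p(1) t] YM[OF t] by auto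
    show ?thesis unfolding f_def cutoff_def by measurable
  qed
  have "(\<integral>\<^sup>+\<omega>. ennreal (radial (weight e p) (Y t \<omega>)) \<partial>M)
    = (\<integral>\<^sup>+\<omega>. liminf (\<lambda>n. ennreal (radial (f n) (Y t \<omega>))) \<partial>M)"
    by (intro nn_integral_cong lim_imp_Liminf[symmetric] lim) simp
  also have "\<dots> \<le> liminf (\<lambda>n. \<integral>\<^sup>+\<omega>. ennreal (radial (f n) (Y t \<omega>)) \<partial>M)"
    by (rule nn_integral_liminf[OF meas])
  also have "\<dots> \<le> liminf (\<lambda>n. ?R)"
    by (intro Liminf_mono always_eventually allI f_bound)
  also have "\<dots> = ?R" by (simp add: Liminf_const)
  finally show ?thesis .
qed

text \<open>Fatou's lemma along times increasing strictly to u transfers the inequality from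
  \<open>Y\<close> to its left limits, so that the same function stands on both sides, as Gronwall's
  inequality requires.\<close>

lemma left_moment_le:
  assumes e: "0 \<le> e" and p: "0 \<le> p" "p \<le> real m" and u: "u \<in> {r<..T}"
  shows "left_moment e p u \<le>
    (\<integral>\<^sup>+\<omega>. ennreal (radial (weight e p) (Y r \<omega>)) \<partial>M) +
    ennreal (L * weight_const p) * (\<integral>\<^sup>+v\<in>{r<..u}. left_moment e p v \<partial>lborel)" (is "_ \<le> ?R")
proof -
  define t where "t n = u - (u - r) / real (Suc n)" for n
  have t: "t n \<in> {r..T}" "t n < u" for n
  proof -
    have "(u - r) / real (Suc n) \<le> (u - r) / 1" using u by (intro divide_left_mono) auto
    moreover have "0 < (u - r) / real (Suc n)" using u by simp
    ultimately show "t n \<in> {r..T}" "t n < u" using u by (auto simp: t_def)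
  qed
  have "(\<lambda>n. u - (u - r) * inverse (real (Suc n))) \<longlonglongrightarrow> u - (u - r) * 0"
    by (intro tendsto_intros LIMSEQ_inverse_real_of_nat)
  then have "t \<longlonglongrightarrow> u" by (simp add: t_def[abs_def] divide_inverse)
  then have t_left: "filterlim t (at_left u) sequentially"
    using t by (intro filterlim_at_withinI) auto
  have lim: "(\<lambda>n. ennreal (radial (weight e p) (Y (t n) \<omega>)))
    \<longlonglongrightarrow> ennreal (radial (weight e p) (Yl u \<omega>))" if "\<omega> \<in> space M" for \<omega>
  proof (intro tendsto_ennrealI isCont_tendsto_compose[where g="radial (weight e p)"])
    show "isCont (radial (weight e p)) (Yl u \<omega>)"
      using continuous_on_radial_weight[OF e p(1), where 'a="real^'d"]
        by (simp add: continuous_on_eq_continuous_at)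
    show "(\<lambda>n. Y (t n) \<omega>) \<longlonglongrightarrow> Yl u \<omega>"
      by (rule filterlim_compose[OF left_limits(1)[OF that u] t_left])
  qed
  have "left_moment e p u = (\<integral>\<^sup>+\<omega>. liminf (\<lambda>n. ennreal (radial (weight e p) (Y (t n) \<omega>))) \<partial>M)"
    unfolding left_moment_def by (intro nn_integral_cong lim_imp_Liminf[symmetric] lim) simp_all
  also have "\<dots> \<le> liminf (\<lambda>n. \<integral>\<^sup>+\<omega>. ennreal (radial (weight e p) (Y (t n) \<omega>)) \<partial>M)"
    by (intro nn_integral_liminf measurable_compose[OF radial_weight_Y_measurable[OF e p(1) t(1)]])
      measurable
  also have "\<dots> \<le> liminf (\<lambda>n. ?R)"
  proof (intro Liminf_mono always_eventually allI)
    fix n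
    have "(\<integral>\<^sup>+v\<in>{r<..t n}. left_moment e p v \<partial>lborel) \<le> (\<integral>\<^sup>+v\<in>{r<..u}. left_moment e p v \<partial>lborel)"
      using t(2)[of n] by (intro nn_integral_mono) (auto simp: indicator_def)
    then show "(\<integral>\<^sup>+\<omega>. ennreal (radial (weight e p) (Y (t n) \<omega>)) \<partial>M) \<le> ?R"
      using moment_le[OF e p t(1), of n] by (meson add_left_mono mult_left_mono order_trans zero_le)
  qed
  also have "\<dots> = ?R" by (simp add: Liminf_const)
  finally show ?thesis .
qed

end

context bounded_generator
begin

text \<open>For e = 1/(n+1) the weight is at most (n+1)^m, which supplies the a priori bound for
  Gronwall's inequality. That bound does not enter the conclusion, so \<open>D\<close> is the same
  for all n and Fatou's lemma removes e.\<close>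

lemma left_moment_uniform_bound:
  assumes init: "(\<integral>\<^sup>+\<omega>. ennreal (radial (weight 0 (real m)) (Y r \<omega>)) \<partial>M) < \<infinity>"
  shows "\<exists>D<\<infinity>. \<forall>u\<in>{r<..T}. left_moment 0 (real m) u \<le> D"
proof -
  define b where "b = (\<integral>\<^sup>+\<omega>. ennreal (radial (weight 0 (real m)) (Y r \<omega>)) \<partial>M)"
  \<comment> \<open>The summand 1 secures c > 0 even if L = 0.\<close>
  define c where "c = L * weight_const (real m) + 1"
  have c: "0 < c" "L * weight_const (real m) \<le> c"
    using L weight_const_nonneg[of "real m"] by (auto simp: c_def intro: add_nonneg_pos)
  define D where "D = ennreal (exp (2 * c * (T - r))) * (2 * b)"
  have D: "D < \<infinity>" using init by (simp add: D_def b_def ennreal_mult_less_top)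
  have xpos: "0 < 1 + (norm (y::real^'d))\<^sup>2" for y by (simp add: add_pos_nonneg)
  have bound: "left_moment (1 / real (Suc n)) (real m) u \<le> D" if u: "u \<in> {r<..T}" for n u
    unfolding D_def
  proof (rule gronwall_nn_integral[OF _ _ c(1) u])
    let ?e = "1 / real (Suc n)"
    fix u assume u: "u \<in> {r<..T}"
    have "left_moment ?e (real m) u \<le> (\<integral>\<^sup>+\<omega>. ennreal ((1 / ?e) powr real m) \<partial>M)"
      unfolding left_moment_def by (intro nn_integral_mono ennreal_leI weight_le_inverse xpos) auto
    then show "left_moment ?e (real m) u \<le> ennreal ((1 / ?e) powr real m)"
      by (simp add: emeasure_space_1)
    have "(\<integral>\<^sup>+\<omega>. ennreal (radial (weight ?e (real m)) (Y r \<omega>)) \<partial>M) \<le> b"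
      unfolding b_def by (intro nn_integral_mono ennreal_leI weight_le_weight_0 xpos) auto
    then show "left_moment ?e (real m) u \<le> b + ennreal c * (\<integral>\<^sup>+v\<in>{r<..u}. left_moment ?e (real m) v
      \<partial>lborel)"
      using left_moment_le[of ?e "real m" u] u c(2)
      by (intro order_trans[OF left_moment_le[of ?e
        "real m" u]] add_mono mult_right_mono ennreal_leI) auto
  qed
  have "left_moment 0 (real m) u \<le> D" if u: "u \<in> {r<..T}" for u
  proof -
    have lim: "(\<lambda>n. ennreal (radial (weight (1 / real (Suc n)) (real m)) y))
      \<longlonglongrightarrow> ennreal (radial (weight 0 (real m)) y)"
      for y :: "real^'d"
      by (intro tendsto_ennrealI tendsto_weight_0 xpos)
    have "left_moment 0 (real m) u = (\<integral>\<^sup>+\<omega>. liminf (\<lambda>n. ennreal (radial (weight (1 / real (Suc n))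
      (real m)) (Yl u \<omega>))) \<partial>M)"
      unfolding left_moment_def by (intro nn_integral_cong lim_imp_Liminf[symmetric] lim) simp_all
    also have "\<dots> \<le> liminf (\<lambda>n. left_moment (1 / real (Suc n)) (real m) u)"
      unfolding left_moment_def using u rT
      by (intro nn_integral_liminf left_limit_Fubini(3)[where t=T] continuous_on_radial_weight) auto
    also have "\<dots> \<le> liminf (\<lambda>n. D)"
      using bound[OF u] by (intro Liminf_mono always_eventually allI)
    finally show ?thesis by (simp add: Liminf_const)
  qed
  with D show ?thesis by blast
qed

section \<open>Control of the supremum\<close>

lemma ennreal_power2_le_two_add:
  fixes S :: ennreal
  assumes "a = b + c" "ennreal \<bar>c\<bar> \<le> S"
  shows "ennreal (a\<^sup>2) \<le> 2 * ennreal (b\<^sup>2) + 2 * S\<^sup>2"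
proof -
  have "a\<^sup>2 \<le> 2 * b\<^sup>2 + 2 * \<bar>c\<bar>\<^sup>2"
    using zero_le_power2[of "b - c"] by (simp add: assms(1) power2_eq_square algebra_simps)
  then have "ennreal (a\<^sup>2) \<le> ennreal (2 * b\<^sup>2 + 2 * \<bar>c\<bar>\<^sup>2)" by (rule ennreal_leI)
  also have "\<dots> = 2 * ennreal (b\<^sup>2) + 2 * (ennreal \<bar>c\<bar>)\<^sup>2"
    by (simp add: ennreal_plus ennreal_mult ennreal_power del: power2_abs)
  also have "\<dots> \<le> 2 * ennreal (b\<^sup>2) + 2 * S\<^sup>2"
    using assms(2) by (intro add_left_mono mult_left_mono power_mono) auto
  finally show ?thesis .
qed

definition left_path_integral :: "'w \<Rightarrow> ennreal" where
  "left_path_integral \<omega> = (\<integral>\<^sup>+u\<in>{r<..T}. ennreal (radial (weight 0 (real m)) (Yl u \<omega>)) \<partial>lborel)"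

lemma left_path_integral_measurable: "left_path_integral \<in> borel_measurable M"
  unfolding left_path_integral_def[abs_def] using rT
  by (intro left_limit_Fubini(2) continuous_on_radial_weight) auto

text \<open>The drift of the half weight enters squared. The Cauchy-Schwarz inequality against the
  constant 1 brings it back to an integral of the full weight, at the price of the factor T -
  r.\<close>

lemma path_Cauchy_Schwarz:
  assumes \<omega>: "\<omega> \<in> space M" and k: "0 \<le> k"
  shows "(\<integral>\<^sup>+u\<in>{r<..T}. ennreal (k * radial (weight 0 (real m / 2)) (Yl u \<omega>)) \<partial>lborel)\<^sup>2
     \<le> ennreal (k\<^sup>2 * (T - r)) * left_path_integral \<omega>"
proof -
  define h where "h y = k * radial (weight 0 (real m / 2)) y" for y :: "real^'d"
  have h: "continuous_on UNIV h" unfolding h_def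
    by (intro continuous_intros continuous_on_radial_weight) auto
  have hp: "continuous_on UNIV (radial (weight 0 (real m)) :: real^'d \<Rightarrow> real)"
    by (rule continuous_on_radial_weight) auto
  have T: "T \<in> {r..T}" using rT by simp
  have xpos: "0 < 1 + (norm (y::real^'d))\<^sup>2" for y by (simp add: add_pos_nonneg)
  have meas: "(\<lambda>u. ennreal (h (Yl u \<omega>)) * indicator {r<..T} u) \<in> borel_measurable lborel"
    using measurable_compose[OF measurable_Pair2'[OF \<omega>] left_limit_measurable_ennreal[OF h T]]
      by simp
  have meas2: "(\<lambda>u. ennreal (radial (weight 0 (real m)) (Yl u \<omega>)) * indicator {r<..T} u)
    \<in> borel_measurable lborel"
    using measurable_compose[OF measurable_Pair2'[OF \<omega>] left_limit_measurable_ennreal[OF hp T]]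
      by simp
  have "(\<integral>\<^sup>+u\<in>{r<..T}. ennreal (h (Yl u \<omega>)) \<partial>lborel)\<^sup>2
    = (\<integral>\<^sup>+u. (ennreal (h (Yl u \<omega>)) * indicator {r<..T} u) * indicator {r<..T} u \<partial>lborel)\<^sup>2"
    by (intro arg_cong[where f="\<lambda>x. x\<^sup>2"] nn_integral_cong) (simp add: indicator_def)
  also have "\<dots> \<le> (\<integral>\<^sup>+u. (ennreal (h (Yl u \<omega>)) * indicator {r<..T} u)\<^sup>2 \<partial>lborel) * (\<integral>\<^sup>+u. (indicator
    {r<..T} u)\<^sup>2 \<partial>lborel)"
    by (rule Cauchy_Schwarz_nn_integral[OF meas]) simp
  also have "(\<integral>\<^sup>+u. (indicator {r<..T} u :: ennreal)\<^sup>2 \<partial>lborel)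
    = (\<integral>\<^sup>+u. indicator {r<..T} u \<partial>lborel)"
    by (intro nn_integral_cong) (simp add: indicator_def)
  also have "\<dots> = ennreal (T - r)" using rT by simp
  also have "(\<integral>\<^sup>+u. (ennreal (h (Yl u \<omega>)) * indicator {r<..T} u)\<^sup>2 \<partial>lborel)
     = (\<integral>\<^sup>+u. ennreal (k\<^sup>2) * (ennreal (radial (weight 0 (real m)) (Yl u \<omega>)) * indicator {r<..T} u)
       \<partial>lborel)"
  proof (rule nn_integral_cong)
    fix u
    have "(ennreal (h (Yl u \<omega>)))\<^sup>2 = ennreal (k\<^sup>2) * ennreal (radial (weight 0 (real m)) (Yl u \<omega>))"
      using k by (simp add: h_def ennreal_power power_mult_distrib weight_0_half_sq[OF xpos]
        ennreal_mult)
    then show "(ennreal (h (Yl u \<omega>)) * indicator {r<..T} u)\<^sup>2 =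
      ennreal (k\<^sup>2) * (ennreal (radial (weight 0 (real m)) (Yl u \<omega>)) * indicator {r<..T} u)"
      by (simp add: indicator_def)
  qed
  also have "\<dots> = ennreal (k\<^sup>2) * left_path_integral \<omega>"
    unfolding left_path_integral_def by (rule nn_integral_cmult[OF meas2])
  also have "ennreal (k\<^sup>2) * left_path_integral \<omega> * ennreal (T - r)
    = ennreal (k\<^sup>2 * (T - r)) * left_path_integral \<omega>"
    using rT by (simp add: ennreal_mult mult_ac)
  finally show ?thesis by (simp add: h_def)
qed

text \<open>The radial process differs from its martingale by a drift that one random variable
  \<open>S\<close> bounds at all times. Splitting squares by (b + c)^2 <= 2 b^2 + 2 c^2 before and
  after Doob's constant 4 gives 2 * 4 * 2 = 16 for the terminal value and 2 * 4 * 2 + 2 = 18 for the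
  drift. Neither \<open>R\<close> nor \<open>N\<close> enters the right side.\<close>

lemma maximal_inequality:
  fixes R :: real and N :: nat
  defines "f x \<equiv> weight 0 (real m / 2) x * cutoff R x"
    and "k \<equiv> (L * weight_const (real m / 2))\<^sup>2 * (T - r)"
    and "grid i \<equiv> r + real i * (T - r) / real N"
  assumes R: "1 \<le> R" and N: "1 \<le> N"
  shows "(\<integral>\<^sup>+\<omega>. (SUP i\<in>{..N}. ennreal ((radial f (Y (grid i) \<omega>))\<^sup>2)) \<partial>M) \<le>
    16 * (\<integral>\<^sup>+\<omega>. ennreal (radial (weight 0 (real m)) (Y T \<omega>)) \<partial>M)
      + 18 * (ennreal k * (\<integral>\<^sup>+\<omega>. left_path_integral \<omega> \<partial>M))"
proof -
  define W where "W x = weight_const (real m / 2) * weight 0 (real m / 2) x" for x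
  obtain f1 f2 where s: "scaled_C2 W f f1 f2"
    using scaled_C2_weight_cutoff[of 0 "real m / 2" R] R unfolding W_def weight_const_def f_def
      by auto
  have mw: "moderate_weight m W"
    unfolding W_def[abs_def] by (rule moderate_weight_weight) (auto simp: weight_const_nonneg)
  have supp: "f x = 0" if "R \<le> x" for x using that R by (simp add: f_def cutoff_eq_0)
  have xpos: "0 < 1 + (norm (y::real^'d))\<^sup>2" for y by (simp add: add_pos_nonneg)
  have T: "T \<in> {r..T}" using rT by simp
  have grid: "grid i \<in> {r..T}" if "i \<le> N" for i
  proof -
    have "real i * (T - r) \<le> real N * (T - r)" using that rT by (intro mult_right_mono) auto
    then have "real i * (T - r) / real N \<le> T - r" using N
      by (simp add: pos_divide_le_eq mult.commute)
    moreover have "0 \<le> real i * (T - r) / real N" using rT by simp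
    ultimately show ?thesis by (simp add: grid_def)
  qed
  have grid_mono: "grid i \<le> grid j" if "i \<le> j" for i j
    using that rT by (simp add: grid_def divide_right_mono mult_right_mono)
  have grid_N: "grid N = T" using N by (simp add: grid_def)
  define X where "X i = mg f (grid i)" for i
  \<comment> \<open>The integral runs up to T and \<open>W\<close> carries no cutoff, so
    \<open>S\<close> dominates the drift at every grid time and for every \<open>R\<close>.\<close>
  define S where "S \<omega> = (\<integral>\<^sup>+u\<in>{r<..T}. ennreal (L * radial W (Yl u \<omega>)) \<partial>lborel)" for \<omega>
  have S_sq: "(S \<omega>)\<^sup>2 \<le> ennreal k * left_path_integral \<omega>" if "\<omega> \<in> space M" for \<omega>
    using path_Cauchy_Schwarz[OF that, of "L * weight_const (real m / 2)"] L weight_const_nonneg[of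
      "real m / 2"]
    by (simp add: S_def W_def k_def mult.assoc)
  have drift_S: "ennreal \<bar>drift f t \<omega>\<bar> \<le> S \<omega>" if "t \<in> {r..T}" "\<omega> \<in> space M" for t \<omega>
  proof -
    have "ennreal \<bar>drift f t \<omega>\<bar> \<le> (\<integral>\<^sup>+u\<in>{r<..t}. ennreal (L * radial W (Yl u \<omega>)) \<partial>lborel)"
      by (rule abs_drift_le[OF s mw that(2,1)])
    also have "\<dots> \<le> S \<omega>" unfolding S_def using that(1)
      by (intro nn_integral_mono) (auto simp: indicator_def)
    finally show ?thesis .
  qed
  obtain B where B: "\<And>t \<omega>. t \<in> {r..T} \<Longrightarrow> \<omega> \<in> space M \<Longrightarrow> \<bar>mg f t \<omega>\<bar> \<le> B"
    using bounded_mg[OF s mw supp R] by blast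
  have X_meas: "X i \<in> borel_measurable M" if "i \<le> N" for i
    unfolding X_def by (rule mg_measurable[OF s mw supp R grid[OF that]])
  have XB: "\<bar>X i \<omega>\<bar> \<le> B" if "i \<le> N" "\<omega> \<in> space M" for i \<omega>
    unfolding X_def using B grid that by blast
  have rm_meas[measurable]: "running_max X N \<in> borel_measurable M"
    by (intro borel_measurable_running_max X_meas)
  have [measurable]: "X N \<in> borel_measurable M" by (rule X_meas) simp
  note left_path_integral_measurable[measurable]
  have rmB: "0 \<le> running_max X N \<omega>" "\<omega> \<in> space M \<Longrightarrow> running_max X N \<omega> \<le> B" for \<omega>
    using running_max_nonneg running_max_le[of N X \<omega> B] XB by auto
  have doob: "(\<integral>\<omega>. (running_max X N \<omega>)\<^sup>2 \<partial>M) \<le> 4 * (\<integral>\<omega>. (X N \<omega>)\<^sup>2 \<partial>M)"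
  proof (rule doob_L2[where F="\<lambda>i. G (grid i)" and B=B])
    fix i j assume ij: "j \<le> i" "i \<le> N"
    show "X j \<in> borel_measurable (G (grid i))"
      unfolding X_def
      by (rule measurable_from_subalg[OF G_mono[OF grid_mono[OF ij(1)]] mg_adapted[OF s mw supp R
        grid]]) (use ij in auto)
  next
    fix i Z assume i: "i < N" and Z: "Z \<in> borel_measurable (G (grid i))" "\<And>\<omega>. \<omega> \<in> space M \<Longrightarrow> \<bar>Z \<omega>\<bar>
      \<le> B"
    show "(\<integral>\<omega>. Z \<omega> * X (Suc i) \<omega> \<partial>M) = (\<integral>\<omega>. Z \<omega> * X i \<omega> \<partial>M)"
      unfolding X_def using grid[of i] grid[of "Suc i"] grid_mono[of i "Suc i"] i
      by (intro mg_martingale[OF s mw supp R _ _ Z]) auto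
  qed (use grid XB G_subalgebra in auto)
  have sq_int: "integrable M (\<lambda>\<omega>. (running_max X N \<omega>)\<^sup>2)" "integrable M (\<lambda>\<omega>. (X N \<omega>)\<^sup>2)"
  proof -
    have "(running_max X N \<omega>)\<^sup>2 \<le> B\<^sup>2" "(X N \<omega>)\<^sup>2 \<le> B\<^sup>2" if "\<omega> \<in> space M" for \<omega>
      using power_mono[OF rmB(2)[OF that] rmB(1), of 2] power_mono[OF XB[OF order_refl that]
        abs_ge_zero, of 2] by auto
    then show "integrable M (\<lambda>\<omega>. (running_max X N \<omega>)\<^sup>2)" "integrable M (\<lambda>\<omega>. (X N \<omega>)\<^sup>2)"
      by (auto intro!: integrable_const_bound[of _ "B\<^sup>2"])
  qed
  have doob': "(\<integral>\<^sup>+\<omega>. ennreal ((running_max X N \<omega>)\<^sup>2) \<partial>M) \<le> 4 * (\<integral>\<^sup>+\<omega>. ennreal ((X N \<omega>)\<^sup>2) \<partial>M)"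
    using ennreal_leI[OF doob] sq_int by (simp add: nn_integral_eq_integral ennreal_mult)
  define Q where "Q = (\<integral>\<^sup>+\<omega>. left_path_integral \<omega> \<partial>M)"
  have XN: "ennreal ((X N \<omega>)\<^sup>2) \<le> 2 * ennreal (radial (weight 0 (real m)) (Y T \<omega>))
    + 2 * (ennreal k * left_path_integral \<omega>)"
    if \<omega>: "\<omega> \<in> space M" for \<omega>
  proof -
    have "X N \<omega> = radial f (Y T \<omega>) + (- drift f T \<omega>)" by (simp add: X_def mg_def grid_N)
    from ennreal_power2_le_two_add[OF this, of "S \<omega>"]
    have "ennreal ((X N \<omega>)\<^sup>2) \<le> 2 * ennreal ((radial f (Y T \<omega>))\<^sup>2) + 2 * (S \<omega>)\<^sup>2"
      using drift_S[OF T \<omega>] by simp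
    also have "(radial f (Y T \<omega>))\<^sup>2 \<le> (radial (weight 0 (real m / 2)) (Y T \<omega>))\<^sup>2"
      using cutoff_bounds[of R "1 + (norm (Y T \<omega>))\<^sup>2"] R
      by (intro power_mono) (auto simp: f_def intro!: mult_left_le)
    finally show ?thesis
      using S_sq[OF \<omega>] unfolding weight_0_half_sq[OF xpos]
      by (simp add: add_left_mono mult_left_mono order_trans ennreal_leI add_mono)
  qed
  have "(\<integral>\<^sup>+\<omega>. ennreal ((X N \<omega>)\<^sup>2) \<partial>M) \<le> (\<integral>\<^sup>+\<omega>. 2 * ennreal (radial (weight 0 (real m)) (Y T \<omega>))
    + 2 * (ennreal k * left_path_integral \<omega>) \<partial>M)"
    by (intro nn_integral_mono XN)
  also have "\<dots> = 2 * (\<integral>\<^sup>+\<omega>. ennreal (radial (weight 0 (real m)) (Y T \<omega>)) \<partial>M) + 2 * (ennreal k * Q)"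
  proof -
    have [measurable]: "(\<lambda>\<omega>. radial (weight 0 (real m)) (Y T \<omega>)) \<in> borel_measurable M"
      by (rule radial_weight_Y_measurable) (use T in auto)
    show ?thesis by (simp add: nn_integral_add nn_integral_cmult Q_def)
  qed
  finally have XN_int: "(\<integral>\<^sup>+\<omega>. ennreal ((X N \<omega>)\<^sup>2) \<partial>M) \<le> \<dots>" .
  have "(\<integral>\<^sup>+\<omega>. (SUP i\<in>{..N}. ennreal ((radial f (Y (grid i) \<omega>))\<^sup>2)) \<partial>M)
    \<le> (\<integral>\<^sup>+\<omega>. 2 * ennreal ((running_max X N \<omega>)\<^sup>2) + 2 * (ennreal k * left_path_integral \<omega>) \<partial>M)"
  proof (intro nn_integral_mono SUP_least)
    fix \<omega> i assume \<omega>: "\<omega> \<in> space M" and i: "i \<in> {..N}"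
    have "radial f (Y (grid i) \<omega>) = X i \<omega> + drift f (grid i) \<omega>" by (simp add: X_def mg_def)
    from ennreal_power2_le_two_add[OF this drift_S[OF grid \<omega>]] i
    have "ennreal ((radial f (Y (grid i) \<omega>))\<^sup>2) \<le> 2 * ennreal ((X i \<omega>)\<^sup>2) + 2 * (S \<omega>)\<^sup>2" by simp
    also have "\<dots> \<le> 2 * ennreal ((running_max X N \<omega>)\<^sup>2) + 2 * (ennreal k * left_path_integral \<omega>)"
    proof (intro add_mono mult_left_mono ennreal_leI S_sq[OF \<omega>])
      show "(X i \<omega>)\<^sup>2 \<le> (running_max X N \<omega>)\<^sup>2"
        using power_mono[OF abs_le_running_max[of i N X \<omega>] abs_ge_zero, of 2] i by simp
    qed auto
    finally show "ennreal ((radial f (Y (grid i) \<omega>))\<^sup>2) \<le> \<dots>" .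
  qed
  also have "\<dots> = 2 * (\<integral>\<^sup>+\<omega>. ennreal ((running_max X N \<omega>)\<^sup>2) \<partial>M) + 2 * (ennreal k * Q)"
    by (simp add: nn_integral_add nn_integral_cmult Q_def)
  also have "\<dots> \<le> 2 * (4 * (2 * (\<integral>\<^sup>+\<omega>. ennreal (radial (weight 0 (real m)) (Y T \<omega>)) \<partial>M)
    + 2 * (ennreal k * Q))) + 2 * (ennreal k * Q)"
    by (intro add_right_mono mult_left_mono order_trans[OF doob'] XN_int) auto
  also have "\<dots> = 16 * (\<integral>\<^sup>+\<omega>. ennreal (radial (weight 0 (real m)) (Y T \<omega>)) \<partial>M)
    + 18 * (ennreal k * Q)"
  proof -
    have "2 * (4 * (2 * p + 2 * q)) + 2 * q = 16 * p + 18 * q" for p q :: ennreal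
      by (simp add: distrib_left flip: mult.assoc add.assoc distrib_right)
    then show ?thesis .
  qed
  finally show ?thesis unfolding Q_def .
qed

end

text \<open>Cutoff level and grid are refined together through one index n. The grids are not
  nested, so the maxima \<open>H n\<close> need not increase; but every t is approached from the
  right by grid points, whence the lower limit of \<open>H n\<close> bounds the value at every t. It
  is a measurable majorant of the supremum, to which Fatou's lemma applies.\<close>

lemma (in bounded_generator) sup_moment_finite:
  assumes init: "(\<integral>\<^sup>+\<omega>. ennreal (norm (Y r \<omega>) ^ (2 * m)) \<partial>M) < \<infinity>"
  shows "(\<integral>\<^sup>+\<omega>. (SUP t\<in>{r..T}. ennreal (norm (Y t \<omega>) ^ (2 * m))) \<partial>M) < \<infinity>"
proof -
  have r: "r \<in> {r..T}" and T: "T \<in> {r..T}" using rT by auto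
  have xpos: "0 < 1 + (norm (y::real^'d))\<^sup>2" for y by (simp add: add_pos_nonneg)
  define w where "w y = radial (weight 0 (real m)) y" for y :: "real^'d"
  have w: "w y = (1 + (norm y)\<^sup>2) ^ m" for y unfolding w_def by (rule weight_0_nat[OF xpos])
  have norm_w: "norm y ^ (2 * m) \<le> w y" for y
    unfolding w power_mult by (intro power_mono) auto
  have w_norm: "w y \<le> 2 ^ m + 2 ^ m * norm y ^ (2 * m)" for y
  proof -
    have "w y \<le> (2 * max 1 ((norm y)\<^sup>2)) ^ m" unfolding w by (intro power_mono) auto
    also have "\<dots> \<le> 2 ^ m + 2 ^ m * norm y ^ (2 * m)"
      by (auto simp: power_mult power_mult_distrib max_def)
    finally show ?thesis .
  qed
  have "(\<integral>\<^sup>+\<omega>. ennreal (w (Y r \<omega>)) \<partial>M) \<le> (\<integral>\<^sup>+\<omega>. ennreal (2 ^ m)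
    + ennreal (2 ^ m) * ennreal (norm (Y r \<omega>) ^ (2 * m)) \<partial>M)"
    using w_norm by (intro nn_integral_mono) (simp flip: ennreal_mult ennreal_plus add: ennreal_leI)
  also have "\<dots> = ennreal (2 ^ m) + ennreal (2 ^ m) * (\<integral>\<^sup>+\<omega>. ennreal (norm (Y r \<omega>) ^ (2 * m)) \<partial>M)"
  proof -
    have [measurable]: "Y r \<in> borel_measurable M" by (rule YM[OF r])
    show ?thesis by (simp add: nn_integral_add nn_integral_cmult emeasure_space_1)
  qed
  also have "\<dots> < \<infinity>" using init by (simp add: ennreal_mult_less_top)
  finally have init_w: "(\<integral>\<^sup>+\<omega>. ennreal (w (Y r \<omega>)) \<partial>M) < \<infinity>" .
  obtain D where D: "D < \<infinity>" "\<And>u. u \<in> {r<..T} \<Longrightarrow> left_moment 0 (real m) u \<le> D"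
    using left_moment_uniform_bound[OF init_w[unfolded w_def]] by blast
  have "(\<integral>\<^sup>+u\<in>{r<..T}. left_moment 0 (real m) u \<partial>lborel) \<le> (\<integral>\<^sup>+u. D * indicator {r<..T} u \<partial>lborel)"
    using D(2) by (intro nn_integral_mono) (auto simp: indicator_def)
  also have "\<dots> = D * ennreal (T - r)" using rT by (simp add: nn_integral_cmult_indicator)
  also have "\<dots> < \<infinity>" using D(1) by (simp add: ennreal_mult_less_top)
  finally have left_fin: "(\<integral>\<^sup>+u\<in>{r<..T}. left_moment 0 (real m) u \<partial>lborel) < \<infinity>" .
  have "(\<integral>\<^sup>+\<omega>. ennreal (w (Y T \<omega>)) \<partial>M) \<le> (\<integral>\<^sup>+\<omega>. ennreal (w (Y r \<omega>)) \<partial>M) +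
      ennreal (L * weight_const (real m)) * (\<integral>\<^sup>+u\<in>{r<..T}. left_moment 0 (real m) u \<partial>lborel)"
    unfolding w_def by (rule moment_le) (use T in auto)
  also have "\<dots> < \<infinity>" using init_w left_fin by (simp add: ennreal_mult_less_top)
  finally have w_T: "(\<integral>\<^sup>+\<omega>. ennreal (w (Y T \<omega>)) \<partial>M) < \<infinity>" .
  have Q: "(\<integral>\<^sup>+\<omega>. left_path_integral \<omega> \<partial>M) < \<infinity>"
    using left_fin left_limit_Fubini(1)[OF continuous_on_radial_weight[of 0 "real m"] T]
    unfolding left_path_integral_def left_moment_def by simp
  define k where "k = (L * weight_const (real m / 2))\<^sup>2 * (T - r)"
  define E where "E = 16 * (\<integral>\<^sup>+\<omega>. ennreal (w (Y T \<omega>)) \<partial>M)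
    + 18 * (ennreal k * (\<integral>\<^sup>+\<omega>. left_path_integral \<omega> \<partial>M))"
  have E: "E < \<infinity>" using w_T Q by (simp add: E_def ennreal_mult_less_top)
  define f where "f n x = weight 0 (real m / 2) x * cutoff (real (Suc n)) x" for n x
  define grid where "grid n i = r + real i * (T - r) / real (Suc n)" for n i
  define H where "H n \<omega> = (SUP i\<in>{..Suc n}. ennreal ((radial (f n) (Y (grid n i) \<omega>))\<^sup>2))" for n \<omega>
  have H_int: "(\<integral>\<^sup>+\<omega>. H n \<omega> \<partial>M) \<le> E" for n
    using maximal_inequality[of "real (Suc n)" "Suc n"]
    unfolding H_def E_def f_def grid_def w_def k_def by simp
  have grid: "grid n i \<in> {r..T}" if "i \<le> Suc n" for n i
  proof -
    have "real i * (T - r) \<le> real (Suc n) * (T - r)" using that rT by (intro mult_right_mono) auto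
    then have "real i * (T - r) / real (Suc n) \<le> T - r"
      by (simp only: pos_divide_le_eq of_nat_0_less_iff mult.commute)
    moreover have "0 \<le> real i * (T - r) / real (Suc n)" using rT by simp
    ultimately show ?thesis by (simp add: grid_def)
  qed
  have H_meas: "H n \<in> borel_measurable M" for n
  proof -
    have "(\<lambda>\<omega>. ennreal ((radial (f n) (Y (grid n i) \<omega>))\<^sup>2)) \<in> borel_measurable M" if "i \<in> {..Suc n}"
      for i
    proof -
      have [measurable]: "(\<lambda>\<omega>. radial (weight 0 (real m / 2)) (Y (grid n i) \<omega>))
        \<in> borel_measurable M"
        "Y (grid n i) \<in> borel_measurable M"
        using that by (auto intro!: radial_weight_Y_measurable YM grid)
      show ?thesis unfolding f_def cutoff_def by measurable
    qed
    then show ?thesis unfolding H_def[abs_def] by (intro borel_measurable_SUP) auto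
  qed
  have "ennreal (norm (Y t \<omega>) ^ (2 * m)) \<le> liminf (\<lambda>n. H n \<omega>)" if \<omega>: "\<omega> \<in> space M" and t: "t
    \<in> {r..T}" for t \<omega>
  proof -
    \<comment> \<open>Rounding up selects the first grid point at or after t, which suits
      right-continuous paths.\<close>
    define i where "i n = nat \<lceil>real (Suc n) * ((t - r) / (T - r))\<rceil>" for n
    define g where "g n = grid n (i n)" for n
    have frac: "0 \<le> (t - r) / (T - r)" "(t - r) / (T - r) \<le> 1" using t rT by auto
    have i: "real (Suc n) * ((t - r) / (T - r)) \<le> real (i n)" "real (i n)
      \<le> real (Suc n) * ((t - r) / (T - r)) + 1"
      "i n \<le> Suc n" for n
    proof -
      have nn: "0 \<le> real (Suc n) * ((t - r) / (T - r))"
        by (rule mult_nonneg_nonneg[OF _ frac(1)]) simp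
      then have eq: "real (i n) = of_int \<lceil>real (Suc n) * ((t - r) / (T - r))\<rceil>" unfolding i_def
        by (intro of_nat_nat) linarith
      show "real (Suc n) * ((t - r) / (T - r)) \<le> real (i n)" "real (i n)
        \<le> real (Suc n) * ((t - r) / (T - r)) + 1"
        unfolding eq by linarith+
      have "real (Suc n) * ((t - r) / (T - r)) \<le> of_int (int (Suc n))"
        using mult_left_le[OF frac(2), of "real (Suc n)"] by simp
      then show "i n \<le> Suc n" unfolding i_def nat_le_iff by (rule ceiling_le)
    qed
    have g_ge: "t \<le> g n" and g_le: "g n \<le> t + (T - r) * inverse (real (Suc n))" for n
    proof -
      define q where "q = (T - r) / real (Suc n)"
      have q: "0 \<le> q" using rT by (simp add: q_def)
      have tq: "real (Suc n) * ((t - r) / (T - r)) * q = t - r" using rT by (simp add: q_def)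
      have "g n = r + real (i n) * q" by (simp add: g_def grid_def q_def)
      moreover have "t - r \<le> real (i n) * q" using mult_right_mono[OF i(1) q, of n] unfolding tq .
      moreover have "real (i n) * q \<le> t - r + q" using mult_right_mono[OF i(2) q, of n]
        unfolding distrib_right tq by simp
      ultimately show "t \<le> g n" "g n \<le> t + (T - r) * inverse (real (Suc n))"
        by (auto simp: q_def divide_inverse)
    qed
    have g_lim: "g \<longlonglongrightarrow> t"
    proof (rule tendsto_sandwich[of "\<lambda>_. t" _ _ "\<lambda>n. t + (T - r) * inverse (real (Suc n))"])
      have "(\<lambda>n. t + (T - r) * inverse (real (Suc n))) \<longlonglongrightarrow> t + (T - r) * 0"
        by (intro tendsto_add tendsto_mult tendsto_const LIMSEQ_inverse_real_of_nat)
      then show "(\<lambda>n. t + (T - r) * inverse (real (Suc n))) \<longlonglongrightarrow> t" by simp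
    qed (use g_ge g_le in \<open>auto intro!: always_eventually\<close>)
    \<comment> \<open>At t = T there is no right limit within the interval, but there the chosen
      grid point is T itself.\<close>
    have Y_lim: "(\<lambda>n. Y (g n) \<omega>) \<longlonglongrightarrow> Y t \<omega>"
    proof (cases "t = T")
      case True
      then have "g n = t" for n using g_ge[of n] grid[OF i(3)[of n]] by (simp add: g_def)
      then show ?thesis by simp
    next
      case False
      then have Yr: "((\<lambda>s. Y s \<omega>) \<longlongrightarrow> Y t \<omega>) (at_right t)" using Y_right[OF \<omega>] t by simp
      show ?thesis
      proof (rule topological_tendstoI)
        fix S assume S: "open S" "Y t \<omega> \<in> S"
        obtain b where b: "t < b" "\<And>s. t < s \<Longrightarrow> s < b \<Longrightarrow> Y s \<omega> \<in> S"
          using topological_tendstoD[OF Yr S] unfolding eventually_at_right_field by blast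
        have "\<forall>\<^sub>F n in sequentially. g n < b" using order_tendstoD(2)[OF g_lim b(1)] .
        then show "\<forall>\<^sub>F n in sequentially. Y (g n) \<omega> \<in> S"
        proof eventually_elim
          case (elim n)
          \<comment> \<open>The right limit says nothing about s = t; grid points that hit t exactly
            are covered by \<open>S(2)\<close>.\<close>
          show ?case using b(2)[of "g n"] elim g_ge[of n] S(2) by (cases "g n = t") auto
        qed
      qed
    qed
    have "(\<lambda>n. radial (weight 0 (real m / 2)) (Y (g n) \<omega>)) \<longlonglongrightarrow> radial (weight 0 (real m / 2)) (Y t \<omega>)"
    proof (rule isCont_tendsto_compose[where g="radial (weight 0 (real m / 2))", OF _ Y_lim])
      show "isCont (radial (weight 0 (real m / 2))) (Y t \<omega>)"
        using continuous_on_radial_weight[of 0 "real m / 2", where 'a="real^'d"]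
          by (simp add: continuous_on_eq_continuous_at)
    qed
    moreover have "(\<lambda>n. radial (cutoff (real (Suc n))) (Y (g n) \<omega>)) \<longlonglongrightarrow> 1"
      by (rule tendsto_cutoff_1[OF tendsto_add[OF tendsto_const tendsto_power[OF tendsto_norm[OF
        Y_lim]]]])
    ultimately have "(\<lambda>n. (radial (f n) (Y (g n) \<omega>))\<^sup>2)
      \<longlonglongrightarrow> (radial (weight 0 (real m / 2)) (Y t \<omega>) * 1)\<^sup>2"
      unfolding f_def by (intro tendsto_power tendsto_mult)
    then have "(\<lambda>n. ennreal ((radial (f n) (Y (g n) \<omega>))\<^sup>2)) \<longlonglongrightarrow> ennreal (w (Y t \<omega>))"
      unfolding w_def by (intro tendsto_ennrealI) (simp add: weight_0_half_sq[OF xpos])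
    then have "ennreal (w (Y t \<omega>)) = liminf (\<lambda>n. ennreal ((radial (f n) (Y (g n) \<omega>))\<^sup>2))"
      by (intro lim_imp_Liminf[symmetric]) simp_all
    also have "\<dots> \<le> liminf (\<lambda>n. H n \<omega>)"
      unfolding H_def g_def using i(3) by (intro Liminf_mono always_eventually allI SUP_upper) auto
    finally show ?thesis using ennreal_leI[OF norm_w] by (rule order_trans[rotated])
  qed
  then have "(\<integral>\<^sup>+\<omega>. (SUP t\<in>{r..T}. ennreal (norm (Y t \<omega>) ^ (2 * m))) \<partial>M)
    \<le> (\<integral>\<^sup>+\<omega>. liminf (\<lambda>n. H n \<omega>) \<partial>M)"
    by (intro nn_integral_mono SUP_least)
  also have "\<dots> \<le> liminf (\<lambda>n. \<integral>\<^sup>+\<omega>. H n \<omega> \<partial>M)" by (rule nn_integral_liminf[OF H_meas])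
  also have "\<dots> \<le> liminf (\<lambda>n. E)" by (intro Liminf_mono always_eventually allI H_int)
  also have "\<dots> < \<infinity>" using E by (simp add: Liminf_const)
  finally show ?thesis .
qed

text \<open>Finiteness of the initial moment in \<open>init\<close> is also necessary, because the
  supremum includes the time r; the estimate propagates it over [r, T].\<close>

theorem theorem3p2:
  fixes T a r :: real and K m :: nat
    and \<nu> :: "(real^'n) measure"
    and \<mu> :: "real \<Rightarrow> real^'d \<Rightarrow> nat \<Rightarrow> real^'d"
    and \<sigma> :: "real \<Rightarrow> real^'d \<Rightarrow> nat \<Rightarrow> real^'p^'d"
    and F :: "real \<Rightarrow> real^'d \<Rightarrow> nat \<Rightarrow> real^'n \<Rightarrow> real^'d"
    and \<rho> :: "nat \<Rightarrow> nat \<Rightarrow> real \<Rightarrow> real^'d \<Rightarrow> real^'d"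
    and lam :: "nat \<Rightarrow> nat \<Rightarrow> real \<Rightarrow> real^'d \<Rightarrow> real"
    and M :: "'w measure"
    and Y :: "real \<Rightarrow> 'w \<Rightarrow> real^'d"
    and C :: "real \<Rightarrow> 'w \<Rightarrow> nat"
  assumes "0 < T" and "0 < a" and "1 \<le> K" and "0 \<le> r" and "r < T"
    and coeffs: "standing_assumptions T a K \<nu> \<mu> \<sigma> F \<rho> lam"
    and LMP: "solves_local_martingale_problem M r T K (generator a K \<nu> \<mu> \<sigma> F \<rho> lam) Y C"
    and init: "(\<integral>\<^sup>+\<omega>. ennreal (norm (Y r \<omega>) ^ (2 * m)) \<partial>M) < \<infinity>"
    and LB: "locally_bounded_on ({r..T} \<times> UNIV \<times> {1..K})
               (\<lambda>(t, y, c). \<integral>\<^sup>+x\<in>{x. norm (F t y c x) > 1}. ennreal (norm (F t y c x)) \<partial>\<nu>)"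
    and LG: "\<exists>K1>0. \<forall>t\<in>{r..T}. \<forall>y. \<forall>c\<in>{1..K}.
               ennreal ((norm (\<mu> t y c))\<^sup>2 + norm (\<sigma> t y c ** transpose (\<sigma> t y c)))
               + (\<integral>\<^sup>+x\<in>{x. norm x \<le> a}. ennreal ((norm (F t y c x))\<^sup>2) \<partial>\<nu>)
               \<le> ennreal (K1 * (1 + (norm y)\<^sup>2))"
    and growth_2: "\<exists>K3\<ge>0. \<forall>t\<in>{r..T}. \<forall>y. \<forall>c\<in>{1..K}. \<forall>k\<in>{1..K} - {c}.
               (\<integral>\<^sup>+x\<in>{x. norm x > a}. ennreal ((norm (F t y c x))\<^sup>2) \<partial>\<nu>)
               + ennreal ((norm (\<rho> c k t y))\<^sup>2)
               \<le> ennreal (K3 * (1 + (norm y)\<^sup>2))"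
    and growth_2m: "\<exists>K4\<ge>0. \<forall>t\<in>{r..T}. \<forall>y. \<forall>c\<in>{1..K}.
               (\<integral>\<^sup>+x. ennreal (norm (F t y c x) ^ (2 * m)) \<partial>\<nu>)
               \<le> ennreal (K4 * (1 + norm y ^ (2 * m)))"
  shows "(\<integral>\<^sup>+\<omega>. (SUP t\<in>{r..T}. ennreal (norm (Y t \<omega>) ^ (2 * m))) \<partial>M) < \<infinity>"
proof (cases "m = 0")
  \<comment> \<open>For m = 0 the integrand is the constant 1; the bound on the generator is stated
    for m >= 1.\<close>
  case True
  have "prob_space M" using LMP unfolding solves_local_martingale_problem_def by blast
  then interpret prob_space M .
  have "(\<integral>\<^sup>+\<omega>. (SUP t\<in>{r..T}. ennreal (norm (Y t \<omega>) ^ (2 * m))) \<partial>M) \<le> (\<integral>\<^sup>+\<omega>. 1 \<partial>M)"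
    using True by (intro nn_integral_mono SUP_least) simp
  also have "\<dots> < \<infinity>" by (simp add: emeasure_space_1)
  finally show ?thesis .
next
  case False
  then have "1 \<le> m" by simp
  obtain L where L: "0 \<le> L" "\<forall>W f f1 f2. moderate_weight m W \<longrightarrow> scaled_C2 W f f1 f2 \<longrightarrow>
    (\<forall>t\<in>{r..T}. \<forall>y. \<forall>c\<in>{1..K}.
       \<bar>generator a K \<nu> \<mu> \<sigma> F \<rho> lam t (\<lambda>y c. radial f y) y c\<bar> \<le> L * radial W y)"
    using generator_radial_bound[OF \<open>0 < a\<close> \<open>0 \<le> r\<close> \<open>1 \<le> m\<close> coeffs LG growth_2 growth_2m]
    by (elim exE conjE) (rule that)
  have "prob_space M" using LMP unfolding solves_local_martingale_problem_def by blast
  then interpret bounded_generator M r T K m "generator a K \<nu> \<mu> \<sigma> F \<rho> lam" Y C L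
    by (intro bounded_generator.intro bounded_generator_axioms.intro \<open>r < T\<close> LMP L(1)
      L(2)[rule_format])
  show ?thesis by (rule sup_moment_finite[OF init])
qed

end
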